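(* Let $n\ge 2$, let $\psi\in L^2(\mathbb R^n)$ be an admissible shearlet with admissibility constant $C_\psi$, and let $0\le\lambda<1$. Then for every Schwartz function $f\in\mathcal S(\mathbb R^n)\subseteq L^2(\mathbb R^n)$, $$C_{\psi}\int_{\mathbb R^{n}}|\xi|^{-\lambda}\,|\hat f(\xi)|^2\,d\xi\;\le\; C_{\lambda}\int_{\mathbb S}|t|^{\lambda}\,\big|\mathcal{SH}_{\psi}f(a,s,t)\big|^2\,d\eta,$$ where $$C_{\lambda}=\pi^{\lambda}\left[\Gamma\!\left(\frac{n-\lambda}{4}\right)\Big/\Gamma\!\left(\frac{n+\lambda}{4}\right)\right]^2 .$$
   Context: Fourier transform: $\hat f(\xi)=\mathscr F[f](\xi)=\int_{\mathbb R^n}f(x)e^{-2\pi i\,\xi\cdot x}\,dx$, extended to $L^2(\mathbb R^n)$ by Plancherel. $|\cdot|$ is the Euclidean norm on $\mathbb R^n$, and $\Gamma$ is Euler's gamma function. For $a\in\mathbb R\setminus\{0\}$ and $s\in\mathbb R^{n-1}$ let $$A_a=\begin{pmatrix} a & 0\\ 0 & \operatorname{sgn}(a)|a|^{1/n}I_{n-1}\end{pmatrix},\qquad S_s=\begin{pmatrix}1 & s^T\\ 0 & I_{n-1}\end{pmatrix},\qquad M_{sa}=S_sA_a,$$ so $|\det M_{sa}|=|\det A_a|=|a|^{2-1/n}$. For $\psi\in L^2(\mathbb R^n)$ and $t\in\mathbb R^n$ put $\psi_{a,s,t}(x)=|\det M_{sa}|^{-1/2}\psi\big(M_{sa}^{-1}(x-t)\big)$.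 The continuous shearlet transform of $f\in L^2(\mathbb R^n)$ is $\mathcal{SH}_\psi f(a,s,t)=\langle f,\psi_{a,s,t}\rangle=\int_{\mathbb R^n}f(x)\overline{\psi_{a,s,t}(x)}\,dx$. Let $\mathbb S=(\mathbb R\setminus\{0\})\times\mathbb R^{n-1}\times\mathbb R^n$ with the measure $d\eta=\dfrac{da\,ds\,dt}{|a|^{n+1}}$. The function $\psi\in L^2(\mathbb R^n)$ is an admissible shearlet if $$C_\psi=\int_{\mathbb R^{n-1}}\int_{\mathbb R\setminus\{0\}}\frac{|\hat\psi(M_{sa}^T\xi)|^2}{|a|^{(n^2-n+1)/n}}\,da\,ds<\infty;$$ this quantity has the same value for every $\xi\in\mathbb R^n$ with $\xi_1\neq0$. *)

theory Defs
  imports "HOL-Analysis.Analysis"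
begin

definition square_integrable :: "('a::euclidean_space \<Rightarrow> complex) \<Rightarrow> bool" where
  "square_integrable f \<longleftrightarrow>
     f \<in> borel_measurable borel \<and> integrable lborel (\<lambda>x. (norm (f x))\<^sup>2)"

definition fourier :: "('a::euclidean_space \<Rightarrow> complex) \<Rightarrow> 'a \<Rightarrow> complex" where
  "fourier f \<xi> = (LINT x|lborel. f x * exp (- 2 * complex_of_real pi * \<i> * complex_of_real (\<xi> \<bullet> x)))"

text \<open>The extension of the Fourier integral to square integrable functions by \<open>L\<^sup>2\<close>-continuity:
  \<open>g\<close> is the \<open>L\<^sup>2\<close>-limit of the Fourier integrals of functions in \<open>L\<^sup>1 \<inter> L\<^sup>2\<close> converging to \<open>f\<close>
  in \<open>L\<^sup>2\<close>. By Plancherel's theorem, such a \<open>g\<close> exists for every square integrable \<open>f\<close> and is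
  unique up to null sets; the function \<open>fourier_L2\<close> selects one representative.\<close>

definition is_fourier_L2 :: "('a::euclidean_space \<Rightarrow> complex) \<Rightarrow> ('a \<Rightarrow> complex) \<Rightarrow> bool" where
  "is_fourier_L2 f g \<longleftrightarrow> square_integrable g \<and>
     (\<exists>u :: nat \<Rightarrow> 'a \<Rightarrow> complex.
        (\<forall>k. integrable lborel (u k) \<and> square_integrable (u k)) \<and>
        (\<lambda>k. \<integral>\<^sup>+x. ennreal ((norm (u k x - f x))\<^sup>2) \<partial>lborel) \<longlonglongrightarrow> 0 \<and>
        (\<lambda>k. \<integral>\<^sup>+\<xi>. ennreal ((norm (fourier (u k) \<xi> - g \<xi>))\<^sup>2) \<partial>lborel) \<longlonglongrightarrow> 0)"

definition fourier_L2 :: "('a::euclidean_space \<Rightarrow> complex) \<Rightarrow> 'a \<Rightarrow> complex" where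
  "fourier_L2 f = (SOME g. is_fourier_L2 f g)"

primrec iter_partial :: "'a::euclidean_space list \<Rightarrow> ('a \<Rightarrow> complex) \<Rightarrow> 'a \<Rightarrow> complex" where
  "iter_partial [] f = f"
| "iter_partial (b # bs) f = (\<lambda>x. frechet_derivative (iter_partial bs f) (at x) b)"

text \<open>Lists of standard basis vectors play the role of multi-indices.\<close>

definition schwartz :: "('a::euclidean_space \<Rightarrow> complex) \<Rightarrow> bool" where
  "schwartz f \<longleftrightarrow>
     (\<forall>bs. set bs \<subseteq> Basis \<longrightarrow>
        (\<forall>x. iter_partial bs f differentiable (at x)) \<and>
        (\<forall>k::nat. \<exists>C. \<forall>x. norm x ^ k * norm (iter_partial bs f x) \<le> C))"

text \<open>The space \<open>\<real>\<^sup>n\<close> with \<open>n \<ge> 2\<close> is \<open>real ^ ('m option)\<close>, where \<open>n = CARD('m) + 1\<close>: the index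
  \<open>None\<close> is the first coordinate, and the indices \<open>Some i\<close> are the remaining \<open>n - 1\<close> coordinates,
  so that \<open>\<real>\<^sup>n\<^sup>-\<^sup>1\<close> is \<open>real ^ 'm\<close>.\<close>

definition dilation_matrix :: "real \<Rightarrow> real ^ ('m::finite option) ^ ('m option)" where
  "dilation_matrix a = (\<chi> i j.
     if i \<noteq> j then 0
     else if i = None then a
     else sgn a * \<bar>a\<bar> powr (1 / real CARD('m option)))"

definition shear_matrix :: "real ^ 'm::finite \<Rightarrow> real ^ ('m option) ^ ('m option)" where
  "shear_matrix s = (\<chi> i j.
     if i = j then 1
     else (case (i, j) of (None, Some k) \<Rightarrow> s $ k | _ \<Rightarrow> 0))"

definition shearlet_matrix :: "real \<Rightarrow> real ^ 'm::finite \<Rightarrow> real ^ ('m option) ^ ('m option)" where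
  "shearlet_matrix a s = shear_matrix s ** dilation_matrix a"

definition shearlet ::
    "(real ^ ('m::finite option) \<Rightarrow> complex) \<Rightarrow> real \<Rightarrow> real ^ 'm \<Rightarrow> real ^ ('m option) \<Rightarrow>
     real ^ ('m option) \<Rightarrow> complex" where
  "shearlet \<psi> a s t x =
     complex_of_real (\<bar>det (shearlet_matrix a s)\<bar> powr (- 1 / 2)) *
     \<psi> (matrix_inv (shearlet_matrix a s) *v (x - t))"

definition shearlet_transform ::
    "(real ^ ('m::finite option) \<Rightarrow> complex) \<Rightarrow> (real ^ ('m option) \<Rightarrow> complex) \<Rightarrow>
     real \<Rightarrow> real ^ 'm \<Rightarrow> real ^ ('m option) \<Rightarrow> complex" where
  "shearlet_transform \<psi> f a s t = (LINT x|lborel. f x * cnj (shearlet \<psi> a s t x))"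

definition shearlet_measure :: "(real \<times> (real ^ 'm::finite) \<times> (real ^ ('m option))) measure" where
  "shearlet_measure =
     density (restrict_space lborel {(a, s, t). a \<noteq> 0})
       (\<lambda>(a, s, t). ennreal (1 / \<bar>a\<bar> ^ (CARD('m option) + 1)))"

text \<open>The admissibility integral at the frequency \<open>\<xi>\<close>. It takes the same value at all \<open>\<xi>\<close> whose
  first coordinate is nonzero, and this common value is the admissibility constant of \<open>\<psi>\<close>.\<close>

definition admissibility_integral ::
    "(real ^ ('m::finite option) \<Rightarrow> complex) \<Rightarrow> real ^ ('m option) \<Rightarrow> ennreal" where
  "admissibility_integral \<psi> \<xi> =
     (let n = real CARD('m option) in
      \<integral>\<^sup>+s. (\<integral>\<^sup>+a\<in>{a. a \<noteq> 0}.
        ennreal ((norm (fourier_L2 \<psi> (transpose (shearlet_matrix a s) *v \<xi>)))\<^sup>2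
                 / \<bar>a\<bar> powr ((n\<^sup>2 - n + 1) / n)) \<partial>lborel) \<partial>lborel)"

text \<open>Since the admissibility integral is the same for all \<open>\<xi>\<close> with nonzero first coordinate,
  finiteness for one such \<open>\<xi>\<close> amounts to finiteness for all of them.\<close>

definition admissible_shearlet :: "(real ^ ('m::finite option) \<Rightarrow> complex) \<Rightarrow> bool" where
  "admissible_shearlet \<psi> \<longleftrightarrow> square_integrable \<psi> \<and>
     (\<exists>\<xi>. \<xi> $ None \<noteq> 0 \<and> admissibility_integral \<psi> \<xi> < \<infinity>)"

definition pitt_const :: "nat \<Rightarrow> real \<Rightarrow> real" where
  "pitt_const n lam =
     pi powr lam * (Gamma ((real n - lam) / 4) / Gamma ((real n + lam) / 4))\<^sup>2"

end

theory Submission imports Defs "HOL-Probability.Characteristic_Functions"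
begin

text \<open>
  For fixed \<open>a\<close> and \<open>s\<close>, the function \<open>t \<mapsto> SH f (a, s, t)\<close> is the correlation of \<open>f\<close> with a dilate of \<open>\<psi>\<close>.
  Its Fourier transform is the product of that of \<open>f\<close> with the conjugate of
  \<open>|det M|\<^sup>1\<^sup>/\<^sup>2 fourier_L2 \<psi> (M\<^sup>T \<xi>)\<close>. Pitt's inequality with sharp constant, applied in \<open>t\<close> and integrated over
  \<open>a\<close> and \<open>s\<close> by Tonelli, yields the theorem, because the integral of the dilates of \<open>|fourier_L2 \<psi>|\<^sup>2\<close> is
  the admissibility constant for almost every \<open>\<xi>\<close>.

  For Pitt's inequality, \<open>|\<xi>|\<^sup>-\<^sup>\<lambda>\<close> is a superposition of the Gaussians \<open>exp (- \<pi> t |\<xi>|\<^sup>2)\<close>, and the Gaussian mean of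
  \<open>|fourier u|\<^sup>2\<close> is a quadratic form of the heat kernel in \<open>u\<close>. The Schur test with the weight
  \<open>|x|\<^sup>-\<^sup>(\<^sup>n\<^sup>+\<^sup>\<lambda>\<^sup>)\<^sup>/\<^sup>2\<close> gives the sharp constant, as the heat semigroup reduces the Schur integral to a Beta integral. The case
  \<open>\<lambda> = 0\<close> is Bessel's inequality, which also replaces Plancherel's theorem everywhere else.
\<close>

section \<open>Gaussians and the heat kernel\<close>

text \<open>The correlation of \<open>f\<close> with a dilate of \<open>\<psi>\<close> is in general
  only square integrable, so its transform exists merely as an L2 limit, and
  \<open>fourier_L2\<close> picks an unspecified representative. Hence the relation
  \<open>is_fourier_L2\<close> carries the argument: Pitt's inequality is proved for every
  \<open>g\<close> related to a function, and the dilation rule and the product rule assert that an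
  explicit function is related to a given one. Uniqueness of the transform never enters. One-sided
  norm bounds are enough, because limits are taken by Fatou's lemma and error terms only have to
  vanish. Gaussian means keep all double integrals nonnegative, so Tonelli applies without
  integrability conditions, even to the weight w(x) = |x|^(-(n+\<lambda>)/2), which is not
  integrable. Its exponent is the borderline one: |x|^\<lambda> w(x)^2 = |x|^(-n) diverges only
  logarithmically at 0 and at infinity, so that w is formally an extremal and the Schur test loses
  nothing in the constant.\<close>

text \<open>With t = 4 pi \<tau> this is the classical heat kernel at time \<tau>. The parameter is
  normalised so that the kernel is the Fourier transform of exp(-pi t |u|^2).\<close>

definition heat_kernel :: "real \<Rightarrow> 'a::euclidean_space \<Rightarrow> real" where
  "heat_kernel t x = t powr (- (real DIM('a) / 2)) * exp (- pi * (norm x)\<^sup>2 / t)"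

lemma heat_kernel_nonneg [simp]: "0 \<le> heat_kernel t x"
  by (simp add: heat_kernel_def)

lemma heat_kernel_measurable [measurable]:
  "(\<lambda>(t, x). heat_kernel t x) \<in> borel_measurable (borel \<Otimes>\<^sub>M borel)"
  unfolding heat_kernel_def case_prod_beta by measurable

text \<open>The characteristic function of the standard normal law, rescaled: v = c u with c =
  sqrt(2 pi t) turns v^2/2 into pi t u^2.\<close>

lemma has_bochner_integral_gaussian_fourier_real:
  fixes x t :: real
  assumes "t > 0"
  shows "has_bochner_integral lborel
     (\<lambda>u. complex_of_real (exp (- pi * t * u\<^sup>2)) * exp (- 2 * complex_of_real pi * \<i> * complex_of_real (x * u)))
     (complex_of_real (t powr (- 1 / 2) * exp (- pi * x\<^sup>2 / t)))"
proof -
  interpret real_distribution std_normal_distribution by (rule real_dist_normal_dist)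
  have *: "has_bochner_integral lborel (\<lambda>v. std_normal_density v *\<^sub>R iexp (s * v))
      (complex_of_real (exp (- (s^2) / 2)))" for s
  proof -
    have "integrable std_normal_distribution (\<lambda>v. iexp (s * v))" by (rule integrable_iexp) auto
    then have 1: "integrable lborel (\<lambda>v. std_normal_density v *\<^sub>R iexp (s * v))"
      by (subst (asm) integrable_density) auto
    have "(CLINT v|std_normal_distribution. iexp (s * v)) = complex_of_real (exp (- (s^2) / 2))"
      using char_std_normal_distribution unfolding char_def by metis
    then have 2: "integral\<^sup>L lborel (\<lambda>v. std_normal_density v *\<^sub>R iexp (s * v)) = complex_of_real (exp (- (s^2) / 2))"
      by (subst (asm) integral_density) auto
    show ?thesis using 1 2 by (simp add: has_bochner_integral_iff)
  qed
  define c where "c = sqrt (2 * pi * t)"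
  have c: "c > 0" "c\<^sup>2 = 2 * pi * t" using assms by (auto simp: c_def)
  have "has_bochner_integral lborel (\<lambda>v. std_normal_density (0 + c * v) *\<^sub>R iexp (- (2 * pi * x / c) * (0 + c * v)))
      (complex_of_real (exp (- ((- (2 * pi * x / c))^2) / 2)) /\<^sub>R \<bar>c\<bar>)"
    using * [of "- (2 * pi * x / c)"] c by (subst (asm) lborel_has_bochner_integral_real_affine_iff[of c _ _ 0]) auto
  then have "has_bochner_integral lborel (\<lambda>v. complex_of_real (sqrt (2 * pi)) * (std_normal_density (0 + c * v) *\<^sub>R iexp (- (2 * pi * x / c) * (0 + c * v))))
      (complex_of_real (sqrt (2 * pi)) * (complex_of_real (exp (- ((- (2 * pi * x / c))^2) / 2)) /\<^sub>R \<bar>c\<bar>))"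
    by (intro has_bochner_integral_mult_right) auto
  moreover have "complex_of_real (sqrt (2 * pi)) * (std_normal_density (0 + c * v) *\<^sub>R iexp (- (2 * pi * x / c) * (0 + c * v)))
     = complex_of_real (exp (- pi * t * v\<^sup>2)) * exp (- 2 * complex_of_real pi * \<i> * complex_of_real (x * v))" for v
  proof -
    have "sqrt (2 * pi) * std_normal_density (0 + c * v) = exp (- pi * t * v\<^sup>2)"
      by (simp add: std_normal_density_def power_mult_distrib c)
    moreover have "- (2 * pi * x / c) * (0 + c * v) = - 2 * pi * (x * v)"
      using c by (simp add: field_simps)
    ultimately have "complex_of_real (exp (- pi * t * v\<^sup>2)) * iexp (- 2 * pi * (x * v))
        = complex_of_real (sqrt (2 * pi)) * (std_normal_density (0 + c * v) *\<^sub>R iexp (- (2 * pi * x / c) * (0 + c * v)))"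
      by (simp only: scaleR_conv_of_real mult.assoc[symmetric] of_real_mult[symmetric])
    then show ?thesis by (simp add: ac_simps)
  qed
  moreover have "complex_of_real (sqrt (2 * pi)) * (complex_of_real (exp (- ((- (2 * pi * x / c))^2) / 2)) /\<^sub>R \<bar>c\<bar>)
    = complex_of_real (t powr (- 1 / 2) * exp (- pi * x\<^sup>2 / t))"
  proof -
    have "sqrt (2 * pi) / c = t powr (- 1 / 2)"
      using assms by (simp add: c_def real_sqrt_mult powr_minus_divide powr_half_sqrt)
    moreover have "- ((- (2 * pi * x / c))^2) / 2 = - pi * x\<^sup>2 / t"
      using assms by (simp add: power_divide c power_mult_distrib) (simp add: power2_eq_square field_simps)
    ultimately have "sqrt (2 * pi) * (exp (- ((- (2 * pi * x / c))^2) / 2) / c) = t powr (- 1 / 2) * exp (- pi * x\<^sup>2 / t)"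
      by (metis times_divide_eq_left times_divide_eq_right mult.commute)
    moreover have "complex_of_real (sqrt (2 * pi)) * (complex_of_real (exp (- ((- (2 * pi * x / c))^2) / 2)) /\<^sub>R \<bar>c\<bar>)
       = complex_of_real (sqrt (2 * pi) * (exp (- ((- (2 * pi * x / c))^2) / 2) / c))"
      using \<open>c > 0\<close> unfolding scaleR_conv_of_real of_real_mult[symmetric] divide_inverse by (simp only: abs_of_pos mult.commute)
    ultimately show ?thesis by metis
  qed
  ultimately show ?thesis by (simp only:)
qed

text \<open>Lebesgue measure is the image of a product of one-dimensional ones, so Fubini factors
  the integral. This lifts the one-dimensional Gaussian computation to all dimensions.\<close>

lemma has_bochner_integral_prod_Basis:
  fixes g :: "'a::euclidean_space \<Rightarrow> real \<Rightarrow> complex"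
  assumes "\<And>b. b \<in> Basis \<Longrightarrow> has_bochner_integral lborel (g b) (I b)"
  shows "has_bochner_integral lborel (\<lambda>x. \<Prod>b\<in>Basis. g b (x \<bullet> b)) (\<Prod>b\<in>Basis. I b)"
proof -
  interpret product_sigma_finite "\<lambda>b::'a. lborel :: real measure" ..
  have int: "integrable lborel (g b)" if "b \<in> Basis" for b using assms[OF that] by (rule integrable.intros)
  have [measurable]: "g b \<in> borel_measurable borel" if "b \<in> Basis" for b using int[OF that] by auto
  have eq: "(lborel :: 'a measure) = distr (\<Pi>\<^sub>M b\<in>Basis. lborel) borel (\<lambda>f. \<Sum>b\<in>Basis. f b *\<^sub>R b)"
    unfolding lborel_def[where 'a='a] lborel_eq_real[symmetric] ..
  have m: "(\<lambda>x. \<Prod>b\<in>Basis. g b (x \<bullet> b)) \<in> borel_measurable (borel :: 'a measure)"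
    by (intro borel_measurable_prod) measurable
  have m2: "(\<lambda>f. \<Sum>b\<in>Basis. f b *\<^sub>R b) \<in> (\<Pi>\<^sub>M b\<in>Basis. lborel) \<rightarrow>\<^sub>M (borel :: 'a measure)"
    by measurable
  have s: "(\<Prod>b\<in>Basis. g b ((\<Sum>b\<in>Basis. f b *\<^sub>R b) \<bullet> b)) = (\<Prod>b\<in>Basis. g b (f b))" for f
    by (intro prod.cong) (auto simp: inner_sum_left_Basis)
  have "has_bochner_integral (\<Pi>\<^sub>M b\<in>Basis. lborel) (\<lambda>f. \<Prod>b\<in>Basis. g b (f b)) (\<Prod>b\<in>Basis. I b)"
    unfolding has_bochner_integral_iff using int
    by (auto intro!: product_integrable_prod simp: product_integral_prod has_bochner_integral_integral_eq[OF assms])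
  then show ?thesis
    by (subst eq, subst has_bochner_integral_distr[OF _ m2 ]) (use m in \<open>auto simp: s\<close>)
qed

lemma has_bochner_integral_gaussian_fourier:
  fixes x :: "'a::euclidean_space"
  assumes "t > 0"
  shows "has_bochner_integral lborel
     (\<lambda>u. complex_of_real (exp (- pi * t * (norm u)\<^sup>2)) * exp (- 2 * complex_of_real pi * \<i> * complex_of_real (x \<bullet> u)))
     (complex_of_real (heat_kernel t x))"
proof -
  have "has_bochner_integral lborel
     (\<lambda>u. \<Prod>b\<in>Basis. complex_of_real (exp (- pi * t * (u \<bullet> b)\<^sup>2)) * exp (- 2 * complex_of_real pi * \<i> * complex_of_real ((x \<bullet> b) * (u \<bullet> b))))
     (\<Prod>b\<in>Basis. complex_of_real (t powr (- 1 / 2) * exp (- pi * (x \<bullet> b)\<^sup>2 / t)))"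
    by (rule has_bochner_integral_prod_Basis
       [of "\<lambda>b u. complex_of_real (exp (- pi * t * u\<^sup>2)) * exp (- 2 * complex_of_real pi * \<i> * complex_of_real ((x \<bullet> b) * u))"])
      (rule has_bochner_integral_gaussian_fourier_real[OF assms])
  moreover have "(\<Prod>b\<in>Basis. complex_of_real (exp (- pi * t * (u \<bullet> b)\<^sup>2)) * exp (- 2 * complex_of_real pi * \<i> * complex_of_real ((x \<bullet> b) * (u \<bullet> b))))
     = complex_of_real (exp (- pi * t * (norm u)\<^sup>2)) * exp (- 2 * complex_of_real pi * \<i> * complex_of_real (x \<bullet> u))" for u
    unfolding prod.distrib of_real_prod[symmetric]
    by (subst (3) euclidean_inner, subst power2_norm_eq_inner, subst (3) euclidean_inner)
      (simp only: exp_sum[symmetric] finite_Basis sum_distrib_left power2_eq_square of_real_sum)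
  moreover have "(\<Prod>b\<in>(Basis::'a set). complex_of_real (t powr (- 1 / 2) * exp (- pi * (x \<bullet> b)\<^sup>2 / t)))
     = complex_of_real (heat_kernel t x)"
  proof -
    have "(\<Prod>b\<in>(Basis::'a set). exp (- pi * (x \<bullet> b)\<^sup>2 / t)) = exp (- pi * (norm x)\<^sup>2 / t)"
      by (subst power2_norm_eq_inner, subst (2) euclidean_inner)
        (simp only: exp_sum[symmetric] finite_Basis sum_distrib_left power2_eq_square sum_divide_distrib)
    moreover have "(\<Prod>b\<in>(Basis::'a set). t powr (- 1 / 2)) = t powr (- (real DIM('a) / 2))"
      using assms by (simp add: powr_realpow[symmetric] powr_powr)
    ultimately show ?thesis
      unfolding of_real_prod[symmetric] prod.distrib heat_kernel_def by simp
  qed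
  ultimately show ?thesis by simp
qed

lemma nn_integral_gaussian:
  assumes "t > 0"
  shows "(\<integral>\<^sup>+u. ennreal (exp (- pi * t * (norm u)\<^sup>2)) \<partial>(lborel :: 'a::euclidean_space measure)) = ennreal (t powr (- (real DIM('a) / 2)))"
proof -
  have "has_bochner_integral lborel (\<lambda>u::'a. complex_of_real (exp (- pi * t * (norm u)\<^sup>2))) (complex_of_real (heat_kernel t (0 :: 'a)))"
    using has_bochner_integral_gaussian_fourier[OF assms, of "0 :: 'a"] by simp
  then have "has_bochner_integral lborel (\<lambda>u::'a. Re (complex_of_real (exp (- pi * t * (norm u)\<^sup>2)))) (Re (complex_of_real (heat_kernel t (0 :: 'a))))"
    by (rule has_bochner_integral_Re)
  then have "has_bochner_integral lborel (\<lambda>u::'a. exp (- pi * t * (norm u)\<^sup>2)) (t powr (- (real DIM('a) / 2)))"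
    by (simp add: heat_kernel_def)
  then show ?thesis
    by (subst nn_integral_eq_integral) (auto simp: has_bochner_integral_iff)
qed

section \<open>Translations, dilations and reflections under the Lebesgue integral\<close>

lemma nn_integral_lborel_shift:
  fixes f :: "'a::euclidean_space \<Rightarrow> ennreal"
  assumes [measurable]: "f \<in> borel_measurable borel"
  shows "(\<integral>\<^sup>+x. f (c + x) \<partial>lborel) = (\<integral>\<^sup>+x. f x \<partial>lborel)"
  by (subst (2) lborel_distr_plus[of c, symmetric]) (simp add: nn_integral_distr)

lemma nn_integral_lborel_scale:
  fixes f :: "'a::euclidean_space \<Rightarrow> ennreal"
  assumes [measurable]: "f \<in> borel_measurable borel" and "c \<noteq> 0"
  shows "(\<integral>\<^sup>+x. f x \<partial>lborel) = ennreal (\<bar>c\<bar> ^ DIM('a)) * (\<integral>\<^sup>+x. f (c *\<^sub>R x) \<partial>lborel)"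
  by (subst lborel_affine[OF \<open>c \<noteq> 0\<close>, of 0]) (simp add: nn_integral_density nn_integral_distr nn_integral_cmult)

lemma nn_integral_lborel_affine:
  fixes h :: "'a::euclidean_space \<Rightarrow> ennreal"
  assumes [measurable]: "h \<in> borel_measurable borel" and "c \<noteq> 0"
  shows "(\<integral>\<^sup>+y. h (c *\<^sub>R (t + y)) \<partial>lborel) = ennreal (1 / \<bar>c\<bar> ^ DIM('a)) * (\<integral>\<^sup>+y. h y \<partial>lborel)"
proof -
  have "(\<integral>\<^sup>+y. h (c *\<^sub>R (t + y)) \<partial>lborel) = (\<integral>\<^sup>+y. h (c *\<^sub>R y) \<partial>lborel)"
    by (rule nn_integral_lborel_shift[of "\<lambda>y. h (c *\<^sub>R y)"]) measurable
  moreover have "ennreal (1 / \<bar>c\<bar> ^ DIM('a)) * (\<integral>\<^sup>+y. h y \<partial>lborel) = (\<integral>\<^sup>+y. h (c *\<^sub>R y) \<partial>lborel)"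
    using assms(2) by (subst nn_integral_lborel_scale[OF assms]) (simp add: mult.assoc[symmetric] ennreal_mult[symmetric])
  ultimately show ?thesis by simp
qed

lemma nn_integral_lborel_reflect:
  fixes f :: "'a::euclidean_space \<Rightarrow> ennreal"
  assumes [measurable]: "f \<in> borel_measurable borel"
  shows "(\<integral>\<^sup>+x. f (c - x) \<partial>lborel) = (\<integral>\<^sup>+x. f x \<partial>lborel)"
  using nn_integral_lborel_scale[of "\<lambda>x. f (c + x)" "-1"] nn_integral_lborel_shift[of f c] by simp

text \<open>Completing the square in \<open>y\<close>: the two exponents combine to a Gaussian
  centred at \<open>m\<close> with rate r = 1/s + 1/t, times a factor in \<open>x\<close> alone. Its
  mass r^(-n/2) turns (s t)^(-n/2) into (s + t)^(-n/2).\<close>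

lemma heat_kernel_semigroup:
  fixes x :: "'a::euclidean_space"
  assumes "s > 0" "t > 0"
  shows "(\<integral>\<^sup>+y. ennreal (heat_kernel t (x - y)) * ennreal (heat_kernel s y) \<partial>lborel) = ennreal (heat_kernel (s + t) x)"
proof -
  define r where "r = (s + t) / (s * t)"
  define m where "m = (s / (s + t)) *\<^sub>R x"
  have r: "r > 0" using assms by (simp add: r_def)
  have sq: "(norm (x - y))\<^sup>2 / t + (norm y)\<^sup>2 / s = r * (norm (y - m))\<^sup>2 + (norm x)\<^sup>2 / (s + t)" for y
  proof -
    define X Y Z where "X = x \<bullet> x" and "Y = y \<bullet> y" and "Z = x \<bullet> y"
    have "(norm (x - y))\<^sup>2 = X + Y - 2 * Z"
      by (simp add: power2_norm_eq_inner inner_diff_left inner_diff_right inner_commute X_def Y_def Z_def)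
    moreover have "(norm (y - m))\<^sup>2 = Y - 2 * (s / (s + t)) * Z + (s / (s + t))\<^sup>2 * X"
    proof -
      have "(norm (y - c *\<^sub>R x))\<^sup>2 = Y - 2 * c * Z + c\<^sup>2 * X" for c
        unfolding power2_norm_eq_inner X_def Y_def Z_def inner_diff_left inner_diff_right
          inner_scaleR_left inner_scaleR_right inner_commute[of y x]
        by (simp add: power2_eq_square algebra_simps)
      then show ?thesis unfolding m_def .
    qed
    moreover have "(norm x)\<^sup>2 = X" "(norm y)\<^sup>2 = Y" by (simp_all add: X_def Y_def power2_norm_eq_inner)
    moreover have "(X + Y - 2 * Z) / t + Y / s = r * (Y - 2 * (s / (s + t)) * Z + (s / (s + t))\<^sup>2 * X) + X / (s + t)"
    proof -
      have st: "s + t \<noteq> 0" using assms by simp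
      have "r * (s / (s + t)) = 1 / t" "r * (s / (s + t))\<^sup>2 = s / (t * (s + t))"
        using assms st by (simp_all add: r_def power2_eq_square)
      have "r * (Y - 2 * (s / (s + t)) * Z + (s / (s + t))\<^sup>2 * X) = r * Y - 2 / t * Z + s / (t * (s + t)) * X"
      proof -
        have "r * (Y - 2 * q * Z + q\<^sup>2 * X) = r * Y - 2 * (r * q) * Z + (r * q\<^sup>2) * X" for q
          by (simp add: algebra_simps)
        then show ?thesis
          by (simp only: \<open>r * (s / (s + t)) = 1 / t\<close> \<open>r * (s / (s + t))\<^sup>2 = s / (t * (s + t))\<close>)
      qed
      moreover have "r * Y = Y / t + Y / s" using assms by (simp add: r_def field_simps)
      moreover have "s / (t * (s + t)) * X + X / (s + t) = X / t"
      proof -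
        have "X / (s + t) = t / (t * (s + t)) * X" using assms by simp
        then have "s / (t * (s + t)) * X + X / (s + t) = (s + t) / (t * (s + t)) * X"
          by (simp only: add_divide_distrib distrib_right)
        then show ?thesis using st by simp
      qed
      moreover have "(X + Y - 2 * Z) / t + Y / s = X / t + Y / t - 2 / t * Z + Y / s"
        by (simp add: add_divide_distrib diff_divide_distrib)
      ultimately have "(X + Y - 2 * Z) / t + Y / s = (s / (t * (s + t)) * X + X / (s + t)) + Y / t - 2 / t * Z + Y / s"
        and "r * (Y - 2 * (s / (s + t)) * Z + (s / (s + t))\<^sup>2 * X) = (Y / t + Y / s) - 2 / t * Z + s / (t * (s + t)) * X"
        by (simp_all only:)
      then show ?thesis by simp
    qed
    ultimately show ?thesis by simp
  qed
  define k where "k = (s * t) powr (- (real DIM('a) / 2)) * exp (- pi * (norm x)\<^sup>2 / (s + t))"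
  have "heat_kernel t (x - y) * heat_kernel s y = k * exp (- pi * r * (norm (y - m))\<^sup>2)" for y
  proof -
    have "heat_kernel t (x - y) * heat_kernel s y = (s * t) powr (- (real DIM('a) / 2)) * exp (- pi * ((norm (x - y))\<^sup>2 / t + (norm y)\<^sup>2 / s))"
      using assms by (simp add: heat_kernel_def powr_mult exp_add[symmetric] algebra_simps exp_diff exp_minus field_simps)
    then show ?thesis unfolding sq k_def by (simp add: exp_add[symmetric] algebra_simps)
  qed
  then have "(\<integral>\<^sup>+y. ennreal (heat_kernel t (x - y)) * ennreal (heat_kernel s y) \<partial>lborel)
     = (\<integral>\<^sup>+y. ennreal k * ennreal (exp (- pi * r * (norm (- m + y))\<^sup>2)) \<partial>lborel)"
    by (intro nn_integral_cong) (simp add: ennreal_mult[symmetric] k_def)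
  also have "\<dots> = ennreal k * (\<integral>\<^sup>+y. ennreal (exp (- pi * r * (norm (y::'a))\<^sup>2)) \<partial>lborel)"
    using nn_integral_lborel_shift[of "\<lambda>y. ennreal (exp (- pi * r * (norm y)\<^sup>2))" "- m"]
    by (simp add: nn_integral_cmult)
  also have "\<dots> = ennreal (k * r powr (- (real DIM('a) / 2)))"
    using nn_integral_gaussian[OF r, where 'a='a] by (simp add: ennreal_mult k_def)
  also have "k * r powr (- (real DIM('a) / 2)) = heat_kernel (s + t) x"
    using assms by (simp add: k_def r_def heat_kernel_def powr_divide)
  finally show ?thesis .
qed

lemma nn_integral_heat_kernel:
  fixes x :: "'a::euclidean_space"
  assumes "t > 0"
  shows "(\<integral>\<^sup>+y. ennreal (heat_kernel t (x - y)) \<partial>lborel) = 1"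
proof -
  have "(\<integral>\<^sup>+y. ennreal (heat_kernel t (x - y)) \<partial>lborel) = (\<integral>\<^sup>+y. ennreal (heat_kernel t (y::'a)) \<partial>lborel)"
    by (rule nn_integral_lborel_reflect[of "\<lambda>y. ennreal (heat_kernel t y)"]) measurable
  also have "\<dots> = (\<integral>\<^sup>+y. ennreal (t powr (- (real DIM('a) / 2))) * ennreal (exp (- pi * (1 / t) * (norm (y::'a))\<^sup>2)) \<partial>lborel)"
    by (intro nn_integral_cong) (simp add: heat_kernel_def ennreal_mult)
  also have "\<dots> = ennreal (t powr (- (real DIM('a) / 2))) * ennreal ((1/t) powr (- (real DIM('a) / 2)))"
    using nn_integral_gaussian[of "1/t", where 'a='a] assms by (subst nn_integral_cmult) simp_all
  also have "\<dots> = 1"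
    using assms by (simp add: ennreal_mult[symmetric] powr_divide)
  finally show ?thesis .
qed

section \<open>The heat kernel form and Bessel's inequality\<close>

abbreviation fchar :: "'a::euclidean_space \<Rightarrow> 'a \<Rightarrow> complex" where
  "fchar \<xi> x \<equiv> exp (- 2 * complex_of_real pi * \<i> * complex_of_real (\<xi> \<bullet> x))"

lemma borel_measurable_cnj [measurable (raw)]:
  "f \<in> borel_measurable M \<Longrightarrow> (\<lambda>x. cnj (f x)) \<in> borel_measurable M"
  by (rule borel_measurable_continuous_on[OF continuous_on_cnj[OF continuous_on_id]])

lemma norm_fchar [simp]: "norm (fchar \<xi> x) = 1"
  by (simp add: norm_exp_eq_Re)

lemma cnj_fchar: "cnj (fchar \<xi> x) = fchar (- \<xi>) x"
  by (simp add: exp_cnj)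

lemma fourier_fchar_measurable [measurable]:
  "(\<lambda>(\<xi>, x). fchar \<xi> x) \<in> borel_measurable (borel \<Otimes>\<^sub>M borel)"
  unfolding case_prod_beta by (intro borel_measurable_continuous_onI measurable_compose[OF _ borel_measurable_exp]) measurable

lemma integrable_mult_fchar:
  assumes "integrable lborel u"
  shows "integrable lborel (\<lambda>x. u x * fchar \<xi> x)"
proof -
  have [measurable]: "u \<in> borel_measurable borel" using assms by auto
  show ?thesis by (rule Bochner_Integration.integrable_bound[OF assms]) (auto simp: norm_mult)
qed

lemma fourier_measurable [measurable]:
  assumes [measurable]: "u \<in> borel_measurable borel"
  shows "fourier u \<in> borel_measurable borel"
  unfolding fourier_def by (rule lborel.borel_measurable_lebesgue_integral) measurable

lemma norm_fourier_le: "norm (fourier u \<xi>) \<le> (LINT x|lborel. norm (u x))"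
  unfolding fourier_def by (rule order_trans[OF integral_norm_bound]) (simp add: norm_mult)

lemma integrable_mult_bounded:
  fixes u v :: "'a \<Rightarrow> complex"
  assumes "integrable M u" "v \<in> borel_measurable M" "\<And>x. norm (v x) \<le> C"
  shows "integrable M (\<lambda>x. u x * v x)"
proof (rule Bochner_Integration.integrable_bound[of _ "\<lambda>x. C * norm (u x)"])
  have [measurable]: "u \<in> borel_measurable M" using assms by auto
  show "(\<lambda>x. u x * v x) \<in> borel_measurable M" using assms(2) by measurable
  show "integrable M (\<lambda>x. C * norm (u x))" using assms(1) by simp
  show "AE x in M. norm (u x * v x) \<le> norm (C * norm (u x))"
  proof (rule AE_I2)
    fix x
    have "norm (v x) \<le> \<bar>C\<bar>" using assms(3)[of x] by linarith
    then show "norm (u x * v x) \<le> norm (C * norm (u x))"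
      using mult_right_mono[of "norm (v x)" "\<bar>C\<bar>" "norm (u x)"] by (simp add: norm_mult abs_mult mult.commute)
  qed
qed

text \<open>Fubini, since the kernel \<open>fchar\<close> is symmetric in its two arguments. Moving
  the transform between factors takes the place of an inversion theorem.\<close>

lemma fourier_multiplication:
  fixes k u :: "'a::euclidean_space \<Rightarrow> complex"
  assumes k: "integrable lborel k" and u: "integrable lborel u"
  shows "(LINT \<xi>|lborel. k \<xi> * fourier u \<xi>) = (LINT x|lborel. u x * fourier k x)"
proof -
  have [measurable]: "k \<in> borel_measurable borel" "u \<in> borel_measurable borel" using assms by auto
  have int: "integrable (lborel \<Otimes>\<^sub>M lborel) (\<lambda>(\<xi>, x). k \<xi> * (u x * fchar \<xi> x))"
  proof (rule lborel_pair.Fubini_integrable)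
    show "(\<lambda>(\<xi>, x). k \<xi> * (u x * fchar \<xi> x)) \<in> borel_measurable (lborel \<Otimes>\<^sub>M lborel)" by measurable
    show "integrable lborel (\<lambda>\<xi>. LINT x|lborel. norm (case (\<xi>, x) of (\<xi>, x) \<Rightarrow> k \<xi> * (u x * fchar \<xi> x)))"
      using k by (simp add: norm_mult)
    show "AE \<xi> in lborel. integrable lborel (\<lambda>x. case (\<xi>, x) of (\<xi>, x) \<Rightarrow> k \<xi> * (u x * fchar \<xi> x))"
      using integrable_mult_fchar[OF u] by simp
  qed
  have "(LINT \<xi>|lborel. k \<xi> * fourier u \<xi>) = (LINT \<xi>|lborel. LINT x|lborel. k \<xi> * (u x * fchar \<xi> x))"
    unfolding fourier_def by simp
  also have "\<dots> = (LINT x|lborel. LINT \<xi>|lborel. k \<xi> * (u x * fchar \<xi> x))"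
    using lborel_pair.Fubini_integral[OF int] by simp
  also have "\<dots> = (LINT x|lborel. u x * (LINT \<xi>|lborel. k \<xi> * fchar x \<xi>))"
    by (simp only: mult.left_commute[of "k _" "u _"] integral_mult_right_zero inner_commute)
  finally show ?thesis unfolding fourier_def .
qed

lemma integral_norm_le_nn_integral: "ennreal (norm (integral\<^sup>L M f)) \<le> (\<integral>\<^sup>+x. ennreal (norm (f x)) \<partial>M)"
  by (cases "integrable M f") (auto simp: integral_norm_bound_ennreal not_integrable_integral_eq)

text \<open>Since the heat kernel is the Fourier transform of the Gaussian, applying the multiplication
  formula twice turns the Gaussian mean of \<open>|fourier u|\<^sup>2\<close> into the quadratic form of the heat kernel.\<close>

lemma nn_integral_gaussian_fourier_le:
  fixes u :: "'a::euclidean_space \<Rightarrow> complex"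
  assumes u: "integrable lborel u" and t: "t > 0"
  shows "(\<integral>\<^sup>+\<xi>. ennreal (exp (- pi * t * (norm \<xi>)\<^sup>2) * (norm (fourier u \<xi>))\<^sup>2) \<partial>lborel)
     \<le> (\<integral>\<^sup>+x. \<integral>\<^sup>+y. ennreal (norm (u x) * norm (u y)) * ennreal (heat_kernel t (x - y)) \<partial>lborel \<partial>lborel)"
proof -
  have [measurable]: "u \<in> borel_measurable borel" using assms by auto
  let ?C = "LINT x|lborel. norm (u x)"
  define \<gamma> :: "'a \<Rightarrow> complex" where "\<gamma> = (\<lambda>\<xi>. complex_of_real (exp (- pi * t * (norm \<xi>)\<^sup>2)))"
  have \<gamma>: "integrable lborel \<gamma>" "\<And>x. fourier \<gamma> x = complex_of_real (heat_kernel t x)"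
    using has_bochner_integral_gaussian_fourier[OF t, of "0::'a"]
      has_bochner_integral_integral_eq[OF has_bochner_integral_gaussian_fourier[OF t]]
    by (auto simp: \<gamma>_def has_bochner_integral_iff fourier_def)
  have [measurable]: "\<gamma> \<in> borel_measurable borel" using \<gamma> by auto
  \<comment> \<open>Chosen so that \<open>k \<xi> * fourier u \<xi>\<close> is the integrand of the
    Gaussian mean, to which the multiplication formula then applies.\<close>
  define k where "k = (\<lambda>\<xi>. \<gamma> \<xi> * cnj (fourier u \<xi>))"
  have k: "integrable lborel k"
    unfolding k_def by (rule integrable_mult_bounded[OF \<gamma>(1), where C = "?C"]) (auto simp: norm_fourier_le)
  have fk: "fourier k x = cnj (LINT y|lborel. u y * complex_of_real (heat_kernel t (y - x)))" for x
  proof -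
    \<comment> \<open>Modulating the Gaussian by \<open>fchar (- x)\<close> translates its transform
      by \<open>x\<close>. After conjugation the integral for \<open>fourier k x\<close> contains
      \<open>fourier u\<close> itself, ready for the second use of the formula.\<close>
    define h where "h = (\<lambda>\<xi>. \<gamma> \<xi> * fchar (- x) \<xi>)"
    have h: "integrable lborel h" unfolding h_def by (rule integrable_mult_fchar[OF \<gamma>(1)])
    have fh: "fourier h y = complex_of_real (heat_kernel t (y - x))" for y
    proof -
      have "fchar (- x) \<xi> * fchar y \<xi> = fchar (y - x) \<xi>" for \<xi>
        by (simp add: exp_add[symmetric] inner_diff_left algebra_simps)
      then have "fourier h y = fourier \<gamma> (y - x)" unfolding fourier_def h_def by (simp only: mult.assoc)
      then show ?thesis using \<gamma> by simp
    qed
    have "cnj (k \<xi> * fchar x \<xi>) = h \<xi> * fourier u \<xi>" for \<xi>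
      unfolding k_def h_def complex_cnj_mult cnj_fchar by (simp add: \<gamma>_def)
    then have "cnj (fourier k x) = (LINT \<xi>|lborel. h \<xi> * fourier u \<xi>)"
      unfolding fourier_def[of k] by (subst Bochner_Integration.integral_cnj[symmetric]) simp
    also have "\<dots> = (LINT y|lborel. u y * complex_of_real (heat_kernel t (y - x)))"
      using fourier_multiplication[OF h u] by (simp add: fh)
    finally show ?thesis by (metis complex_cnj_cnj)
  qed
  have "(\<integral>\<^sup>+\<xi>. ennreal (exp (- pi * t * (norm \<xi>)\<^sup>2) * (norm (fourier u \<xi>))\<^sup>2) \<partial>lborel)
     = (\<integral>\<^sup>+\<xi>. ennreal (norm (k \<xi> * fourier u \<xi>)) \<partial>lborel)"
    by (intro nn_integral_cong) (simp add: k_def \<gamma>_def norm_mult power2_eq_square)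
  also have "\<dots> = ennreal (LINT \<xi>|lborel. norm (k \<xi> * fourier u \<xi>))"
    by (intro nn_integral_eq_integral integrable_norm integrable_mult_bounded[OF k, where C = "?C"])
      (auto simp: norm_fourier_le)
  also have "(LINT \<xi>|lborel. norm (k \<xi> * fourier u \<xi>)) = norm (LINT \<xi>|lborel. k \<xi> * fourier u \<xi>)"
  proof -
    \<comment> \<open>The integrand is a nonnegative real, so its integral equals the modulus of a
      complex integral; only the latter can be transformed by the multiplication formula.\<close>
    have e: "k \<xi> * fourier u \<xi> = complex_of_real (norm (k \<xi> * fourier u \<xi>))" for \<xi>
    proof -
      have "k \<xi> * fourier u \<xi> = \<gamma> \<xi> * complex_of_real ((norm (fourier u \<xi>))\<^sup>2)"
        unfolding k_def complex_norm_square by (simp add: ac_simps)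
      also have "\<dots> = complex_of_real (exp (- pi * t * (norm \<xi>)\<^sup>2) * (norm (fourier u \<xi>))\<^sup>2)"
        unfolding \<gamma>_def by simp
      finally show ?thesis by (metis abs_of_nonneg exp_ge_zero mult_nonneg_nonneg norm_of_real zero_le_power2)
    qed
    have "(LINT \<xi>|lborel. k \<xi> * fourier u \<xi>) = complex_of_real (LINT \<xi>|lborel. norm (k \<xi> * fourier u \<xi>))"
      by (subst e) simp
    then show ?thesis by simp
  qed
  also have "(LINT \<xi>|lborel. k \<xi> * fourier u \<xi>) = (LINT x|lborel. u x * fourier k x)"
    by (rule fourier_multiplication[OF k u])
  also have "ennreal (norm (LINT x|lborel. u x * fourier k x)) \<le> (\<integral>\<^sup>+x. ennreal (norm (u x * fourier k x)) \<partial>lborel)"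
    by (rule integral_norm_le_nn_integral)
  also have "\<dots> \<le> (\<integral>\<^sup>+x. \<integral>\<^sup>+y. ennreal (norm (u x) * norm (u y)) * ennreal (heat_kernel t (x - y)) \<partial>lborel \<partial>lborel)"
  proof (rule nn_integral_mono)
    fix x
    have "ennreal (norm (fourier k x)) \<le> (\<integral>\<^sup>+y. ennreal (norm (u y * complex_of_real (heat_kernel t (y - x)))) \<partial>lborel)"
      unfolding fk complex_mod_cnj by (rule integral_norm_le_nn_integral)
    then have "ennreal (norm (u x)) * ennreal (norm (fourier k x)) \<le> (\<integral>\<^sup>+y. ennreal (norm (u x)) * ennreal (norm (u y * complex_of_real (heat_kernel t (y - x)))) \<partial>lborel)"
      by (subst nn_integral_cmult) (auto intro: mult_left_mono)
    also have "\<dots> = (\<integral>\<^sup>+y. ennreal (norm (u x) * norm (u y)) * ennreal (heat_kernel t (x - y)) \<partial>lborel)"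
      by (intro nn_integral_cong) (simp add: norm_mult ennreal_mult mult.assoc heat_kernel_def norm_minus_commute)
    finally show "ennreal (norm (u x * fourier k x)) \<le> (\<integral>\<^sup>+y. ennreal (norm (u x) * norm (u y)) * ennreal (heat_kernel t (x - y)) \<partial>lborel)"
      by (simp add: norm_mult ennreal_mult)
  qed
  finally show ?thesis .
qed

text \<open>The hypothesis \<open>le\<close> is a pointwise inequality of arithmetic and geometric
  means. As \<open>K\<close> is symmetric, exchanging the variables shows that \<open>b x y\<close>
  and \<open>b y x\<close> contribute equally, which absorbs the factor 2. The origin is excluded
  because negative powers of the norm will be used there, where \<open>0 powr _\<close> is
  0.\<close>

lemma schur_test:
  fixes a :: "'a::euclidean_space \<Rightarrow> real" and b :: "'a \<Rightarrow> 'a \<Rightarrow> real" and K :: "'a \<Rightarrow> 'a \<Rightarrow> ennreal"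
  assumes [measurable]: "a \<in> borel_measurable borel" "case_prod b \<in> borel_measurable (borel \<Otimes>\<^sub>M borel)"
    "case_prod K \<in> borel_measurable (borel \<Otimes>\<^sub>M borel)"
    and sym: "\<And>x y. K x y = K y x"
    and nonneg: "\<And>x y. 0 \<le> b x y"
    and le: "\<And>x y. x \<noteq> 0 \<Longrightarrow> y \<noteq> 0 \<Longrightarrow> 2 * (a x * a y) \<le> b x y + b y x"
  shows "(\<integral>\<^sup>+x. \<integral>\<^sup>+y. ennreal (a x * a y) * K x y \<partial>lborel \<partial>lborel) \<le> (\<integral>\<^sup>+x. \<integral>\<^sup>+y. ennreal (b x y) * K x y \<partial>lborel \<partial>lborel)"
    (is "?L \<le> ?R")
proof -
  have [measurable]: "(\<lambda>x. K (f x) (g x)) \<in> borel_measurable N" "(\<lambda>x. b (f x) (g x)) \<in> borel_measurable N"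
    if [measurable]: "f \<in> N \<rightarrow>\<^sub>M borel" "g \<in> N \<rightarrow>\<^sub>M borel" for f g and N :: "'c measure"
    using measurable_compose[OF measurable_Pair[OF that] assms(3)]
      measurable_compose[OF measurable_Pair[OF that] assms(2)] by simp_all
  have "2 * ?L = (\<integral>\<^sup>+x. \<integral>\<^sup>+y. 2 * (ennreal (a x * a y) * K x y) \<partial>lborel \<partial>lborel)"
    by (simp add: nn_integral_cmult)
  also have "\<dots> \<le> (\<integral>\<^sup>+x. \<integral>\<^sup>+y. ennreal (b x y) * K x y + ennreal (b y x) * K y x \<partial>lborel \<partial>lborel)"
  proof (rule nn_integral_mono_AE)
    have "AE x in lborel. x \<noteq> (0::'a)" by (rule AE_lborel_singleton)
    then show "AE x in lborel. (\<integral>\<^sup>+y. 2 * (ennreal (a x * a y) * K x y) \<partial>lborel) \<le> (\<integral>\<^sup>+y. ennreal (b x y) * K x y + ennreal (b y x) * K y x \<partial>lborel)"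
    proof eventually_elim
      fix x :: 'a assume x: "x \<noteq> 0"
      have "AE y in lborel. y \<noteq> (0::'a)" by (rule AE_lborel_singleton)
      then have "AE y in lborel. 2 * (ennreal (a x * a y) * K x y) \<le> ennreal (b x y) * K x y + ennreal (b y x) * K y x"
      proof eventually_elim
        fix y :: 'a assume y: "y \<noteq> 0"
        have "2 * ennreal (a x * a y) = ennreal (2 * (a x * a y))"
          using ennreal_mult'[of 2 "a x * a y"] by simp
        also have "\<dots> \<le> ennreal (b x y) + ennreal (b y x)"
          using le[OF x y] nonneg by (simp add: ennreal_plus[symmetric] ennreal_leI del: ennreal_plus)
        finally have "2 * ennreal (a x * a y) * K x y \<le> (ennreal (b x y) + ennreal (b y x)) * K x y"
          by (rule mult_right_mono) simp
        then show "2 * (ennreal (a x * a y) * K x y) \<le> ennreal (b x y) * K x y + ennreal (b y x) * K y x"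
          using sym[of x y] by (simp add: mult.assoc distrib_right)
      qed
      then show "(\<integral>\<^sup>+y. 2 * (ennreal (a x * a y) * K x y) \<partial>lborel) \<le> (\<integral>\<^sup>+y. ennreal (b x y) * K x y + ennreal (b y x) * K y x \<partial>lborel)"
        by (rule nn_integral_mono_AE)
    qed
  qed
  also have "\<dots> = ?R + (\<integral>\<^sup>+x. \<integral>\<^sup>+y. ennreal (b y x) * K y x \<partial>lborel \<partial>lborel)"
    by (simp add: nn_integral_add)
  also have "(\<integral>\<^sup>+x. \<integral>\<^sup>+y. ennreal (b y x) * K y x \<partial>lborel \<partial>lborel) = ?R"
    by (rule lborel_pair.Fubini') measurable
  also have "?R + ?R = 2 * ?R" by (simp add: mult_2)
  finally show ?thesis
    by (subst (asm) ennreal_mult_le_mult_iff) auto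
qed

text \<open>For each \<open>t\<close> the Schur test with \<open>b x y\<close> = |u x|^2 bounds the
  Gaussian mean by the L2 norm, as the heat kernel has mass 1. Letting \<open>t\<close> tend to 0
  along 1/(k+1) removes the Gaussian by Fatou's lemma.\<close>

theorem fourier_bessel:
  fixes u :: "'a::euclidean_space \<Rightarrow> complex"
  assumes u: "integrable lborel u"
  shows "(\<integral>\<^sup>+\<xi>. ennreal ((norm (fourier u \<xi>))\<^sup>2) \<partial>lborel) \<le> (\<integral>\<^sup>+x. ennreal ((norm (u x))\<^sup>2) \<partial>lborel)"
proof -
  have [measurable]: "u \<in> borel_measurable borel" using assms by auto
  have *: "(\<integral>\<^sup>+\<xi>. ennreal (exp (- pi * t * (norm \<xi>)\<^sup>2) * (norm (fourier u \<xi>))\<^sup>2) \<partial>lborel) \<le> (\<integral>\<^sup>+x. ennreal ((norm (u x))\<^sup>2) \<partial>lborel)"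
    if t: "t > 0" for t
  proof -
    have "(\<integral>\<^sup>+x. \<integral>\<^sup>+y. ennreal (norm (u x) * norm (u y)) * ennreal (heat_kernel t (x - y)) \<partial>lborel \<partial>lborel)
       \<le> (\<integral>\<^sup>+x. \<integral>\<^sup>+y. ennreal ((norm (u x))\<^sup>2) * ennreal (heat_kernel t (x - y)) \<partial>lborel \<partial>lborel)"
    proof (rule schur_test)
      show "ennreal (heat_kernel t (x - y)) = ennreal (heat_kernel t (y - x))" for x y :: 'a
        by (simp add: heat_kernel_def norm_minus_commute)
      show "2 * (norm (u x) * norm (u y)) \<le> (norm (u x))\<^sup>2 + (norm (u y))\<^sup>2" for x y
        using sum_squares_bound[of "norm (u x)" "norm (u y)"] by simp
    qed simp_all
    also have "\<dots> = (\<integral>\<^sup>+x. ennreal ((norm (u x))\<^sup>2) * (\<integral>\<^sup>+y. ennreal (heat_kernel t (x - y)) \<partial>lborel) \<partial>lborel)"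
      by (intro nn_integral_cong nn_integral_cmult) measurable
    finally show ?thesis
      using nn_integral_gaussian_fourier_le[OF u t] nn_integral_heat_kernel[OF t, where 'a='a] by simp
  qed
  let ?e = "\<lambda>k \<xi>. exp (- pi * (1 / real (Suc k)) * (norm (\<xi>::'a))\<^sup>2)"
  have lim: "(\<lambda>k. ?e k \<xi> * (norm (fourier u \<xi>))\<^sup>2) \<longlonglongrightarrow> (norm (fourier u \<xi>))\<^sup>2" for \<xi>
  proof -
    have "(\<lambda>k. ?e k \<xi> * (norm (fourier u \<xi>))\<^sup>2) \<longlonglongrightarrow> exp (- pi * 0 * (norm (\<xi>::'a))\<^sup>2) * (norm (fourier u \<xi>))\<^sup>2"
      by (intro tendsto_intros LIMSEQ_Suc[OF lim_1_over_n])
    then show ?thesis by simp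
  qed
  have "(\<integral>\<^sup>+\<xi>. ennreal ((norm (fourier u \<xi>))\<^sup>2) \<partial>lborel)
     = (\<integral>\<^sup>+\<xi>. liminf (\<lambda>k. ennreal (?e k \<xi> * (norm (fourier u \<xi>))\<^sup>2)) \<partial>lborel)"
    by (intro nn_integral_cong lim_imp_Liminf[symmetric] tendsto_ennrealI lim) simp
  also have "\<dots> \<le> liminf (\<lambda>k. \<integral>\<^sup>+\<xi>. ennreal (?e k \<xi> * (norm (fourier u \<xi>))\<^sup>2) \<partial>lborel)"
    by (rule nn_integral_liminf) measurable
  also have "\<dots> \<le> liminf (\<lambda>k::nat. \<integral>\<^sup>+x. ennreal ((norm (u x))\<^sup>2) \<partial>lborel)"
    by (intro Liminf_mono always_eventually allI *) simp
  also have "\<dots> = (\<integral>\<^sup>+x. ennreal ((norm (u x))\<^sup>2) \<partial>lborel)" by (simp add: Liminf_const)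
  finally show ?thesis .
qed

section \<open>Pitt's inequality for integrable functions\<close>

lemma nn_integral_powr_exp:
  fixes q r :: real
  assumes "q > 0" "r > 0"
  shows "(\<integral>\<^sup>+t. ennreal (indicator {0<..} t * (t powr (q - 1) * exp (- r * t))) \<partial>lborel) = ennreal (Gamma q * r powr - q)"
proof -
  have "ennreal (Gamma q) = (\<integral>\<^sup>+t. ennreal (indicator {0..} t * t powr (q - 1) / exp t) \<partial>lborel)"
    using Gamma_conv_nn_integral_real assms by blast
  also have "\<dots> = ennreal r * (\<integral>\<^sup>+t. ennreal (indicator {0..} (r * t) * (r * t) powr (q - 1) / exp (r * t)) \<partial>lborel)"
    using assms by (subst nn_integral_real_affine[where c = r and t = 0]) auto
  also have "\<dots> = ennreal r * (\<integral>\<^sup>+t. ennreal (r powr (q - 1)) * ennreal (indicator {0<..} t * (t powr (q - 1) * exp (- r * t))) \<partial>lborel)"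
    using assms
    by (intro arg_cong2[where f="(*)"] refl nn_integral_cong)
      (auto simp: indicator_def powr_mult ennreal_mult[symmetric] exp_minus field_simps zero_le_mult_iff)
  also have "\<dots> = ennreal (r powr q) * (\<integral>\<^sup>+t. ennreal (indicator {0<..} t * (t powr (q - 1) * exp (- r * t))) \<partial>lborel)"
    using assms by (subst nn_integral_cmult) (simp_all add: mult.assoc[symmetric] ennreal_mult[symmetric] powr_mult_base)
  finally have "ennreal (r powr q) * (\<integral>\<^sup>+t. ennreal (indicator {0<..} t * (t powr (q - 1) * exp (- r * t))) \<partial>lborel) = ennreal (Gamma q)" by simp
  then have "ennreal (r powr - q) * ennreal (r powr q) * (\<integral>\<^sup>+t. ennreal (indicator {0<..} t * (t powr (q - 1) * exp (- r * t))) \<partial>lborel)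
    = ennreal (r powr - q) * ennreal (Gamma q)" by (simp add: mult.assoc)
  then show ?thesis
    using assms by (simp add: ennreal_mult[symmetric] powr_add[symmetric] mult.commute ennreal_mult''[symmetric])
qed

text \<open>The Gamma integral after the substitution t = 1/s. This shape is needed because the heat
  kernel has its parameter in the denominator of the exponent.\<close>

lemma nn_integral_powr_exp_inverse:
  fixes q r :: real
  assumes "q > 0" "r > 0"
  shows "(\<integral>\<^sup>+s. ennreal (indicator {0<..} s * (s powr (- q - 1) * exp (- r / s))) \<partial>lborel) = ennreal (Gamma q * r powr - q)"
proof -
  let ?f = "\<lambda>t. t powr (q - 1) * exp (- r * t)"
  have G: "Gamma q * r powr - q \<ge> 0" using assms Gamma_real_pos[of q] by simp
  have "((\<lambda>t. indicator {0<..} t * ?f t) has_integral Gamma q * r powr - q) UNIV"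
    using nn_integral_powr_exp[OF assms] G by (intro nn_integral_has_integral) auto
  then have "((\<lambda>t. if t \<in> {0<..} then ?f t else 0) has_integral Gamma q * r powr - q) UNIV"
    by (rule has_integral_eq[rotated]) (auto simp: indicator_def)
  then have "(?f has_integral Gamma q * r powr - q) {0<..}"
    by (simp only: has_integral_restrict_UNIV)
  then have 1: "?f absolutely_integrable_on {0<..} \<and> integral {0<..} ?f = Gamma q * r powr - q"
    by (auto intro!: nonnegative_absolutely_integrable_1 simp: has_integral_iff)
  have img: "(\<lambda>s::real. 1 / s) ` {0<..} = {0<..}"
  proof safe
    fix x :: real assume "0 < x"
    then show "x \<in> (\<lambda>s. 1 / s) ` {0<..}" by (intro image_eqI[of _ _ "1 / x"]) auto
  qed auto
  have "(\<lambda>s. \<bar>- (1 / s\<^sup>2)\<bar> * ?f (1 / s)) absolutely_integrable_on {0<..} \<and>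
      integral {0<..} (\<lambda>s. \<bar>- (1 / s\<^sup>2)\<bar> * ?f (1 / s)) = Gamma q * r powr - q"
    using 1
    by (subst has_absolute_integral_change_of_variables_1', goal_cases)
      (auto simp: img inj_on_def power2_eq_square intro!: derivative_eq_intros)
  then have "((\<lambda>s. \<bar>- (1 / s\<^sup>2)\<bar> * ?f (1 / s)) has_integral Gamma q * r powr - q) {0<..}"
    by (auto simp: has_integral_iff intro: set_lebesgue_integral_eq_integral(1))
  then have "(\<integral>\<^sup>+s. ennreal (indicator {0<..} s * (\<bar>- (1 / s\<^sup>2)\<bar> * ?f (1 / s))) \<partial>lborel) = ennreal (Gamma q * r powr - q)"
    by (intro nn_integral_has_integral_lebesgue) auto
  moreover have "ennreal (indicator {0<..} s * (\<bar>- (1 / s\<^sup>2)\<bar> * ?f (1 / s))) = ennreal (indicator {0<..} s * (s powr (- q - 1) * exp (- r / s)))" for s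
  proof (cases "s > 0")
    case True
    have "\<bar>- (1 / s\<^sup>2)\<bar> * (1 / s) powr (q - 1) = s powr (- q - 1)"
    proof -
      have "\<bar>- (1 / s\<^sup>2)\<bar> = s powr (- 2)" using True by (simp add: powr_neg_numeral)
      moreover have "(1 / s) powr (q - 1) = s powr (1 - q)" using True powr_minus_divide[of s "q - 1"] by (simp add: powr_divide)
      moreover have "- 2 + (1 - q) = - q - 1" by simp
      ultimately show ?thesis by (simp only: powr_add[symmetric])
    qed
    then show ?thesis using True by (simp add: mult.assoc[symmetric])
  qed simp
  ultimately show ?thesis by (simp only:)
qed

text \<open>With u = s + t the inner integral is a convolution of two powers, which t = u v
  evaluates to B(p,q) u^(p+q-1). By the semigroup law \<open>F\<close> will be the heat kernel, so a
  double superposition of kernels collapses to a single one.\<close>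

lemma nn_integral_beta_convolution:
  fixes p q :: real and F :: "real \<Rightarrow> ennreal"
  assumes p: "p > 0" and q: "q > 0" and [measurable]: "F \<in> borel_measurable borel"
  shows "(\<integral>\<^sup>+t. \<integral>\<^sup>+s. ennreal (indicator {0<..} t * t powr (p - 1)) * (ennreal (indicator {0<..} s * s powr (q - 1)) * F (s + t)) \<partial>lborel \<partial>lborel)
    = ennreal (Beta p q) * (\<integral>\<^sup>+u. ennreal (indicator {0<..} u * u powr (p + q - 1)) * F u \<partial>lborel)"
proof -
  have B: "(\<integral>\<^sup>+v. ennreal (indicator {0<..<1} v * (v powr (p - 1) * (1 - v) powr (q - 1))) \<partial>lborel) = ennreal (Beta p q)"
  proof -
    have "(\<integral>\<^sup>+v. ennreal (indicator {0..1} v * (v powr (p - 1) * (1 - v) powr (q - 1))) \<partial>lborel) = ennreal (Beta p q)"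
      by (intro nn_integral_has_integral_lebesgue has_integral_Beta_real p q) auto
    \<comment> \<open>At either endpoint one factor is \<open>0 powr _\<close>, which is 0, so the
      open and the closed interval give the same function.\<close>
    moreover have "ennreal (indicator {0..1} v * (v powr (p - 1) * (1 - v) powr (q - 1))) = ennreal (indicator {0<..<1} v * (v powr (p - 1) * (1 - v) powr (q - 1)))" for v
      by (cases "v = 0"; cases "v = 1") (auto simp: indicator_def)
    ultimately show ?thesis by (simp only:)
  qed
  have inner: "(\<integral>\<^sup>+t. ennreal (indicator {0<..} t * t powr (p - 1)) * ennreal (indicator {0<..} (u - t) * (u - t) powr (q - 1)) \<partial>lborel)
     = ennreal (Beta p q) * ennreal (indicator {0<..} u * u powr (p + q - 1))" for u
  proof (cases "u > 0")
    case False
    then have z: "ennreal (indicator {0<..} t * t powr (p - 1)) * ennreal (indicator {0<..} (u - t) * (u - t) powr (q - 1)) = 0" for t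
      by (auto simp: indicator_def)
    show ?thesis unfolding z using False by simp
  next
    case True
    have "(\<integral>\<^sup>+t. ennreal (indicator {0<..} t * t powr (p - 1)) * ennreal (indicator {0<..} (u - t) * (u - t) powr (q - 1)) \<partial>lborel)
      = ennreal u * (\<integral>\<^sup>+v. ennreal (indicator {0<..} (u * v) * (u * v) powr (p - 1)) * ennreal (indicator {0<..} (u - u * v) * (u - u * v) powr (q - 1)) \<partial>lborel)"
      using True by (subst nn_integral_real_affine[where c = u and t = 0]) auto
    also have "\<dots> = ennreal u * (\<integral>\<^sup>+v. ennreal (u powr (p - 1) * u powr (q - 1)) * ennreal (indicator {0<..<1} v * (v powr (p - 1) * (1 - v) powr (q - 1))) \<partial>lborel)"
    proof (rule arg_cong[where f="(*) (ennreal u)"], rule nn_integral_cong)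
      fix v
      show "ennreal (indicator {0<..} (u * v) * (u * v) powr (p - 1)) * ennreal (indicator {0<..} (u - u * v) * (u - u * v) powr (q - 1))
         = ennreal (u powr (p - 1) * u powr (q - 1)) * ennreal (indicator {0<..<1} v * (v powr (p - 1) * (1 - v) powr (q - 1)))"
      proof (cases "0 < v \<and> v < 1")
        case True
        have "u - u * v = u * (1 - v)" by (simp add: algebra_simps)
        then show ?thesis using True \<open>u > 0\<close> by (simp add: powr_mult ennreal_mult[symmetric] ac_simps)
      next
        case False
        then have "indicator {0<..<1} v = (0::real)" by auto
        moreover have "indicator {0<..} (u * v) = (0::real) \<or> indicator {0<..} (u - u * v) = (0::real)"
          using False \<open>u > 0\<close> by (auto simp: indicator_def zero_less_mult_iff)
        ultimately show ?thesis by (metis ennreal_0 mult_zero_left mult_zero_right)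
      qed
    qed
    also have "\<dots> = ennreal u * (ennreal (u powr (p - 1) * u powr (q - 1)) * ennreal (Beta p q))"
      by (subst nn_integral_cmult) (simp_all add: B)
    also have "\<dots> = ennreal (Beta p q) * ennreal (u * (u powr (p - 1) * u powr (q - 1)))"
      using True by (simp add: ennreal_mult ac_simps)
    also have "u * (u powr (p - 1) * u powr (q - 1)) = u powr (p + q - 1)"
      using True by (simp add: powr_add[symmetric] powr_mult_base) 
    finally show ?thesis using True by simp
  qed
  have "(\<integral>\<^sup>+t. \<integral>\<^sup>+s. ennreal (indicator {0<..} t * t powr (p - 1)) * (ennreal (indicator {0<..} s * s powr (q - 1)) * F (s + t)) \<partial>lborel \<partial>lborel)
    = (\<integral>\<^sup>+t. \<integral>\<^sup>+u. ennreal (indicator {0<..} t * t powr (p - 1)) * (ennreal (indicator {0<..} (u - t) * (u - t) powr (q - 1)) * F u) \<partial>lborel \<partial>lborel)"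
  proof (rule nn_integral_cong)
    fix t :: real
    show "(\<integral>\<^sup>+s. ennreal (indicator {0<..} t * t powr (p - 1)) * (ennreal (indicator {0<..} s * s powr (q - 1)) * F (s + t)) \<partial>lborel)
      = (\<integral>\<^sup>+u. ennreal (indicator {0<..} t * t powr (p - 1)) * (ennreal (indicator {0<..} (u - t) * (u - t) powr (q - 1)) * F u) \<partial>lborel)"
      by (subst nn_integral_lborel_shift[where c = t and f = "\<lambda>u. ennreal (indicator {0<..} t * t powr (p - 1)) * (ennreal (indicator {0<..} (u - t) * (u - t) powr (q - 1)) * F u)", symmetric])
        (simp_all add: add.commute)
  qed
  also have "\<dots> = (\<integral>\<^sup>+u. \<integral>\<^sup>+t. ennreal (indicator {0<..} t * t powr (p - 1)) * (ennreal (indicator {0<..} (u - t) * (u - t) powr (q - 1)) * F u) \<partial>lborel \<partial>lborel)"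
    by (rule lborel_pair.Fubini') measurable
  also have "\<dots> = (\<integral>\<^sup>+u. ennreal (Beta p q) * (ennreal (indicator {0<..} u * u powr (p + q - 1)) * F u) \<partial>lborel)"
    unfolding mult.assoc[symmetric] inner[symmetric] by (intro nn_integral_cong nn_integral_multc) measurable
  also have "\<dots> = ennreal (Beta p q) * (\<integral>\<^sup>+u. ennreal (indicator {0<..} u * u powr (p + q - 1)) * F u \<partial>lborel)"
    by (rule nn_integral_cmult) measurable
  finally show ?thesis .
qed

section \<open>Powers of the norm as superpositions of heat kernels\<close>

lemma pi_norm_powr:
  fixes x :: "'a::real_normed_vector"
  assumes "x \<noteq> 0"
  shows "(pi * (norm x)\<^sup>2) powr - q = pi powr - q * norm x powr - (2 * q)"
proof -
  have "(norm x)\<^sup>2 = norm x powr 2" using assms by simp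
  then have "((norm x)\<^sup>2) powr - q = norm x powr - (2 * q)" by (simp only: powr_powr) simp
  then show ?thesis by (simp add: powr_mult)
qed

text \<open>The condition on p + q makes s^(p-1) times s^(-n/2) equal to s^(-q-1). Read from right
  to left, the lemma represents |x|^(-2q) by heat kernels.\<close>

lemma nn_integral_powr_heat_kernel:
  fixes x :: "'a::euclidean_space"
  assumes "q > 0" "x \<noteq> 0" "p + q = real DIM('a) / 2"
  shows "(\<integral>\<^sup>+s. ennreal (indicator {0<..} s * s powr (p - 1)) * ennreal (heat_kernel s x) \<partial>lborel)
     = ennreal (Gamma q * pi powr - q * norm x powr - (2 * q))"
proof -
  have "(\<integral>\<^sup>+s. ennreal (indicator {0<..} s * s powr (p - 1)) * ennreal (heat_kernel s x) \<partial>lborel)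
    = (\<integral>\<^sup>+s. ennreal (indicator {0<..} s * (s powr (- q - 1) * exp (- (pi * (norm x)\<^sup>2) / s))) \<partial>lborel)"
  proof (intro nn_integral_cong)
    fix s :: real
    show "ennreal (indicator {0<..} s * s powr (p - 1)) * ennreal (heat_kernel s x)
       = ennreal (indicator {0<..} s * (s powr (- q - 1) * exp (- (pi * (norm x)\<^sup>2) / s)))"
    proof (cases "s > 0")
      case True
      have "s powr (p - 1) * s powr (- (real DIM('a) / 2)) = s powr (- q - 1)"
      proof -
        have "p - 1 + - (real DIM('a) / 2) = - q - 1" using assms(3) by simp
        then show ?thesis by (simp only: powr_add[symmetric])
      qed
      then show ?thesis using True by (simp add: heat_kernel_def ennreal_mult[symmetric] mult.assoc[symmetric])
    qed simp
  qed
  also have "\<dots> = ennreal (Gamma q * (pi * (norm x)\<^sup>2) powr - q)"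
    using assms by (intro nn_integral_powr_exp_inverse) auto
  also have "(pi * (norm x)\<^sup>2) powr - q = pi powr - q * norm x powr - (2 * q)"
    using assms by (intro pi_norm_powr)
  finally show ?thesis by (simp add: mult.assoc)
qed

text \<open>With the weight \<open>|y|\<^sup>-\<^sup>(\<^sup>n\<^sup>+\<^sup>\<lambda>\<^sup>)\<^sup>/\<^sup>2\<close> written as a superposition of heat kernels, the semigroup property reduces the
  action of the Riesz potential on it to a Beta integral.\<close>

lemma riesz_potential_powr:
  fixes x :: "'a::euclidean_space"
  assumes "0 < lam" "lam < real DIM('a)" "x \<noteq> 0"
  defines "n \<equiv> real DIM('a)"
  shows "(\<integral>\<^sup>+t. ennreal (indicator {0<..} t * t powr (lam / 2 - 1)) *
        (\<integral>\<^sup>+y. ennreal (norm y powr - ((n + lam) / 2)) * ennreal (heat_kernel t (x - y)) \<partial>lborel) \<partial>lborel)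
    = ennreal (Gamma (lam / 2) * pi powr (lam / 2) * (Gamma ((n - lam) / 4) / Gamma ((n + lam) / 4))\<^sup>2 * norm x powr - ((n - lam) / 2))"
proof -
  \<comment> \<open>2q is the exponent of the weight and 2\<mu> that of the result. The identities
    \<mu> + q = n/2 and (\<lambda>/2 + \<mu>) + \<mu> = n/2 are the side conditions for passing from
    a power to heat kernels before the Beta integral and back after it.\<close>
  define \<mu> q where "\<mu> = (n - lam) / 4" and "q = (n + lam) / 4"
  have pos: "\<mu> > 0" "q > 0" "lam / 2 > 0" using assms by (auto simp: \<mu>_def q_def)
  have sums: "\<mu> + q = n / 2" "lam / 2 + \<mu> + \<mu> = n / 2" "lam / 2 + \<mu> = q" by (auto simp: \<mu>_def q_def field_simps)
  have Gpos: "Gamma \<mu> > 0" "Gamma q > 0" "Gamma (lam / 2) > 0" using pos by (auto intro: Gamma_real_pos)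
  define A where "A = Gamma q * pi powr - q"
  have A: "A > 0" using Gpos by (simp add: A_def)
  let ?a = "\<lambda>t. ennreal (indicator {0<..} t * t powr (lam / 2 - 1))"
  let ?b = "\<lambda>s. ennreal (indicator {0<..} s * s powr (\<mu> - 1))"
  let ?w = "\<lambda>y::'a. ennreal (norm y powr - ((n + lam) / 2))"
  have w: "ennreal A * ?w y = (\<integral>\<^sup>+s. ?b s * ennreal (heat_kernel s y) \<partial>lborel)" if "y \<noteq> 0" for y :: 'a
  proof -
    have "(n + lam) / 2 = 2 * q" by (simp add: q_def)
    then show ?thesis
      using nn_integral_powr_heat_kernel[OF pos(2) that, of \<mu>] sums A
      by (simp add: n_def A_def ennreal_mult[symmetric] mult.assoc)
  qed
  have "ennreal A * (\<integral>\<^sup>+t. ?a t * (\<integral>\<^sup>+y. ?w y * ennreal (heat_kernel t (x - y)) \<partial>lborel) \<partial>lborel)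
     = (\<integral>\<^sup>+t. ?a t * (\<integral>\<^sup>+y. ennreal A * ?w y * ennreal (heat_kernel t (x - y)) \<partial>lborel) \<partial>lborel)"
  proof -
    have "(\<integral>\<^sup>+y. ennreal A * ?w y * ennreal (heat_kernel t (x - y)) \<partial>lborel)
      = ennreal A * (\<integral>\<^sup>+y. ?w y * ennreal (heat_kernel t (x - y)) \<partial>lborel)" for t
      by (subst nn_integral_cmult[symmetric]) (simp_all add: mult.assoc)
    then show ?thesis
      by (subst nn_integral_cmult[symmetric]) (simp_all add: mult.left_commute)
  qed
  also have "\<dots> = (\<integral>\<^sup>+t. ?a t * (\<integral>\<^sup>+y. (\<integral>\<^sup>+s. ?b s * ennreal (heat_kernel s y) \<partial>lborel) * ennreal (heat_kernel t (x - y)) \<partial>lborel) \<partial>lborel)"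
  proof -
    have "(\<integral>\<^sup>+y. ennreal A * ?w y * ennreal (heat_kernel t (x - y)) \<partial>lborel)
      = (\<integral>\<^sup>+y. (\<integral>\<^sup>+s. ?b s * ennreal (heat_kernel s y) \<partial>lborel) * ennreal (heat_kernel t (x - y)) \<partial>lborel)" for t
      using AE_lborel_singleton[of "0::'a"] by (intro nn_integral_cong_AE, eventually_elim) (rule arg_cong2[where f="(*)", OF w refl])
    then show ?thesis by (simp only:)
  qed
  also have "\<dots> = (\<integral>\<^sup>+t. ?a t * (\<integral>\<^sup>+s. ?b s * (\<integral>\<^sup>+y. ennreal (heat_kernel t (x - y)) * ennreal (heat_kernel s y) \<partial>lborel) \<partial>lborel) \<partial>lborel)"
  proof (rule nn_integral_cong, rule arg_cong[where f="(*) (?a _)"])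
    fix t :: real
    have "(\<integral>\<^sup>+y. (\<integral>\<^sup>+s. ?b s * ennreal (heat_kernel s y) \<partial>lborel) * ennreal (heat_kernel t (x - y)) \<partial>lborel)
      = (\<integral>\<^sup>+y. \<integral>\<^sup>+s. ?b s * (ennreal (heat_kernel t (x - y)) * ennreal (heat_kernel s y)) \<partial>lborel \<partial>lborel)"
      by (subst nn_integral_multc[symmetric]) (auto simp: ac_simps)
    also have "\<dots> = (\<integral>\<^sup>+s. \<integral>\<^sup>+y. ?b s * (ennreal (heat_kernel t (x - y)) * ennreal (heat_kernel s y)) \<partial>lborel \<partial>lborel)"
      by (rule lborel_pair.Fubini') measurable
    also have "\<dots> = (\<integral>\<^sup>+s. ?b s * (\<integral>\<^sup>+y. ennreal (heat_kernel t (x - y)) * ennreal (heat_kernel s y) \<partial>lborel) \<partial>lborel)"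
      by (intro nn_integral_cong nn_integral_cmult) measurable
    finally show "(\<integral>\<^sup>+y. (\<integral>\<^sup>+s. ?b s * ennreal (heat_kernel s y) \<partial>lborel) * ennreal (heat_kernel t (x - y)) \<partial>lborel)
      = (\<integral>\<^sup>+s. ?b s * (\<integral>\<^sup>+y. ennreal (heat_kernel t (x - y)) * ennreal (heat_kernel s y) \<partial>lborel) \<partial>lborel)" .
  qed
  also have "\<dots> = (\<integral>\<^sup>+t. \<integral>\<^sup>+s. ?a t * (?b s * ennreal (heat_kernel (s + t) x)) \<partial>lborel \<partial>lborel)"
  proof (rule nn_integral_cong)
    fix t :: real
    show "?a t * (\<integral>\<^sup>+s. ?b s * (\<integral>\<^sup>+y. ennreal (heat_kernel t (x - y)) * ennreal (heat_kernel s y) \<partial>lborel) \<partial>lborel)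
      = (\<integral>\<^sup>+s. ?a t * (?b s * ennreal (heat_kernel (s + t) x)) \<partial>lborel)"
    proof (cases "t > 0")
      case True
      have "?b s * (\<integral>\<^sup>+y. ennreal (heat_kernel t (x - y)) * ennreal (heat_kernel s y) \<partial>lborel) = ?b s * ennreal (heat_kernel (s + t) x)" for s
        using True heat_kernel_semigroup[of s t x] by (cases "s > 0") auto
      then show ?thesis by (simp add: nn_integral_cmult)
    qed simp
  qed
  also have "\<dots> = ennreal (Beta (lam / 2) \<mu>) * (\<integral>\<^sup>+u. ennreal (indicator {0<..} u * u powr (lam / 2 + \<mu> - 1)) * ennreal (heat_kernel u x) \<partial>lborel)"
    by (rule nn_integral_beta_convolution[OF pos(3,1)]) measurable
  also have "\<dots> = ennreal (Beta (lam / 2) \<mu>) * ennreal (Gamma \<mu> * pi powr - \<mu> * norm x powr - (2 * \<mu>))"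
    using assms pos sums by (subst nn_integral_powr_heat_kernel) (auto simp: n_def)
  also have "\<dots> = ennreal (Beta (lam / 2) \<mu> * (Gamma \<mu> * pi powr - \<mu> * norm x powr - (2 * \<mu>)))"
    by (rule ennreal_mult[symmetric]) (use Gpos sums in \<open>auto simp: Beta_def\<close>)
  \<comment> \<open>One quotient \<Gamma>(\<mu>)/\<Gamma>(q) comes from the Beta function, the other
    from converting the two powers; hence the square in \<open>pitt_const\<close>. The factor
    pi^(\<lambda>/2) is pi^(q - \<mu>).\<close>
  also have "Beta (lam / 2) \<mu> * (Gamma \<mu> * pi powr - \<mu> * norm x powr - (2 * \<mu>))
     = A * (Gamma (lam / 2) * pi powr (lam / 2) * (Gamma \<mu> / Gamma q)\<^sup>2 * norm x powr - ((n - lam) / 2))"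
  proof -
    have m: "2 * \<mu> = (n - lam) / 2" by (simp add: \<mu>_def)
    have p: "pi powr - \<mu> = pi powr - q * pi powr (lam / 2)"
      unfolding powr_add[symmetric] using sums by (intro arg_cong2[where f="(powr)"]) auto
    have "Beta (lam / 2) \<mu> = Gamma (lam / 2) * Gamma \<mu> / Gamma q" by (simp only: Beta_def sums)
    then show ?thesis unfolding m p A_def using Gpos by (simp add: power2_eq_square)
  qed
  finally have "ennreal A * (\<integral>\<^sup>+t. ?a t * (\<integral>\<^sup>+y. ?w y * ennreal (heat_kernel t (x - y)) \<partial>lborel) \<partial>lborel)
     = ennreal A * ennreal (Gamma (lam / 2) * pi powr (lam / 2) * (Gamma \<mu> / Gamma q)\<^sup>2 * norm x powr - ((n - lam) / 2))"
    using A Gpos by (simp add: ennreal_mult)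
  then show ?thesis
    using A unfolding \<mu>_def q_def by (simp add: ennreal_mult_cancel_left)
qed

theorem pitt_inequality_L1:
  fixes u :: "'a::euclidean_space \<Rightarrow> complex"
  assumes lam: "0 \<le> lam" "lam < real DIM('a)" and u: "integrable lborel u"
  shows "(\<integral>\<^sup>+\<xi>. ennreal (norm \<xi> powr - lam * (norm (fourier u \<xi>))\<^sup>2) \<partial>lborel)
     \<le> ennreal (pitt_const DIM('a) lam) * (\<integral>\<^sup>+x. ennreal (norm x powr lam * (norm (u x))\<^sup>2) \<partial>lborel)"
\<comment> \<open>The case \<lambda> = 0 is separate because the normalising factor
  \<Gamma>(\<lambda>/2) has a pole there.\<close>
proof (cases "lam = 0")
  case True
  have [measurable]: "u \<in> borel_measurable borel" using u by auto
  \<comment> \<open>At the origin \<open>norm x powr 0\<close> is 0 and not 1, so the weights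
    disappear only almost everywhere.\<close>
  have e: "AE x in lborel. x \<noteq> (0::'a)" by (rule AE_lborel_singleton)
  have "(\<integral>\<^sup>+\<xi>. ennreal (norm \<xi> powr - lam * (norm (fourier u \<xi>))\<^sup>2) \<partial>lborel) = (\<integral>\<^sup>+\<xi>. ennreal ((norm (fourier u \<xi>))\<^sup>2) \<partial>lborel)"
    by (rule nn_integral_cong_AE, rule eventually_mono[OF e]) (simp add: True)
  moreover have "(\<integral>\<^sup>+\<xi>. ennreal (norm \<xi> powr lam * (norm (u \<xi>))\<^sup>2) \<partial>lborel) = (\<integral>\<^sup>+\<xi>. ennreal ((norm (u \<xi>))\<^sup>2) \<partial>lborel)"
    by (rule nn_integral_cong_AE, rule eventually_mono[OF e]) (simp add: True)
  moreover have "pitt_const DIM('a) lam = 1"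
  proof -
    have "Gamma (real DIM('a) / 4) > 0" by (rule Gamma_real_pos) simp
    then have "Gamma (real DIM('a) / 4) \<noteq> 0" by (rule less_imp_neq[THEN not_sym])
    then show ?thesis by (simp add: pitt_const_def True)
  qed
  ultimately show ?thesis using fourier_bessel[OF u] by simp
next
  case False
  then have lam0: "lam > 0" using lam by simp
  define n where "n = real DIM('a)"
  have [measurable]: "u \<in> borel_measurable borel" using u by auto
  \<comment> \<open>\<open>D\<close> normalises the superposition of Gaussians that represents
    |\<xi>|^(-\<lambda>), and \<open>E\<close> is the factor produced by the Riesz potential of the
    weight. Their quotient E/D is \<open>pitt_const\<close>.\<close>
  define D where "D = Gamma (lam / 2) * pi powr - (lam / 2)"
  have D: "D > 0" using Gamma_real_pos[of "lam / 2"] lam0 by (simp add: D_def)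
  define E where "E = Gamma (lam / 2) * pi powr (lam / 2) * (Gamma ((n - lam) / 4) / Gamma ((n + lam) / 4))\<^sup>2"
  have E: "E \<ge> 0" using Gamma_real_pos[of "lam / 2"] lam0 by (simp add: E_def)
  let ?a = "\<lambda>t. ennreal (indicator {0<..} t * t powr (lam / 2 - 1))"
  let ?v = "\<lambda>x. norm x powr lam * (norm (u x))\<^sup>2"
  \<comment> \<open>For x, y away from 0 this is |u x|^2 w(y)/w(x) with w(z) =
    |z|^(-(n+\<lambda>)/2), grouped so that the right-hand integrand \<open>?v x\<close> of Pitt's
    inequality is visible.\<close>
  let ?b = "\<lambda>x y. ?v x * norm x powr ((n - lam) / 2) * norm y powr - ((n + lam) / 2)"
  have riesz: "ennreal D * ennreal (norm \<xi> powr - lam) = (\<integral>\<^sup>+t. ?a t * ennreal (exp (- pi * t * (norm \<xi>)\<^sup>2)) \<partial>lborel)"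
    if "\<xi> \<noteq> 0" for \<xi> :: 'a
  proof -
    have "(\<integral>\<^sup>+t. ?a t * ennreal (exp (- pi * t * (norm \<xi>)\<^sup>2)) \<partial>lborel)
       = (\<integral>\<^sup>+t. ennreal (indicator {0<..} t * (t powr (lam / 2 - 1) * exp (- (pi * (norm \<xi>)\<^sup>2) * t))) \<partial>lborel)"
      by (intro nn_integral_cong) (simp add: ennreal_mult[symmetric] ac_simps)
    also have "\<dots> = ennreal (Gamma (lam / 2) * (pi * (norm \<xi>)\<^sup>2) powr - (lam / 2))"
      using lam0 that by (intro nn_integral_powr_exp) auto
    also have "(pi * (norm \<xi>)\<^sup>2) powr - (lam / 2) = pi powr - (lam / 2) * norm \<xi> powr - lam"
      using pi_norm_powr[OF that, of "lam / 2"] by simp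
    finally show ?thesis using D by (simp add: D_def ennreal_mult[symmetric] mult.assoc)
  qed
  have "ennreal D * (\<integral>\<^sup>+\<xi>. ennreal (norm \<xi> powr - lam * (norm (fourier u \<xi>))\<^sup>2) \<partial>lborel)
     = (\<integral>\<^sup>+\<xi>. (ennreal D * ennreal (norm \<xi> powr - lam)) * ennreal ((norm (fourier u \<xi>))\<^sup>2) \<partial>lborel)"
    by (subst nn_integral_cmult[symmetric]) (auto simp: ennreal_mult mult.assoc)
  also have "\<dots> = (\<integral>\<^sup>+\<xi>. (\<integral>\<^sup>+t. ?a t * ennreal (exp (- pi * t * (norm \<xi>)\<^sup>2)) \<partial>lborel) * ennreal ((norm (fourier u \<xi>))\<^sup>2) \<partial>lborel)"
    using AE_lborel_singleton[of "0::'a"] riesz by (intro nn_integral_cong_AE) (auto elim!: eventually_mono)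
  also have "\<dots> = (\<integral>\<^sup>+\<xi>. \<integral>\<^sup>+t. ?a t * ennreal (exp (- pi * t * (norm \<xi>)\<^sup>2) * (norm (fourier u \<xi>))\<^sup>2) \<partial>lborel \<partial>lborel)"
    by (subst nn_integral_multc[symmetric]) (auto simp: ennreal_mult mult.assoc)
  also have "\<dots> = (\<integral>\<^sup>+t. \<integral>\<^sup>+\<xi>. ?a t * ennreal (exp (- pi * t * (norm \<xi>)\<^sup>2) * (norm (fourier u \<xi>))\<^sup>2) \<partial>lborel \<partial>lborel)"
    by (rule lborel_pair.Fubini') measurable
  also have "\<dots> = (\<integral>\<^sup>+t. ?a t * (\<integral>\<^sup>+\<xi>. ennreal (exp (- pi * t * (norm \<xi>)\<^sup>2) * (norm (fourier u \<xi>))\<^sup>2) \<partial>lborel) \<partial>lborel)"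
    by (intro nn_integral_cong nn_integral_cmult) measurable
  also have "\<dots> \<le> (\<integral>\<^sup>+t. ?a t * (\<integral>\<^sup>+x. \<integral>\<^sup>+y. ennreal (?b x y) * ennreal (heat_kernel t (x - y)) \<partial>lborel \<partial>lborel) \<partial>lborel)"
  proof (rule nn_integral_mono)
    fix t :: real
    show "?a t * (\<integral>\<^sup>+\<xi>. ennreal (exp (- pi * t * (norm \<xi>)\<^sup>2) * (norm (fourier u \<xi>))\<^sup>2) \<partial>lborel)
       \<le> ?a t * (\<integral>\<^sup>+x. \<integral>\<^sup>+y. ennreal (?b x y) * ennreal (heat_kernel t (x - y)) \<partial>lborel \<partial>lborel)"
    proof (cases "t > 0")
      case True
      note nn_integral_gaussian_fourier_le[OF u True]
      also have "(\<integral>\<^sup>+x. \<integral>\<^sup>+y. ennreal (norm (u x) * norm (u y)) * ennreal (heat_kernel t (x - y)) \<partial>lborel \<partial>lborel)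
        \<le> (\<integral>\<^sup>+x. \<integral>\<^sup>+y. ennreal (?b x y) * ennreal (heat_kernel t (x - y)) \<partial>lborel \<partial>lborel)"
      proof (rule schur_test)
        show "ennreal (heat_kernel t (x - y)) = ennreal (heat_kernel t (y - x))" for x y :: 'a
          by (simp add: heat_kernel_def norm_minus_commute)
        show "2 * (norm (u x) * norm (u y)) \<le> ?b x y + ?b y x" if "x \<noteq> 0" "y \<noteq> 0" for x y
        proof -
          \<comment> \<open>r^2 = w(y)/w(x), so \<open>?b x y\<close> and \<open>?b y x\<close> are
            the squares of |u x| r and |u y|/r, whose product is |u x| |u y|.\<close>
          define r where "r = norm x powr ((n + lam) / 4) * norm y powr - ((n + lam) / 4)"
          have r: "r > 0" using that by (simp add: r_def)
          have b: "?b z w = (norm (u z))\<^sup>2 * (norm z powr ((n + lam) / 2) * norm w powr - ((n + lam) / 2))" for z w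
          proof -
            have "lam + (n - lam) / 2 = (n + lam) / 2" by (simp add: field_simps)
            then have "norm z powr lam * norm z powr ((n - lam) / 2) = norm z powr ((n + lam) / 2)"
              by (simp only: powr_add[symmetric])
            moreover have "?b z w = (norm (u z))\<^sup>2 * ((norm z powr lam * norm z powr ((n - lam) / 2)) * norm w powr - ((n + lam) / 2))"
              by (simp only: ac_simps)
            ultimately show ?thesis by (simp only:)
          qed
          have half: "z powr ((n + lam) / 2) = (z powr ((n + lam) / 4))\<^sup>2" for z :: real
          proof -
            have "(n + lam) / 4 + (n + lam) / 4 = (n + lam) / 2" by simp
            then show ?thesis by (simp only: power2_eq_square powr_add[symmetric])
          qed
          have "norm x powr ((n + lam) / 2) * norm y powr - ((n + lam) / 2) = r\<^sup>2"
            "norm y powr ((n + lam) / 2) * norm x powr - ((n + lam) / 2) = (1 / r)\<^sup>2"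
            unfolding r_def powr_minus half by (simp_all only: power_mult_distrib power_inverse divide_inverse inverse_mult_distrib
              inverse_inverse_eq power_one mult_1_left mult.commute)
          then have "?b x y + ?b y x = (norm (u x) * r)\<^sup>2 + (norm (u y) * (1 / r))\<^sup>2"
            unfolding b by (simp only: power_mult_distrib)
          then have b2: "(norm (u x) * r)\<^sup>2 + (norm (u y) * (1 / r))\<^sup>2 = ?b x y + ?b y x" by (rule sym)
          have "2 * (norm (u x) * norm (u y)) = 2 * (norm (u x) * r) * (norm (u y) * (1 / r))" using r by simp
          also have "\<dots> \<le> (norm (u x) * r)\<^sup>2 + (norm (u y) * (1 / r))\<^sup>2" by (rule sum_squares_bound)
          finally show ?thesis unfolding b2 .
        qed
      qed simp_all
      finally show ?thesis by (rule mult_left_mono) simp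
    qed simp
  qed
  also have "\<dots> = (\<integral>\<^sup>+t. \<integral>\<^sup>+x. ?a t * (\<integral>\<^sup>+y. ennreal (?b x y) * ennreal (heat_kernel t (x - y)) \<partial>lborel) \<partial>lborel \<partial>lborel)"
    by (intro nn_integral_cong nn_integral_cmult[symmetric]) measurable
  also have "\<dots> = (\<integral>\<^sup>+x. \<integral>\<^sup>+t. ?a t * (\<integral>\<^sup>+y. ennreal (?b x y) * ennreal (heat_kernel t (x - y)) \<partial>lborel) \<partial>lborel \<partial>lborel)"
    by (rule lborel_pair.Fubini') measurable
  also have "\<dots> = (\<integral>\<^sup>+x. ennreal E * ennreal (?v x) \<partial>lborel)"
  proof (rule nn_integral_cong_AE)
    have "AE x in lborel. x \<noteq> (0::'a)" by (rule AE_lborel_singleton)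
    then show "AE x in lborel. (\<integral>\<^sup>+t. ?a t * (\<integral>\<^sup>+y. ennreal (?b x y) * ennreal (heat_kernel t (x - y)) \<partial>lborel) \<partial>lborel)
       = ennreal E * ennreal (?v x)"
    proof eventually_elim
      fix x :: 'a assume x: "x \<noteq> 0"
      let ?c = "?v x * norm x powr ((n - lam) / 2)"
      let ?w = "\<lambda>t. \<integral>\<^sup>+y. ennreal (norm y powr - ((n + lam) / 2)) * ennreal (heat_kernel t (x - y)) \<partial>lborel"
      have "(\<integral>\<^sup>+y. ennreal (?b x y) * ennreal (heat_kernel t (x - y)) \<partial>lborel) = ennreal ?c * ?w t" for t
        by (subst nn_integral_cmult[symmetric]) (auto simp: ennreal_mult mult.assoc)
      then have "(\<integral>\<^sup>+t. ?a t * (\<integral>\<^sup>+y. ennreal (?b x y) * ennreal (heat_kernel t (x - y)) \<partial>lborel) \<partial>lborel)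
         = (\<integral>\<^sup>+t. ennreal ?c * (?a t * ?w t) \<partial>lborel)" by (simp only: mult.left_commute)
      also have "\<dots> = ennreal ?c * (\<integral>\<^sup>+t. ?a t * ?w t \<partial>lborel)" by (rule nn_integral_cmult) measurable
      \<comment> \<open>The Riesz potential of the weight cancels the power |x|^((n-\<lambda>)/2)
        contained in \<open>?b\<close>, leaving the constant \<open>E\<close>.\<close>
      also have "\<dots> = ennreal ?c * ennreal (E * norm x powr - ((n - lam) / 2))"
        using riesz_potential_powr[OF lam0 lam(2) x] unfolding n_def E_def by simp
      also have "\<dots> = ennreal (E * ?v x)"
        using x E by (simp add: ennreal_mult[symmetric] powr_minus field_simps)
      finally show "(\<integral>\<^sup>+t. ?a t * (\<integral>\<^sup>+y. ennreal (?b x y) * ennreal (heat_kernel t (x - y)) \<partial>lborel) \<partial>lborel)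
       = ennreal E * ennreal (?v x)" using E by (simp add: ennreal_mult)
    qed
  qed
  also have "\<dots> = ennreal E * (\<integral>\<^sup>+x. ennreal (?v x) \<partial>lborel)" by (rule nn_integral_cmult) measurable
  also have "E = D * pitt_const DIM('a) lam"
  proof -
    have "pi powr (lam / 2) = pi powr - (lam / 2) * pi powr lam" by (simp add: powr_add[symmetric])
    then show ?thesis by (simp add: E_def D_def pitt_const_def n_def)
  qed
  finally have "ennreal D * (\<integral>\<^sup>+\<xi>. ennreal (norm \<xi> powr - lam * (norm (fourier u \<xi>))\<^sup>2) \<partial>lborel)
     \<le> ennreal D * (ennreal (pitt_const DIM('a) lam) * (\<integral>\<^sup>+x. ennreal (?v x) \<partial>lborel))"
    using D by (simp add: ennreal_mult' mult.assoc)
  then show ?thesis using D by (subst (asm) ennreal_mult_le_mult_iff) auto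
qed

section \<open>The Fourier transform on square integrable functions\<close>

abbreviation L2_dist :: "('a::euclidean_space \<Rightarrow> complex) \<Rightarrow> ('a \<Rightarrow> complex) \<Rightarrow> ennreal" where
  "L2_dist f g \<equiv> \<integral>\<^sup>+x. ennreal ((norm (f x - g x))\<^sup>2) \<partial>lborel"

lemma norm_diff_square_le:
  fixes a b c :: "'a::real_normed_vector"
  shows "(norm (a - c))\<^sup>2 \<le> 2 * (norm (a - b))\<^sup>2 + 2 * (norm (b - c))\<^sup>2"
proof -
  have "norm (a - c) \<le> norm (a - b) + norm (b - c)" by norm
  then have "(norm (a - c))\<^sup>2 \<le> (norm (a - b) + norm (b - c))\<^sup>2" by (intro power_mono) auto
  also have "\<dots> \<le> 2 * (norm (a - b))\<^sup>2 + 2 * (norm (b - c))\<^sup>2"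
    using sum_squares_bound[of "norm (a - b)" "norm (b - c)"] by (simp add: power2_sum)
  finally show ?thesis .
qed

text \<open>\<open>L2_dist\<close> is the square of the L2 distance, so the triangle inequality
  costs a factor 2. This is harmless where distances only have to tend to 0 or stay finite.\<close>

lemma L2_dist_triangle:
  assumes [measurable]: "f \<in> borel_measurable borel" "g \<in> borel_measurable borel" "h \<in> borel_measurable borel"
  shows "L2_dist f h \<le> 2 * L2_dist f g + 2 * L2_dist g h"
proof -
  have "L2_dist f h \<le> (\<integral>\<^sup>+x. 2 * ennreal ((norm (f x - g x))\<^sup>2) + 2 * ennreal ((norm (g x - h x))\<^sup>2) \<partial>lborel)"
  proof (rule nn_integral_mono)
    fix x
    have "ennreal ((norm (f x - h x))\<^sup>2) \<le> ennreal (2 * (norm (f x - g x))\<^sup>2 + 2 * (norm (g x - h x))\<^sup>2)"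
      by (rule ennreal_leI[OF norm_diff_square_le])
    then show "ennreal ((norm (f x - h x))\<^sup>2) \<le> 2 * ennreal ((norm (f x - g x))\<^sup>2) + 2 * ennreal ((norm (g x - h x))\<^sup>2)"
      by (simp add: ennreal_mult)
  qed
  also have "\<dots> = 2 * L2_dist f g + 2 * L2_dist g h"
    by (simp add: nn_integral_add nn_integral_cmult)
  finally show ?thesis .
qed

lemma L2_dist_commute: "L2_dist f g = L2_dist g f"
  by (simp add: norm_minus_commute)

lemma square_integrable_iff:
  "square_integrable f \<longleftrightarrow> f \<in> borel_measurable borel \<and> (\<integral>\<^sup>+x. ennreal ((norm (f x))\<^sup>2) \<partial>lborel) < \<infinity>"
  unfolding square_integrable_def by (auto simp: integrable_iff_bounded)

lemma fourier_diff:
  assumes "integrable lborel u" "integrable lborel v"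
  shows "fourier (\<lambda>x. u x - v x) \<xi> = fourier u \<xi> - fourier v \<xi>"
  unfolding fourier_def left_diff_distrib
  by (rule Bochner_Integration.integral_diff[OF integrable_mult_fchar[OF assms(1)] integrable_mult_fchar[OF assms(2)]])

lemma bessel_dist:
  assumes "integrable lborel u" "integrable lborel v"
  shows "L2_dist (fourier u) (fourier v) \<le> L2_dist u v"
  using fourier_bessel[of "\<lambda>x. u x - v x"] assms by (simp add: fourier_diff)

text \<open>Cutting off to balls makes a square integrable function integrable, and the modulus
  never increases, so the weighted norm on the right of Pitt's inequality does not grow.\<close>

definition truncation :: "real \<Rightarrow> ('a::euclidean_space \<Rightarrow> complex) \<Rightarrow> 'a \<Rightarrow> complex" where
  "truncation R f x = (if norm x \<le> R then f x else 0)"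

lemma truncation_measurable [measurable]:
  assumes [measurable]: "f \<in> borel_measurable borel"
  shows "truncation R f \<in> borel_measurable borel"
proof -
  have "truncation R f = (\<lambda>x. if x \<in> cball 0 R then f x else 0)" by (auto simp: truncation_def)
  then show ?thesis by simp
qed

text \<open>On a ball, which has finite measure, |f| is dominated by 1 + |f|^2.\<close>

lemma integrable_truncation:
  fixes f :: "'a::euclidean_space \<Rightarrow> complex"
  assumes "square_integrable f"
  shows "integrable lborel (truncation R f)"
proof (rule Bochner_Integration.integrable_bound)
  have [measurable]: "f \<in> borel_measurable borel" using assms by (simp add: square_integrable_def)
  have "integrable lborel (indicator (cball 0 R) :: 'a \<Rightarrow> real)"
    by (rule integrable_real_indicator) (use emeasure_bounded_finite[OF bounded_cball, of "0 :: 'a" R] in simp_all)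
  then show "integrable lborel (\<lambda>x. indicator (cball 0 R) x + (norm (f x))\<^sup>2)"
    using assms by (simp add: square_integrable_def)
  show "truncation R f \<in> borel_measurable lborel" by simp
  show "AE x in lborel. norm (truncation R f x) \<le> norm (indicator (cball 0 R) x + (norm (f x))\<^sup>2)"
  proof (rule AE_I2)
    fix x :: 'a
    have "norm (f x) \<le> 1 + (norm (f x))\<^sup>2"
      using sum_squares_bound[of "norm (f x)" 1] by (simp add: algebra_simps) (smt (verit) zero_le_power2)
    then show "norm (truncation R f x) \<le> norm (indicator (cball 0 R) x + (norm (f x))\<^sup>2 :: real)"
      by (auto simp: truncation_def indicator_def)
  qed
qed

lemma truncation_L2_le:
  "(\<integral>\<^sup>+x. ennreal ((norm (truncation R f x))\<^sup>2) \<partial>lborel) \<le> (\<integral>\<^sup>+x. ennreal ((norm (f x))\<^sup>2) \<partial>lborel)"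
  by (rule nn_integral_mono) (simp add: truncation_def)

lemma square_integrable_truncation:
  assumes "square_integrable f"
  shows "square_integrable (truncation R f)"
  using assms truncation_L2_le[of R f] unfolding square_integrable_iff by (auto intro: le_less_trans)

lemma truncation_tendsto:
  fixes f :: "'a::euclidean_space \<Rightarrow> complex"
  assumes "square_integrable f"
  shows "(\<lambda>k. L2_dist (truncation (real k) f) f) \<longlonglongrightarrow> 0"
proof -
  have [measurable]: "f \<in> borel_measurable borel" using assms by (simp add: square_integrable_def)
  have "(\<lambda>k. \<integral>\<^sup>+x. ennreal ((norm (truncation (real k) f x - f x))\<^sup>2) \<partial>lborel) \<longlonglongrightarrow> (\<integral>\<^sup>+x. 0 \<partial>(lborel :: 'a measure))"
  proof (rule nn_integral_dominated_convergence[where w = "\<lambda>x. ennreal ((norm (f x))\<^sup>2)"])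
    show "(\<integral>\<^sup>+x. ennreal ((norm (f x))\<^sup>2) \<partial>lborel) < \<infinity>" using assms by (simp add: square_integrable_iff)
    show "AE x in lborel. ennreal ((norm (truncation (real k) f x - f x))\<^sup>2) \<le> ennreal ((norm (f x))\<^sup>2)" for k
      by (auto simp: truncation_def)
    show "AE x in lborel. (\<lambda>k. ennreal ((norm (truncation (real k) f x - f x))\<^sup>2)) \<longlonglongrightarrow> 0"
    proof (rule AE_I2)
      fix x :: 'a
      obtain N where N: "norm x \<le> real N" using real_arch_simple by blast
      have "\<forall>\<^sub>F k in sequentially. ennreal ((norm (truncation (real k) f x - f x))\<^sup>2) = 0"
        using eventually_ge_at_top[of N]
      proof eventually_elim
        case (elim k)
        then have "norm x \<le> real k" using N by linarith
        then show ?case by (simp add: truncation_def)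
      qed
      then show "(\<lambda>k. ennreal ((norm (truncation (real k) f x - f x))\<^sup>2)) \<longlonglongrightarrow> 0"
        by (rule tendsto_eventually)
    qed
  qed measurable
  then show ?thesis by simp
qed

text \<open>Controls the transform of every integrable approximant of \<open>f\<close>, not only of
  the sequence hidden in \<open>is_fourier_L2\<close>; this admits truncations in Pitt's inequality.
  Going through that sequence uses the squared triangle inequality twice, whence the factor 4; the
  remaining terms vanish in the limit.\<close>

lemma is_fourier_L2_dist_le:
  fixes f g :: "'a::euclidean_space \<Rightarrow> complex"
  assumes fg: "is_fourier_L2 f g" and [measurable]: "f \<in> borel_measurable borel" and v: "integrable lborel v"
  shows "L2_dist (fourier v) g \<le> 4 * L2_dist v f"
proof -
  have [measurable]: "g \<in> borel_measurable borel" "v \<in> borel_measurable borel"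
    using fg v by (auto simp: is_fourier_L2_def square_integrable_def)
  obtain u where u: "\<And>k. integrable lborel (u k)"
    and lim: "(\<lambda>k. L2_dist (u k) f) \<longlonglongrightarrow> 0" "(\<lambda>k. L2_dist (fourier (u k)) g) \<longlonglongrightarrow> 0"
    using fg unfolding is_fourier_L2_def by blast
  have [measurable]: "u k \<in> borel_measurable borel" for k using u[of k] by auto
  have le: "L2_dist (fourier v) g \<le> 4 * L2_dist v f + (4 * L2_dist (u k) f + 2 * L2_dist (fourier (u k)) g)" for k
  proof -
    have "L2_dist (fourier v) g \<le> 2 * L2_dist (fourier v) (fourier (u k)) + 2 * L2_dist (fourier (u k)) g"
      by (rule L2_dist_triangle) measurable
    also have "\<dots> \<le> 2 * (2 * L2_dist v f + 2 * L2_dist f (u k)) + 2 * L2_dist (fourier (u k)) g"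
      by (intro add_mono mult_left_mono order_trans[OF bessel_dist[OF v u]] L2_dist_triangle) simp_all
    also have "\<dots> = 4 * L2_dist v f + (4 * L2_dist (u k) f + 2 * L2_dist (fourier (u k)) g)"
      by (simp add: L2_dist_commute[of f] distrib_left mult.assoc[symmetric] add.assoc)
    finally show ?thesis .
  qed
  have "(\<lambda>k. 4 * L2_dist v f + (4 * L2_dist (u k) f + 2 * L2_dist (fourier (u k)) g)) \<longlonglongrightarrow> 4 * L2_dist v f + (4 * 0 + 2 * 0)"
    by (intro tendsto_intros ennreal_tendsto_cmult lim) simp_all
  then show ?thesis using le by (intro LIMSEQ_le_const) auto
qed

text \<open>A Riesz-Fischer argument: by Bessel's inequality the transforms of truncations form a
  Cauchy sequence, a fast subsequence converges almost everywhere, and Fatou's lemma shows that the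
  pointwise limit is the L2 limit. Existence is what gives the choice in \<open>fourier_L2\<close>
  its meaning.\<close>

theorem ex_is_fourier_L2:
  fixes f :: "'a::euclidean_space \<Rightarrow> complex"
  assumes f: "square_integrable f"
  shows "\<exists>g. is_fourier_L2 f g"
proof -
  have [measurable]: "f \<in> borel_measurable borel" using f by (simp add: square_integrable_def)
  \<comment> \<open>The rate 8^(-k) leaves room for the weight 2^k below: the weighted increments
    are still bounded by 4 * 4^(-k), which is summable.\<close>
  have "\<exists>R. L2_dist (truncation (real R) f) f \<le> ennreal ((1 / 8) ^ k)" for k
  proof -
    have "\<forall>\<^sub>F R in sequentially. L2_dist (truncation (real R) f) f < ennreal ((1 / 8) ^ k)"
      by (rule order_tendstoD(2)[OF truncation_tendsto[OF f]]) simp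
    then show ?thesis by (auto simp: eventually_sequentially intro: less_imp_le)
  qed
  then obtain R where R: "\<And>k. L2_dist (truncation (real (R k)) f) f \<le> ennreal ((1 / 8) ^ k)" by metis
  define u where "u k = truncation (real (R k)) f" for k
  have u: "integrable lborel (u k)" "square_integrable (u k)" for k
    unfolding u_def using integrable_truncation[OF f] square_integrable_truncation[OF f] by auto
  have [measurable]: "u k \<in> borel_measurable borel" for k using u(1)[of k] by auto
  have uf: "L2_dist (u k) f \<le> ennreal ((1 / 8) ^ k)" for k using R by (simp add: u_def)
  have uu: "L2_dist (fourier (u l)) (fourier (u k)) \<le> ennreal (4 * (1 / 8) ^ k)" if "k \<le> l" for k l
  proof -
    have "L2_dist (fourier (u l)) (fourier (u k)) \<le> 2 * L2_dist (u l) f + 2 * L2_dist f (u k)"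
      by (rule order_trans[OF bessel_dist[OF u(1) u(1)] L2_dist_triangle]) measurable
    also have "\<dots> \<le> 2 * ennreal ((1 / 8) ^ k) + 2 * ennreal ((1 / 8) ^ k)"
    proof (intro add_mono mult_left_mono)
      have "ennreal ((1 / 8) ^ l) \<le> ennreal ((1 / 8) ^ k)"
        using that by (intro ennreal_leI power_decreasing) auto
      then show "L2_dist (u l) f \<le> ennreal ((1 / 8) ^ k)" using uf[of l] by (rule order_trans[rotated])
      show "L2_dist f (u k) \<le> ennreal ((1 / 8) ^ k)" using uf[of k] by (simp only: L2_dist_commute[of f])
    qed simp_all
    also have "\<dots> = ennreal (4 * (1 / 8) ^ k)"
    proof -
      have "2 * ennreal ((1 / 8) ^ k) + 2 * ennreal ((1 / 8) ^ k) = (2 + 2) * ennreal ((1 / 8) ^ k)"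
        by (simp only: distrib_right)
      then show ?thesis by (simp add: ennreal_mult)
    qed
    finally show ?thesis .
  qed
  define d where "d k \<xi> = fourier (u (Suc k)) \<xi> - fourier (u k) \<xi>" for k \<xi>
  have [measurable]: "d k \<in> borel_measurable borel" for k unfolding d_def by measurable
  have "(\<integral>\<^sup>+\<xi>. (\<Sum>k. ennreal (2 ^ k * (norm (d k \<xi>))\<^sup>2)) \<partial>lborel) = (\<Sum>k. \<integral>\<^sup>+\<xi>. ennreal (2 ^ k * (norm (d k \<xi>))\<^sup>2) \<partial>lborel)"
    by (rule nn_integral_suminf) measurable
  also have "\<dots> \<le> (\<Sum>k. ennreal (4 * (1 / 4) ^ k))"
  proof (intro suminf_le summableI)
    fix k
    have "(\<integral>\<^sup>+\<xi>. ennreal (2 ^ k * (norm (d k \<xi>))\<^sup>2) \<partial>lborel) = ennreal (2 ^ k) * L2_dist (fourier (u (Suc k))) (fourier (u k))"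
      unfolding d_def by (subst nn_integral_cmult[symmetric]) (simp_all add: ennreal_mult)
    also have "\<dots> \<le> ennreal (2 ^ k) * ennreal (4 * (1 / 8) ^ k)"
      by (intro mult_left_mono uu) simp_all
    also have "\<dots> = ennreal (2 ^ k * (4 * (1 / 8) ^ k))" by (rule ennreal_mult[symmetric]) simp_all
    also have "2 ^ k * (4 * (1 / 8) ^ k) = 4 * (1 / 4 :: real) ^ k"
      by (simp add: power_mult_distrib[symmetric] mult.left_commute)
    finally show "(\<integral>\<^sup>+\<xi>. ennreal (2 ^ k * (norm (d k \<xi>))\<^sup>2) \<partial>lborel) \<le> ennreal (4 * (1 / 4) ^ k)" .
  qed
  also have "\<dots> = ennreal (\<Sum>k. 4 * (1 / 4) ^ k)"
    by (rule suminf_ennreal2) (auto intro!: summable_mult summable_geometric)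
  finally have "(\<integral>\<^sup>+\<xi>. (\<Sum>k. ennreal (2 ^ k * (norm (d k \<xi>))\<^sup>2)) \<partial>lborel) \<noteq> \<infinity>" by (auto simp: top_unique)
  then have "AE \<xi> in lborel. (\<Sum>k. ennreal (2 ^ k * (norm (d k \<xi>))\<^sup>2)) \<noteq> \<infinity>"
    by (intro nn_integral_PInf_AE) simp_all
  then have conv: "AE \<xi> in lborel. convergent (\<lambda>k. fourier (u k) \<xi>)"
  proof eventually_elim
    case (elim \<xi>)
    have 1: "summable (\<lambda>k. 2 ^ k * (norm (d k \<xi>))\<^sup>2)" by (rule summable_suminf_not_top) (use elim in auto)
    have 2: "summable (\<lambda>k. (1 / 2 :: real) ^ k)" by (intro summable_geometric) simp
    have "summable (\<lambda>k. norm (d k \<xi>))"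
    proof (rule summable_comparison_test'[OF summable_add[OF 2 1]])
      fix k
      define a :: real where "a = 2 ^ k"
      have a: "a > 0" by (simp add: a_def)
      \<comment> \<open>Arithmetic and geometric means with a = 2^k: the weighted squares and the
        geometric series together dominate the norms of the increments.\<close>
      have "0 \<le> (1 / a - norm (d k \<xi>))\<^sup>2 * a" using a by simp
      also have "\<dots> = 1 / a - 2 * norm (d k \<xi>) + a * (norm (d k \<xi>))\<^sup>2"
        using a by (simp add: power2_eq_square field_simps)
      finally have "2 * norm (d k \<xi>) \<le> 1 / a + a * (norm (d k \<xi>))\<^sup>2" by simp
      then have "norm (d k \<xi>) \<le> 1 / a + a * (norm (d k \<xi>))\<^sup>2" using norm_ge_zero[of "d k \<xi>"] by linarith
      then show "norm (norm (d k \<xi>)) \<le> (1 / 2) ^ k + 2 ^ k * (norm (d k \<xi>))\<^sup>2"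
        by (simp add: a_def power_one_over)
    qed
    then have "summable (\<lambda>k. d k \<xi>)" by (rule summable_norm_cancel)
    then have "convergent (\<lambda>k. fourier (u 0) \<xi> + (\<Sum>i<k. d i \<xi>))"
      by (intro convergent_add convergent_const) (simp add: summable_iff_convergent)
    moreover have "fourier (u 0) \<xi> + (\<Sum>i<k. d i \<xi>) = fourier (u k) \<xi>" for k
      unfolding d_def sum_lessThan_telescope[of "\<lambda>i. fourier (u i) \<xi>"] by simp
    ultimately show ?case by simp
  qed
  \<comment> \<open>Where the sequence diverges, \<open>lim\<close> is an unspecified value;
    \<open>g\<close> is measurable nevertheless, and the divergence set is null.\<close>
  define g where "g \<xi> = lim (\<lambda>k. fourier (u k) \<xi>)" for \<xi>
  have [measurable]: "g \<in> borel_measurable borel" unfolding g_def by measurable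
  have ug: "L2_dist (fourier (u k)) g \<le> ennreal (4 * (1 / 8) ^ k)" for k
  proof -
    \<comment> \<open>The Cauchy bound \<open>uu\<close> for all l \<ge> k passes to the limit
      \<open>g\<close> by Fatou's lemma.\<close>
    have "L2_dist (fourier (u k)) g = (\<integral>\<^sup>+\<xi>. liminf (\<lambda>l. ennreal ((norm (fourier (u k) \<xi> - fourier (u l) \<xi>))\<^sup>2)) \<partial>lborel)"
    proof (rule nn_integral_cong_AE)
      show "AE \<xi> in lborel. ennreal ((norm (fourier (u k) \<xi> - g \<xi>))\<^sup>2) = liminf (\<lambda>l. ennreal ((norm (fourier (u k) \<xi> - fourier (u l) \<xi>))\<^sup>2))"
        using conv
      proof eventually_elim
        case (elim \<xi>)
        then have "(\<lambda>l. fourier (u l) \<xi>) \<longlonglongrightarrow> g \<xi>" by (simp add: g_def convergent_LIMSEQ_iff)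
        then show ?case
          by (intro lim_imp_Liminf[symmetric] tendsto_ennrealI tendsto_intros) simp_all
      qed
    qed
    also have "\<dots> \<le> liminf (\<lambda>l. L2_dist (fourier (u k)) (fourier (u l)))"
      by (rule nn_integral_liminf) measurable
    also have "\<dots> \<le> limsup (\<lambda>l. L2_dist (fourier (u k)) (fourier (u l)))"
      by (rule Liminf_le_Limsup) simp
    also have "\<dots> \<le> ennreal (4 * (1 / 8) ^ k)"
      by (rule Limsup_bounded, rule eventually_mono[OF eventually_ge_at_top[of k]])
        (use uu in \<open>simp add: L2_dist_commute[of "fourier (u k)"]\<close>)
    finally show ?thesis .
  qed
  have "(\<integral>\<^sup>+\<xi>. ennreal ((norm (g \<xi>))\<^sup>2) \<partial>lborel) < \<infinity>"
  proof -
    have "L2_dist g (\<lambda>_. 0) \<le> 2 * L2_dist g (fourier (u 0)) + 2 * L2_dist (fourier (u 0)) (\<lambda>_. 0)"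
      by (rule L2_dist_triangle) measurable
    also have "\<dots> \<le> 2 * ennreal (4 * (1 / 8) ^ 0) + 2 * (\<integral>\<^sup>+x. ennreal ((norm (u 0 x))\<^sup>2) \<partial>lborel)"
      using ug[of 0] fourier_bessel[OF u(1)[of 0]]
      by (intro add_mono mult_left_mono) (simp_all add: L2_dist_commute[of g])
    also have "\<dots> < \<infinity>" using u(2)[of 0] by (simp add: square_integrable_iff ennreal_mult_less_top)
    finally show ?thesis by simp
  qed
  then have g: "square_integrable g" by (simp add: square_integrable_iff)
  have lim: "(\<lambda>k. ennreal (c * (1 / 8) ^ k)) \<longlonglongrightarrow> 0" for c
  proof -
    have "(\<lambda>k. c * (1 / 8 :: real) ^ k) \<longlonglongrightarrow> c * 0" by (intro tendsto_intros LIMSEQ_realpow_zero) simp_all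
    then have "(\<lambda>k. ennreal (c * (1 / 8 :: real) ^ k)) \<longlonglongrightarrow> ennreal (c * 0)" by (rule tendsto_ennrealI)
    then show ?thesis by simp
  qed
  have "(\<lambda>k. L2_dist (u k) f) \<longlonglongrightarrow> 0"
    by (rule tendsto_sandwich[OF _ _ tendsto_const lim[of 1]]) (use uf in auto)
  moreover have "(\<lambda>k. L2_dist (fourier (u k)) g) \<longlonglongrightarrow> 0"
    by (rule tendsto_sandwich[OF _ _ tendsto_const lim[of 4]]) (use ug in auto)
  ultimately have "is_fourier_L2 f g"
    unfolding is_fourier_L2_def using g u by blast
  then show ?thesis by blast
qed

lemma is_fourier_L2_fourier_L2: "square_integrable f \<Longrightarrow> is_fourier_L2 f (fourier_L2 f)"
  unfolding fourier_L2_def by (rule someI_ex[OF ex_is_fourier_L2])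

text \<open>The inequality for integrable functions is applied to truncations. Their transforms
  converge to \<open>g\<close> in L2, hence almost everywhere along a subsequence, so Fatou's lemma
  handles the left side; on the right the truncations are dominated by \<open>f\<close>.\<close>

theorem pitt_inequality:
  fixes f g :: "'a::euclidean_space \<Rightarrow> complex"
  assumes lam: "0 \<le> lam" "lam < real DIM('a)" and f: "square_integrable f" and fg: "is_fourier_L2 f g"
  shows "(\<integral>\<^sup>+\<xi>. ennreal (norm \<xi> powr - lam * (norm (g \<xi>))\<^sup>2) \<partial>lborel)
     \<le> ennreal (pitt_const DIM('a) lam) * (\<integral>\<^sup>+x. ennreal (norm x powr lam * (norm (f x))\<^sup>2) \<partial>lborel)"
proof -
  have [measurable]: "f \<in> borel_measurable borel" "g \<in> borel_measurable borel"
    using f fg by (auto simp: is_fourier_L2_def square_integrable_def)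
  define v where "v k = truncation (real k) f" for k
  have v: "integrable lborel (v k)" for k unfolding v_def by (rule integrable_truncation[OF f])
  have [measurable]: "v k \<in> borel_measurable borel" for k using v[of k] by auto
  let ?d = "\<lambda>k \<xi>. (norm (fourier (v k) \<xi> - g \<xi>))\<^sup>2"
  have le: "L2_dist (fourier (v k)) g \<le> 4 * L2_dist (v k) f" for k
    by (rule is_fourier_L2_dist_le[OF fg _ v]) measurable
  have fin: "L2_dist (v k) f < \<infinity>" for k
  proof -
    have "L2_dist (v k) f \<le> (\<integral>\<^sup>+x. ennreal ((norm (f x))\<^sup>2) \<partial>lborel)"
      by (rule nn_integral_mono) (simp add: v_def truncation_def)
    then show ?thesis using f by (simp add: square_integrable_iff)
  qed
  have int: "integrable lborel (?d k)" for k
    using le_less_trans[OF le[of k]] fin[of k] by (simp add: integrable_iff_bounded ennreal_mult_less_top)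
  have "(\<lambda>k. 4 * L2_dist (v k) f) \<longlonglongrightarrow> 4 * 0"
    unfolding v_def by (intro ennreal_tendsto_cmult truncation_tendsto[OF f]) simp
  then have lim4: "(\<lambda>k. 4 * L2_dist (v k) f) \<longlonglongrightarrow> 0" by simp
  have "(\<lambda>k. L2_dist (fourier (v k)) g) \<longlonglongrightarrow> 0"
    by (rule tendsto_sandwich[OF _ _ tendsto_const lim4]) (use le in auto)
  then have "(\<lambda>k. ennreal (LINT \<xi>|lborel. ?d k \<xi>)) \<longlonglongrightarrow> ennreal 0"
    using int by (subst nn_integral_eq_integral[symmetric]) simp_all
  then have "(\<lambda>k. LINT \<xi>|lborel. norm (?d k \<xi>)) \<longlonglongrightarrow> 0"
    by (subst (asm) tendsto_ennreal_iff) simp_all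
  then obtain r where r: "strict_mono r" "AE \<xi> in lborel. (\<lambda>k. ?d (r k) \<xi>) \<longlonglongrightarrow> 0"
    using tendsto_L1_AE_subseq[of lborel ?d, OF int] by blast
  have "(\<integral>\<^sup>+\<xi>. ennreal (norm \<xi> powr - lam * (norm (g \<xi>))\<^sup>2) \<partial>lborel)
     = (\<integral>\<^sup>+\<xi>. liminf (\<lambda>k. ennreal (norm \<xi> powr - lam * (norm (fourier (v (r k)) \<xi>))\<^sup>2)) \<partial>lborel)"
  proof (rule nn_integral_cong_AE)
    show "AE \<xi> in lborel. ennreal (norm \<xi> powr - lam * (norm (g \<xi>))\<^sup>2) = liminf (\<lambda>k. ennreal (norm \<xi> powr - lam * (norm (fourier (v (r k)) \<xi>))\<^sup>2))"
      using r(2)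
    proof eventually_elim
      case (elim \<xi>)
      then have "(\<lambda>k. sqrt (?d (r k) \<xi>)) \<longlonglongrightarrow> sqrt 0" by (rule tendsto_real_sqrt)
      then have "(\<lambda>k. fourier (v (r k)) \<xi> - g \<xi>) \<longlonglongrightarrow> 0" by (simp add: tendsto_norm_zero_iff)
      then have "(\<lambda>k. fourier (v (r k)) \<xi>) \<longlonglongrightarrow> g \<xi>" by (simp add: LIM_zero_iff)
      then show ?case
        by (intro lim_imp_Liminf[symmetric] tendsto_ennrealI tendsto_intros) simp_all
    qed
  qed
  also have "\<dots> \<le> liminf (\<lambda>k. \<integral>\<^sup>+\<xi>. ennreal (norm \<xi> powr - lam * (norm (fourier (v (r k)) \<xi>))\<^sup>2) \<partial>lborel)"
    by (rule nn_integral_liminf) measurable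
  also have "\<dots> \<le> liminf (\<lambda>k::nat. ennreal (pitt_const DIM('a) lam) * (\<integral>\<^sup>+x. ennreal (norm x powr lam * (norm (f x))\<^sup>2) \<partial>lborel))"
  proof (intro Liminf_mono always_eventually allI)
    fix k
    note pitt_inequality_L1[OF lam v[of "r k"]]
    also have "(\<integral>\<^sup>+x. ennreal (norm x powr lam * (norm (v (r k) x))\<^sup>2) \<partial>lborel) \<le> (\<integral>\<^sup>+x. ennreal (norm x powr lam * (norm (f x))\<^sup>2) \<partial>lborel)"
      by (rule nn_integral_mono) (simp add: v_def truncation_def)
    finally show "(\<integral>\<^sup>+\<xi>. ennreal (norm \<xi> powr - lam * (norm (fourier (v (r k)) \<xi>))\<^sup>2) \<partial>lborel)
      \<le> ennreal (pitt_const DIM('a) lam) * (\<integral>\<^sup>+x. ennreal (norm x powr lam * (norm (f x))\<^sup>2) \<partial>lborel)"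
      by (simp add: mult_left_mono)
  qed
  also have "\<dots> = ennreal (pitt_const DIM('a) lam) * (\<integral>\<^sup>+x. ennreal (norm x powr lam * (norm (f x))\<^sup>2) \<partial>lborel)"
    by (simp add: Liminf_const)
  finally show ?thesis .
qed

section \<open>Fourier transforms of correlations\<close>

lemma lborel_distr_reflect:
  fixes c :: "'a::euclidean_space"
  shows "distr lborel borel (\<lambda>x. c - x) = lborel"
  by (subst lborel_affine[of "-1" c]) (auto simp: density_1)

lemma integrable_reflect:
  fixes h :: "'a::euclidean_space \<Rightarrow> complex"
  assumes "integrable lborel h"
  shows "integrable lborel (\<lambda>t. h (c - t))"
  by (rule integrable_distr[of "\<lambda>t. c - t" lborel borel]) (simp_all add: lborel_distr_reflect assms)

lemma integral_reflect:
  fixes h :: "'a::euclidean_space \<Rightarrow> 'b::{banach, second_countable_topology}"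
  assumes [measurable]: "h \<in> borel_measurable borel"
  shows "(LINT t|lborel. h (c - t)) = (LINT t|lborel. h t)"
  by (subst (2) lborel_distr_reflect[of c, symmetric]) (simp add: integral_distr)

definition correlation :: "('a::euclidean_space \<Rightarrow> complex) \<Rightarrow> ('a \<Rightarrow> complex) \<Rightarrow> 'a \<Rightarrow> complex" where
  "correlation f \<phi> t = (LINT x|lborel. f x * cnj (\<phi> (x - t)))"

lemma correlation_measurable [measurable]:
  assumes [measurable]: "f \<in> borel_measurable borel" "\<phi> \<in> borel_measurable borel"
  shows "correlation f \<phi> \<in> borel_measurable borel"
  unfolding correlation_def by (rule lborel.borel_measurable_lebesgue_integral) measurable

lemma integrable_correlation_kernel:
  fixes f \<phi> :: "'a::euclidean_space \<Rightarrow> complex"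
  assumes f: "integrable lborel f" and \<phi>: "integrable lborel \<phi>"
  shows "integrable (lborel \<Otimes>\<^sub>M lborel) (\<lambda>(x, t). f x * cnj (\<phi> (x - t)))"
proof (rule lborel_pair.Fubini_integrable)
  have [measurable]: "f \<in> borel_measurable borel" "\<phi> \<in> borel_measurable borel" using f \<phi> by auto
  show "(\<lambda>(x, t). f x * cnj (\<phi> (x - t))) \<in> borel_measurable (lborel \<Otimes>\<^sub>M lborel)" by measurable
  have "(LINT t|lborel. norm (f x * cnj (\<phi> (x - t)))) = norm (f x) * (LINT t|lborel. norm (\<phi> t))" for x
    using integral_reflect[of "\<lambda>t. norm (\<phi> t)" x] by (simp add: norm_mult)
  then show "integrable lborel (\<lambda>x. LINT t|lborel. norm (case (x, t) of (x, t) \<Rightarrow> f x * cnj (\<phi> (x - t))))"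
    using f by simp
  show "AE x in lborel. integrable lborel (\<lambda>t. case (x, t) of (x, t) \<Rightarrow> f x * cnj (\<phi> (x - t)))"
    using integrable_reflect[OF \<phi>] by simp
qed

lemma integrable_correlation:
  assumes "integrable lborel f" "integrable lborel \<phi>"
  shows "integrable lborel (correlation f \<phi>)"
  using lborel_pair.integrable_snd[OF integrable_correlation_kernel[OF assms]]
  by (simp add: correlation_def[abs_def])

text \<open>Writing t = x - (x - t) in the character separates the variables after Fubini. The
  conjugation inside the correlation reappears as that of
  \<open>fourier \<phi> \<xi>\<close>.\<close>

lemma fourier_correlation:
  fixes f \<phi> :: "'a::euclidean_space \<Rightarrow> complex"
  assumes f: "integrable lborel f" and \<phi>: "integrable lborel \<phi>"
  shows "fourier (correlation f \<phi>) \<xi> = fourier f \<xi> * cnj (fourier \<phi> \<xi>)"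
proof -
  have [measurable]: "f \<in> borel_measurable borel" "\<phi> \<in> borel_measurable borel" using f \<phi> by auto
  have int: "integrable (lborel \<Otimes>\<^sub>M lborel) (\<lambda>(x, t). f x * cnj (\<phi> (x - t)) * fchar \<xi> t)"
  proof -
    have "(\<lambda>(x, t). f x * cnj (\<phi> (x - t)) * fchar \<xi> t) = (\<lambda>p. (case p of (x, t) \<Rightarrow> f x * cnj (\<phi> (x - t))) * fchar \<xi> (snd p))"
      by auto
    then show ?thesis
      by (simp only:) (rule integrable_mult_bounded[OF integrable_correlation_kernel[OF f \<phi>], where C = 1], simp_all)
  qed
  have "fourier (correlation f \<phi>) \<xi> = (LINT t|lborel. LINT x|lborel. f x * cnj (\<phi> (x - t)) * fchar \<xi> t)"
    unfolding fourier_def correlation_def by (simp only: integral_mult_left_zero)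
  also have "\<dots> = (LINT x|lborel. LINT t|lborel. f x * cnj (\<phi> (x - t)) * fchar \<xi> t)"
    by (rule lborel_pair.Fubini_integral[OF int])
  also have "\<dots> = (LINT x|lborel. f x * fchar \<xi> x * cnj (fourier \<phi> \<xi>))"
  proof (rule Bochner_Integration.integral_cong[OF refl])
    fix x
    have e: "fchar \<xi> t = fchar \<xi> x * cnj (fchar \<xi> (x - t))" for t
      unfolding cnj_fchar exp_add[symmetric] by (simp add: inner_diff_right algebra_simps)
    have "f x * cnj (\<phi> (x - t)) * fchar \<xi> t = f x * fchar \<xi> x * cnj (\<phi> (x - t) * fchar \<xi> (x - t))" for t
      unfolding complex_cnj_mult by (subst e[of t]) (simp only: ac_simps)
    then have "(LINT t|lborel. f x * cnj (\<phi> (x - t)) * fchar \<xi> t) = f x * fchar \<xi> x * cnj (LINT t|lborel. \<phi> (x - t) * fchar \<xi> (x - t))"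
      by (simp only: integral_mult_right_zero Bochner_Integration.integral_cnj)
    then show "(LINT t|lborel. f x * cnj (\<phi> (x - t)) * fchar \<xi> t) = f x * fchar \<xi> x * cnj (fourier \<phi> \<xi>)"
      using integral_reflect[of "\<lambda>t. \<phi> t * fchar \<xi> t" x] by (simp add: fourier_def)
  qed
  also have "\<dots> = fourier f \<xi> * cnj (fourier \<phi> \<xi>)"
    by (simp only: integral_mult_left_zero fourier_def)
  finally show ?thesis .
qed

text \<open>Young's inequality for L1 against L2: Cauchy-Schwarz with |f| split into two square
  roots, then Tonelli in \<open>x\<close> and \<open>t\<close>. It makes correlation with
  \<open>f\<close> continuous on L2.\<close>

lemma correlation_L2_le:
  fixes f \<phi> :: "'a::euclidean_space \<Rightarrow> complex"
  assumes [measurable]: "f \<in> borel_measurable borel" "\<phi> \<in> borel_measurable borel"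
  shows "(\<integral>\<^sup>+t. ennreal ((norm (correlation f \<phi> t))\<^sup>2) \<partial>lborel)
     \<le> (\<integral>\<^sup>+x. ennreal (norm (f x)) \<partial>lborel)\<^sup>2 * (\<integral>\<^sup>+x. ennreal ((norm (\<phi> x))\<^sup>2) \<partial>lborel)"
proof -
  let ?F = "\<integral>\<^sup>+x. ennreal (norm (f x)) \<partial>lborel"
  have "ennreal ((norm (correlation f \<phi> t))\<^sup>2) \<le> ?F * (\<integral>\<^sup>+x. ennreal (norm (f x) * (norm (\<phi> (x - t)))\<^sup>2) \<partial>lborel)" for t
  proof -
    have "ennreal (norm (correlation f \<phi> t)) \<le> (\<integral>\<^sup>+x. ennreal (norm (f x * cnj (\<phi> (x - t)))) \<partial>lborel)"
      unfolding correlation_def by (rule integral_norm_le_nn_integral)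
    also have "\<dots> = (\<integral>\<^sup>+x. ennreal (sqrt (norm (f x))) * ennreal (sqrt (norm (f x)) * norm (\<phi> (x - t))) \<partial>lborel)"
      by (intro nn_integral_cong) (simp add: norm_mult ennreal_mult[symmetric] mult.assoc[symmetric])
    finally have "(ennreal (norm (correlation f \<phi> t)))\<^sup>2 \<le> \<dots>\<^sup>2" by (rule power_mono) simp
    also have "\<dots> \<le> (\<integral>\<^sup>+x. (ennreal (sqrt (norm (f x))))\<^sup>2 \<partial>lborel) * (\<integral>\<^sup>+x. (ennreal (sqrt (norm (f x)) * norm (\<phi> (x - t))))\<^sup>2 \<partial>lborel)"
      by (rule Cauchy_Schwarz_nn_integral) measurable
    finally show ?thesis by (simp add: ennreal_power power_mult_distrib)
  qed
  then have "(\<integral>\<^sup>+t. ennreal ((norm (correlation f \<phi> t))\<^sup>2) \<partial>lborel)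
    \<le> (\<integral>\<^sup>+t. ?F * (\<integral>\<^sup>+x. ennreal (norm (f x) * (norm (\<phi> (x - t)))\<^sup>2) \<partial>lborel) \<partial>lborel)"
    by (rule nn_integral_mono)
  also have "\<dots> = ?F * (\<integral>\<^sup>+t. \<integral>\<^sup>+x. ennreal (norm (f x) * (norm (\<phi> (x - t)))\<^sup>2) \<partial>lborel \<partial>lborel)"
    by (rule nn_integral_cmult) measurable
  also have "(\<integral>\<^sup>+t. \<integral>\<^sup>+x. ennreal (norm (f x) * (norm (\<phi> (x - t)))\<^sup>2) \<partial>lborel \<partial>lborel)
    = (\<integral>\<^sup>+x. \<integral>\<^sup>+t. ennreal (norm (f x) * (norm (\<phi> (x - t)))\<^sup>2) \<partial>lborel \<partial>lborel)"
    by (rule lborel_pair.Fubini') measurable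
  also have "\<dots> = (\<integral>\<^sup>+x. ennreal (norm (f x)) * (\<integral>\<^sup>+x. ennreal ((norm (\<phi> x))\<^sup>2) \<partial>lborel) \<partial>lborel)"
  proof (rule nn_integral_cong)
    fix x
    show "(\<integral>\<^sup>+t. ennreal (norm (f x) * (norm (\<phi> (x - t)))\<^sup>2) \<partial>lborel) = ennreal (norm (f x)) * (\<integral>\<^sup>+x. ennreal ((norm (\<phi> x))\<^sup>2) \<partial>lborel)"
      using nn_integral_lborel_reflect[of "\<lambda>t. ennreal ((norm (\<phi> t))\<^sup>2)" x]
      by (simp add: ennreal_mult nn_integral_cmult)
  qed
  also have "\<dots> = ?F * (\<integral>\<^sup>+x. ennreal ((norm (\<phi> x))\<^sup>2) \<partial>lborel)"
    by (rule nn_integral_multc) measurable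
  finally show ?thesis by (simp add: power2_eq_square mult.assoc)
qed

lemma integrable_mult_square_integrable:
  assumes "square_integrable f" "square_integrable g"
  shows "integrable lborel (\<lambda>x. f x * g x)"
proof (rule Bochner_Integration.integrable_bound)
  have [measurable]: "f \<in> borel_measurable borel" "g \<in> borel_measurable borel"
    using assms by (auto simp: square_integrable_def)
  show "integrable lborel (\<lambda>x. (norm (f x))\<^sup>2 + (norm (g x))\<^sup>2)"
    using assms by (simp add: square_integrable_def)
  show "(\<lambda>x. f x * g x) \<in> borel_measurable lborel" by measurable
  show "AE x in lborel. norm (f x * g x) \<le> norm ((norm (f x))\<^sup>2 + (norm (g x))\<^sup>2)"
  proof (rule AE_I2)
    fix x
    have "2 * norm (f x) * norm (g x) \<le> (norm (f x))\<^sup>2 + (norm (g x))\<^sup>2" by (rule sum_squares_bound)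
    moreover have "0 \<le> norm (f x) * norm (g x)" by simp
    ultimately have "norm (f x) * norm (g x) \<le> (norm (f x))\<^sup>2 + (norm (g x))\<^sup>2" by linarith
    then show "norm (f x * g x) \<le> norm ((norm (f x))\<^sup>2 + (norm (g x))\<^sup>2)"
      by (simp add: norm_mult)
  qed
qed

lemma square_integrable_shift_cnj:
  fixes \<phi> :: "'a::euclidean_space \<Rightarrow> complex"
  assumes "square_integrable \<phi>"
  shows "square_integrable (\<lambda>x. cnj (\<phi> (x - t)))"
proof -
  have [measurable]: "\<phi> \<in> borel_measurable borel" using assms by (simp add: square_integrable_def)
  show ?thesis
    using assms nn_integral_lborel_shift[of "\<lambda>x. ennreal ((norm (\<phi> x))\<^sup>2)" "- t"]
    by (simp add: square_integrable_iff)
qed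

text \<open>As \<open>\<phi>\<close> is only square integrable, \<open>fourier_correlation\<close>
  applies to its approximants. Correlation with \<open>f\<close> on one side and multiplication by
  the bounded function \<open>fourier f\<close> on the other are both continuous on L2, so the
  product formula survives the limit.\<close>

theorem is_fourier_L2_correlation:
  fixes f \<phi> \<Phi> :: "'a::euclidean_space \<Rightarrow> complex"
  assumes f: "integrable lborel f" "square_integrable f"
    and \<phi>: "square_integrable \<phi>" and \<Phi>: "is_fourier_L2 \<phi> \<Phi>"
  shows "is_fourier_L2 (correlation f \<phi>) (\<lambda>\<xi>. fourier f \<xi> * cnj (\<Phi> \<xi>))"
    and "square_integrable (correlation f \<phi>)"
proof -
  have [measurable]: "f \<in> borel_measurable borel" "\<phi> \<in> borel_measurable borel" "\<Phi> \<in> borel_measurable borel"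
    using f \<phi> \<Phi> by (auto simp: is_fourier_L2_def square_integrable_def)
  obtain u where u: "\<And>k. integrable lborel (u k)" "\<And>k. square_integrable (u k)"
    and lim: "(\<lambda>k. L2_dist (u k) \<phi>) \<longlonglongrightarrow> 0" "(\<lambda>k. L2_dist (fourier (u k)) \<Phi>) \<longlonglongrightarrow> 0"
    using \<Phi> unfolding is_fourier_L2_def by blast
  have [measurable]: "u k \<in> borel_measurable borel" for k using u(1)[of k] by auto
  let ?F = "\<integral>\<^sup>+x. ennreal (norm (f x)) \<partial>lborel"
  have F: "?F < \<infinity>" using f by (simp add: integrable_iff_bounded)
  have F2: "?F\<^sup>2 < top" using F by (simp add: power_less_top_ennreal)
  have sq: "square_integrable (correlation f h)" if h: "square_integrable h" for h
  proof -
    have [measurable]: "h \<in> borel_measurable borel" using h by (simp add: square_integrable_def)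
    have "(\<integral>\<^sup>+t. ennreal ((norm (correlation f h t))\<^sup>2) \<partial>lborel) \<le> ?F\<^sup>2 * (\<integral>\<^sup>+x. ennreal ((norm (h x))\<^sup>2) \<partial>lborel)"
      by (rule correlation_L2_le) measurable
    also have "\<dots> < \<infinity>" using F2 h by (simp add: square_integrable_iff ennreal_mult_less_top)
    finally show ?thesis by (simp add: square_integrable_iff)
  qed
  then show "square_integrable (correlation f \<phi>)" using \<phi> .
  have d1: "L2_dist (correlation f (u k)) (correlation f \<phi>) \<le> ?F\<^sup>2 * L2_dist (u k) \<phi>" for k
  proof -
    have "correlation f (u k) t - correlation f \<phi> t = correlation f (\<lambda>x. u k x - \<phi> x) t" for t
      unfolding correlation_def
      by (subst Bochner_Integration.integral_diff[symmetric])
        (auto intro!: integrable_mult_square_integrable square_integrable_shift_cnj f u \<phi> simp: right_diff_distrib)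
    then show ?thesis using correlation_L2_le[of f "\<lambda>x. u k x - \<phi> x"] by simp
  qed
  define C where "C = (LINT x|lborel. norm (f x))"
  have C: "norm (fourier f \<xi>) \<le> C" for \<xi> unfolding C_def by (rule norm_fourier_le)
  have C0: "C \<ge> 0" by (simp add: C_def)
  have Cle: "(\<integral>\<^sup>+\<xi>. ennreal ((norm (fourier f \<xi> * h \<xi>))\<^sup>2) \<partial>lborel) \<le> ennreal (C\<^sup>2) * (\<integral>\<^sup>+\<xi>. ennreal ((norm (h \<xi>))\<^sup>2) \<partial>lborel)"
    if [measurable]: "h \<in> borel_measurable borel" for h :: "'a \<Rightarrow> complex"
  proof (subst nn_integral_cmult[symmetric], measurable, rule nn_integral_mono)
    fix \<xi>
    have "(norm (fourier f \<xi>))\<^sup>2 * (norm (h \<xi>))\<^sup>2 \<le> C\<^sup>2 * (norm (h \<xi>))\<^sup>2"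
      by (intro mult_right_mono power_mono C) simp_all
    then show "ennreal ((norm (fourier f \<xi> * h \<xi>))\<^sup>2) \<le> ennreal (C\<^sup>2) * ennreal ((norm (h \<xi>))\<^sup>2)"
      by (simp add: norm_mult power_mult_distrib ennreal_mult[symmetric] ennreal_leI)
  qed
  have d2: "L2_dist (fourier (correlation f (u k))) (\<lambda>\<xi>. fourier f \<xi> * cnj (\<Phi> \<xi>)) \<le> ennreal (C\<^sup>2) * L2_dist (fourier (u k)) \<Phi>" for k
  proof -
    have "fourier (correlation f (u k)) \<xi> - fourier f \<xi> * cnj (\<Phi> \<xi>) = fourier f \<xi> * cnj (fourier (u k) \<xi> - \<Phi> \<xi>)" for \<xi>
      unfolding fourier_correlation[OF f(1) u(1)] by (simp add: right_diff_distrib)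
    then show ?thesis using Cle[of "\<lambda>\<xi>. cnj (fourier (u k) \<xi> - \<Phi> \<xi>)"]
      by (simp only: complex_mod_cnj) simp
  qed
  have "(\<integral>\<^sup>+\<xi>. ennreal ((norm (\<Phi> \<xi>))\<^sup>2) \<partial>lborel) < \<infinity>"
    using \<Phi> by (simp add: is_fourier_L2_def square_integrable_iff)
  then have "square_integrable (\<lambda>\<xi>. fourier f \<xi> * cnj (\<Phi> \<xi>))"
    using Cle[of "\<lambda>\<xi>. cnj (\<Phi> \<xi>)"]
    by (auto simp: square_integrable_iff ennreal_mult_less_top intro: le_less_trans)
  moreover have "(\<lambda>k. L2_dist (correlation f (u k)) (correlation f \<phi>)) \<longlonglongrightarrow> 0"
  proof (rule tendsto_sandwich[OF _ _ tendsto_const])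
    show "(\<lambda>k. ?F\<^sup>2 * L2_dist (u k) \<phi>) \<longlonglongrightarrow> 0"
      using ennreal_tendsto_cmult[OF F2 lim(1)] by simp
  qed (use d1 in auto)
  moreover have "(\<lambda>k. L2_dist (fourier (correlation f (u k))) (\<lambda>\<xi>. fourier f \<xi> * cnj (\<Phi> \<xi>))) \<longlonglongrightarrow> 0"
  proof (rule tendsto_sandwich[OF _ _ tendsto_const])
    show "(\<lambda>k. ennreal (C\<^sup>2) * L2_dist (fourier (u k)) \<Phi>) \<longlonglongrightarrow> 0"
      using ennreal_tendsto_cmult[OF _ lim(2), of "ennreal (C\<^sup>2)"] by simp
  qed (use d2 in auto)
  ultimately show "is_fourier_L2 (correlation f \<phi>) (\<lambda>\<xi>. fourier f \<xi> * cnj (\<Phi> \<xi>))"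
    unfolding is_fourier_L2_def using integrable_correlation[OF f(1) u(1)] sq[OF u(2)]
    by (intro conjI exI[of _ "\<lambda>k. correlation f (u k)"] allI)
qed

section \<open>The action of the shearlet matrices\<close>

text \<open>Coordinates adapted to the 1 + (n-1) block form of the shear and dilation
  matrices.\<close>

definition vec_cons :: "real \<Rightarrow> real ^ 'm::finite \<Rightarrow> real ^ ('m option)" where
  "vec_cons a b = (\<chi> i. case i of None \<Rightarrow> a | Some j \<Rightarrow> b $ j)"

lemma vec_cons_nth [simp]: "vec_cons a b $ None = a" "vec_cons a b $ Some j = b $ j"
  by (simp_all add: vec_cons_def)

lemma vec_cons_eta: "vec_cons (z $ None) (\<chi> j. z $ Some j) = z"
  by (simp add: vec_eq_iff vec_cons_def split: option.split)

lemma vec_cons_measurable [measurable]: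
  "(\<lambda>(a, b). vec_cons a b) \<in> borel \<Otimes>\<^sub>M borel \<rightarrow>\<^sub>M (borel :: (real ^ ('m::finite option)) measure)"
proof -
  have "continuous_on UNIV (\<lambda>p::real \<times> (real ^ 'm). vec_cons (fst p) (snd p))"
    unfolding vec_cons_def
  proof (rule continuous_on_vec_lambda)
    fix i :: "'m option"
    show "continuous_on UNIV (\<lambda>p::real \<times> (real ^ 'm). case i of None \<Rightarrow> fst p | Some j \<Rightarrow> snd p $ j)"
      by (cases i) (auto intro!: continuous_intros)
  qed
  then show ?thesis
    unfolding case_prod_beta borel_prod by (rule borel_measurable_continuous_onI)
qed

lemma sum_UNIV_option:
  fixes f :: "'m::finite option \<Rightarrow> 'b::comm_monoid_add"
  shows "(\<Sum>i\<in>UNIV. f i) = f None + (\<Sum>j\<in>UNIV. f (Some j))"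
  by (simp add: UNIV_option_conv sum.insert sum.reindex)

lemma prod_UNIV_option:
  fixes f :: "'m::finite option \<Rightarrow> 'b::comm_monoid_mult"
  shows "(\<Prod>i\<in>UNIV. f i) = f None * (\<Prod>j\<in>UNIV. f (Some j))"
  by (simp add: UNIV_option_conv prod.insert prod.reindex)

lemma prod_Basis_cart:
  fixes v :: "real ^ 'n::finite"
  shows "(\<Prod>b\<in>Basis. v \<bullet> b) = (\<Prod>i\<in>UNIV. v $ i)"
proof -
  have B: "(Basis :: (real ^ 'n) set) = (\<lambda>i. axis i 1) ` UNIV"
    by (auto simp: Basis_vec_def)
  show ?thesis
    unfolding B by (subst prod.reindex) (auto simp: inj_on_def axis_eq_axis inner_axis)
qed

text \<open>Lebesgue measure is determined by its values on open boxes, and a box pulls back along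
  \<open>vec_cons\<close> to an interval times a box.\<close>

lemma lborel_vec_cons:
  "(lborel :: (real ^ ('m::finite option)) measure) = distr (lborel \<Otimes>\<^sub>M lborel) borel (\<lambda>(a, b). vec_cons a b)"
proof (rule lborel_eqI)
  fix l u :: "real ^ ('m option)"
  assume lu: "\<And>b. b \<in> Basis \<Longrightarrow> l \<bullet> b \<le> u \<bullet> b"
  have le: "l $ i \<le> u $ i" for i
    using lu[of "axis i 1"] by (simp add: inner_axis axis_in_Basis_iff)
  let ?l = "\<chi> j. l $ Some j" and ?u = "\<chi> j. u $ Some j"
  have m: "(\<lambda>(a, b). vec_cons a b) \<in> lborel \<Otimes>\<^sub>M lborel \<rightarrow>\<^sub>M (borel :: (real ^ ('m option)) measure)"
    using vec_cons_measurable by (simp cong: measurable_cong_sets)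
  have "emeasure (distr (lborel \<Otimes>\<^sub>M lborel) borel (\<lambda>(a, b). vec_cons a b)) (box l u)
    = emeasure (lborel \<Otimes>\<^sub>M lborel) ((\<lambda>(a, b). vec_cons a b) -` box l u \<inter> space (lborel \<Otimes>\<^sub>M lborel))"
    by (rule emeasure_distr[OF m]) simp
  also have "(\<lambda>(a, b). vec_cons a b) -` box l u \<inter> space (lborel \<Otimes>\<^sub>M lborel) = {l $ None <..< u $ None} \<times> box ?l ?u"
    by (auto simp: space_pair_measure mem_box_cart split_option_all)
  also have "emeasure (lborel \<Otimes>\<^sub>M lborel) ({l $ None <..< u $ None} \<times> box ?l ?u)
     = emeasure lborel {l $ None <..< u $ None} * emeasure lborel (box ?l ?u)"
    by (rule lborel.emeasure_pair_measure_Times) simp_all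
  also have "emeasure lborel {l $ None <..< u $ None} = ennreal (u $ None - l $ None)"
    by (rule emeasure_lborel_Ioo[OF le])
  also have "emeasure lborel (box ?l ?u) = ennreal (\<Prod>j\<in>UNIV. u $ Some j - l $ Some j)"
  proof -
    have "?l \<bullet> b \<le> ?u \<bullet> b" if "b \<in> Basis" for b :: "real ^ 'm"
      using that le by (auto simp: Basis_vec_def inner_axis)
    then have "emeasure lborel (box ?l ?u) = ennreal (\<Prod>b\<in>Basis. (?u - ?l) \<bullet> b)" by (rule emeasure_lborel_box)
    then show ?thesis unfolding prod_Basis_cart by simp
  qed
  also have "ennreal (u $ None - l $ None) * ennreal (\<Prod>j\<in>UNIV. u $ Some j - l $ Some j)
    = ennreal (\<Prod>b\<in>Basis. (u - l) \<bullet> b)"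
    unfolding prod_Basis_cart prod_UNIV_option using le by (simp add: ennreal_mult'' prod_nonneg)
  finally show "emeasure (distr (lborel \<Otimes>\<^sub>M lborel) borel (\<lambda>(a, b). vec_cons a b)) (box l u) = ennreal (\<Prod>b\<in>Basis. (u - l) \<bullet> b)" .
qed simp

lemma nn_integral_vec_cons:
  fixes f :: "real ^ ('m::finite option) \<Rightarrow> ennreal"
  assumes [measurable]: "f \<in> borel_measurable borel"
  shows "(\<integral>\<^sup>+x. f x \<partial>lborel) = (\<integral>\<^sup>+a. \<integral>\<^sup>+b. f (vec_cons a b) \<partial>lborel \<partial>lborel)"
proof -
  have m: "(\<lambda>(a, b). vec_cons a b) \<in> lborel \<Otimes>\<^sub>M lborel \<rightarrow>\<^sub>M (borel :: (real ^ ('m option)) measure)"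
    using vec_cons_measurable by (simp cong: measurable_cong_sets)
  have "(\<integral>\<^sup>+x. f x \<partial>lborel) = (\<integral>\<^sup>+p. f (case p of (a, b) \<Rightarrow> vec_cons a b) \<partial>(lborel \<Otimes>\<^sub>M lborel))"
    by (subst lborel_vec_cons, subst nn_integral_distr[OF m]) simp_all
  also have "\<dots> = (\<integral>\<^sup>+a. \<integral>\<^sup>+b. f (vec_cons a b) \<partial>lborel \<partial>lborel)"
    by (subst lborel.nn_integral_fst[symmetric]) simp_all
  finally show ?thesis .
qed

text \<open>The lower diagonal entry of A_a. The \<open>itself\<close> argument supplies the
  dimension, which the number \<open>a\<close> does not determine. The signed root is multiplicative
  in \<open>a\<close>, which yields the inverse matrix directly.\<close>

definition dilation_factor :: "'m::finite itself \<Rightarrow> real \<Rightarrow> real" where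
  "dilation_factor _ a = sgn a * \<bar>a\<bar> powr (1 / real CARD('m option))"

section \<open>Shears and dilations in block coordinates\<close>

lemma dilation_matrix_nth:
  "(dilation_matrix a :: real ^ ('m::finite option) ^ ('m option)) $ i $ j =
    (if i = j then if i = None then a else dilation_factor TYPE('m) a else 0)"
  by (simp add: dilation_matrix_def dilation_factor_def)

lemma shear_matrix_nth:
  "shear_matrix (s :: real ^ 'm::finite) $ i $ j = (if i = j then 1 else if i = None then vec_cons 0 s $ j else 0)"
  by (cases i; cases j) (simp_all add: shear_matrix_def)

lemma dilation_vec_cons:
  "dilation_matrix a *v vec_cons x y = vec_cons (a * x) (dilation_factor TYPE('m) a *\<^sub>R (y :: real ^ 'm::finite))"
proof (rule vec_eq_iff[THEN iffD2], rule allI)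
  fix i :: "'m option"
  show "(dilation_matrix a *v vec_cons x y) $ i = vec_cons (a * x) (dilation_factor TYPE('m) a *\<^sub>R y) $ i"
    by (cases i) (simp_all add: matrix_vector_mult_def dilation_matrix_nth sum_UNIV_option if_distrib[where f = "\<lambda>c. c * _"] cong: if_cong)
qed

lemma shear_vec_cons:
  "shear_matrix s *v vec_cons x y = vec_cons (x + s \<bullet> y) (y :: real ^ 'm::finite)"
proof (rule vec_eq_iff[THEN iffD2], rule allI)
  fix i :: "'m option"
  show "(shear_matrix s *v vec_cons x y) $ i = vec_cons (x + s \<bullet> y) y $ i"
    by (cases i) (simp_all add: matrix_vector_mult_def shear_matrix_nth sum_UNIV_option inner_vec_def if_distrib[where f = "\<lambda>c. c * _"] cong: if_cong)
qed

lemma transpose_shear_vec_cons: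
  "transpose (shear_matrix s) *v vec_cons x y = vec_cons x (y + x *\<^sub>R (s :: real ^ 'm::finite))"
proof (rule vec_eq_iff[THEN iffD2], rule allI)
  fix i :: "'m option"
  show "(transpose (shear_matrix s) *v vec_cons x y) $ i = vec_cons x (y + x *\<^sub>R s) $ i"
    by (cases i) (simp_all add: matrix_vector_mult_def transpose_def shear_matrix_nth sum_UNIV_option if_distrib[where f = "\<lambda>c. c * _"] cong: if_cong)
qed

lemma transpose_dilation: "transpose (dilation_matrix a) = dilation_matrix a"
  by (simp add: transpose_def dilation_matrix_def vec_eq_iff)

lemma shearlet_vec_cons:
  "shearlet_matrix a s *v vec_cons x y = vec_cons (a * x + dilation_factor TYPE('m) a * (s \<bullet> y)) (dilation_factor TYPE('m) a *\<^sub>R (y :: real ^ 'm::finite))"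
  unfolding shearlet_matrix_def matrix_vector_mul_assoc[symmetric] dilation_vec_cons shear_vec_cons by simp

lemma transpose_shearlet_vec_cons:
  "transpose (shearlet_matrix a s) *v vec_cons x y = vec_cons (a * x) (dilation_factor TYPE('m) a *\<^sub>R (y + x *\<^sub>R (s :: real ^ 'm::finite)))"
  unfolding shearlet_matrix_def matrix_transpose_mul transpose_dilation matrix_vector_mul_assoc[symmetric]
    transpose_shear_vec_cons dilation_vec_cons ..

lemma dilation_factor_mult: "dilation_factor TYPE('m::finite) (a * b) = dilation_factor TYPE('m) a * dilation_factor TYPE('m) b"
  by (simp add: dilation_factor_def sgn_mult abs_mult powr_mult)

lemma dilation_factor_1 [simp]: "dilation_factor TYPE('m::finite) 1 = 1"
  by (simp add: dilation_factor_def)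

lemma dilation_factor_neq_0 [simp]: "a \<noteq> 0 \<Longrightarrow> dilation_factor TYPE('m::finite) a \<noteq> 0"
  by (simp add: dilation_factor_def sgn_if)

lemma dilation_factor_inverse: "a \<noteq> 0 \<Longrightarrow> dilation_factor TYPE('m::finite) (1 / a) = 1 / dilation_factor TYPE('m) a"
  using dilation_factor_mult[of a "1 / a", where 'm = 'm] by (simp add: field_simps)

lemma abs_dilation_factor: "a \<noteq> 0 \<Longrightarrow> \<bar>dilation_factor TYPE('m::finite) a\<bar> = \<bar>a\<bar> powr (1 / real CARD('m option))"
  by (simp add: dilation_factor_def abs_mult)

lemma dilation_factor_measurable [measurable]: "dilation_factor TYPE('m::finite) \<in> borel_measurable borel"
  unfolding dilation_factor_def by measurable

lemma matrix_eq_vec_cons: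
  fixes A B :: "real ^ ('m::finite option) ^ ('m option)"
  assumes "\<And>x y. A *v vec_cons x y = B *v vec_cons x y"
  shows "A = B"
  using assms by (metis matrix_eq vec_cons_eta)

lemma shearlet_matrix_inverse:
  fixes s :: "real ^ 'm::finite"
  assumes "a \<noteq> 0"
  defines "N \<equiv> dilation_matrix (1 / a) ** shear_matrix (- s)"
  shows "N ** shearlet_matrix a s = mat 1" "shearlet_matrix a s ** N = mat 1" "matrix_inv (shearlet_matrix a s) = N"
proof -
  have N: "N *v vec_cons x y = vec_cons ((x - s \<bullet> y) / a) ((1 / dilation_factor TYPE('m) a) *\<^sub>R y)" for x y
    unfolding N_def matrix_vector_mul_assoc[symmetric] shear_vec_cons dilation_vec_cons dilation_factor_inverse[OF assms(1)] by simp
  show 1: "N ** shearlet_matrix a s = mat 1"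
    by (rule matrix_eq_vec_cons, unfold matrix_vector_mul_assoc[symmetric] shearlet_vec_cons N)
      (simp add: assms)
  show 2: "shearlet_matrix a s ** N = mat 1"
    by (rule matrix_eq_vec_cons, unfold matrix_vector_mul_assoc[symmetric] shearlet_vec_cons N)
      (simp add: assms)
  \<comment> \<open>\<open>matrix_inv\<close> is defined by choice; once \<open>N\<close> shows that
    an inverse exists, cancelling on the left identifies the chosen one with
    \<open>N\<close>.\<close>
  have "shearlet_matrix a s ** matrix_inv (shearlet_matrix a s) = mat 1"
    unfolding matrix_inv_def by (rule someI2[of _ N]) (use 1 2 in auto)
  then have "N ** (shearlet_matrix a s ** matrix_inv (shearlet_matrix a s)) = N" by simp
  then show "matrix_inv (shearlet_matrix a s) = N" unfolding matrix_mul_assoc 1 by simp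
qed

lemma det_dilation_matrix:
  "det (dilation_matrix a :: real ^ ('m::finite option) ^ ('m option)) = a * dilation_factor TYPE('m) a ^ CARD('m)"
  by (subst det_diagonal) (simp_all add: dilation_matrix_nth prod_UNIV_option)

text \<open>A shear is the identity with a combination of the lower rows added to the first
  one.\<close>

lemma det_shear_matrix: "det (shear_matrix (s :: real ^ 'm::finite)) = 1"
proof -
  let ?I = "mat 1 :: real ^ ('m option) ^ ('m option)"
  have "vec_cons 0 s = (\<Sum>j\<in>UNIV. s $ j *\<^sub>R row (Some j) ?I)"
  proof (rule vec_eq_iff[THEN iffD2], rule allI)
    fix i :: "'m option"
    show "vec_cons 0 s $ i = (\<Sum>j\<in>UNIV. s $ j *\<^sub>R row (Some j) ?I) $ i"
      by (cases i) (simp_all add: row_def mat_def if_distrib[where f = "\<lambda>c. _ * c"] cong: if_cong)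
  qed
  also have "\<dots> = (\<Sum>j\<in>UNIV. s $ j *s row (Some j) ?I)"
    by (simp add: vec_eq_iff)
  also have "\<dots> \<in> vec.span {row j ?I |j. j \<noteq> None}"
    by (intro vec.span_sum vec.span_scale vec.span_base) auto
  finally have "det (\<chi> k. if k = None then row None ?I + vec_cons 0 s else row k ?I) = det ?I"
    by (rule det_row_span)
  moreover have "(\<chi> k. if k = None then row None ?I + vec_cons 0 s else row k ?I) = shear_matrix s"
    by (auto simp: vec_eq_iff row_def mat_def shear_matrix_def vec_cons_def split: option.split)
  ultimately show ?thesis by simp
qed

lemma abs_det_shearlet_matrix:
  fixes s :: "real ^ 'm::finite"
  shows "\<bar>det (shearlet_matrix a s)\<bar> = \<bar>a\<bar> * \<bar>dilation_factor TYPE('m) a\<bar> ^ CARD('m)"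
  unfolding shearlet_matrix_def det_mul det_shear_matrix det_dilation_matrix by (simp add: abs_mult power_abs)

text \<open>Each map is triangular, so two substitutions suffice. For the matrix itself the first
  coordinate is shifted by an amount depending on \<open>y\<close> and is substituted first; for the
  transpose the tail is shifted by a multiple of \<open>x\<close> and comes first. The matrix acts
  in space, the transpose in frequency.\<close>

lemma nn_integral_shearlet_matrix:
  fixes s :: "real ^ 'm::finite"
  assumes [measurable]: "f \<in> borel_measurable borel" and a: "a \<noteq> 0"
  shows "(\<integral>\<^sup>+x. f x \<partial>lborel) = ennreal \<bar>det (shearlet_matrix a s)\<bar> * (\<integral>\<^sup>+x. f (shearlet_matrix a s *v x) \<partial>lborel)"
    and "(\<integral>\<^sup>+x. f x \<partial>lborel) = ennreal \<bar>det (shearlet_matrix a s)\<bar> * (\<integral>\<^sup>+x. f (transpose (shearlet_matrix a s) *v x) \<partial>lborel)"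
proof -
  have [measurable]: "(\<lambda>x. A *v x) \<in> borel \<rightarrow>\<^sub>M borel" for A :: "real ^ ('m option) ^ ('m option)"
    by (intro borel_measurable_continuous_onI linear_continuous_on matrix_vector_mul_bounded_linear)
  define c where "c = dilation_factor TYPE('m) a"
  have c: "c \<noteq> 0" using a by (simp add: c_def)
  have sa: "(\<integral>\<^sup>+x. g x \<partial>lborel) = ennreal \<bar>a\<bar> * (\<integral>\<^sup>+x. g (t + a * x) \<partial>lborel)" if "g \<in> borel_measurable borel" for g :: "real \<Rightarrow> ennreal" and t
    by (rule nn_integral_real_affine[OF that a])
  have sc: "(\<integral>\<^sup>+y. g y \<partial>lborel) = ennreal (\<bar>c\<bar> ^ CARD('m)) * (\<integral>\<^sup>+y. g (c *\<^sub>R (t + y)) \<partial>lborel)"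
    if [measurable]: "g \<in> borel_measurable borel" for g :: "real ^ 'm \<Rightarrow> ennreal" and t
    using nn_integral_lborel_affine[OF that c, of t] c by (simp add: mult.assoc[symmetric] ennreal_mult[symmetric])
  have det: "ennreal \<bar>det (shearlet_matrix a s)\<bar> = ennreal \<bar>a\<bar> * ennreal (\<bar>c\<bar> ^ CARD('m))"
    unfolding abs_det_shearlet_matrix c_def by (simp add: ennreal_mult)
  have "(\<integral>\<^sup>+x. f (shearlet_matrix a s *v x) \<partial>lborel) = (\<integral>\<^sup>+x. \<integral>\<^sup>+y. f (vec_cons (c * (s \<bullet> y) + a * x) (c *\<^sub>R y)) \<partial>lborel \<partial>lborel)"
    by (subst nn_integral_vec_cons) (simp_all add: shearlet_vec_cons c_def add.commute)
  also have "\<dots> = (\<integral>\<^sup>+y. \<integral>\<^sup>+x. f (vec_cons (c * (s \<bullet> y) + a * x) (c *\<^sub>R y)) \<partial>lborel \<partial>lborel)"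
    by (rule lborel_pair.Fubini') measurable
  finally have "ennreal \<bar>a\<bar> * (\<integral>\<^sup>+x. f (shearlet_matrix a s *v x) \<partial>lborel)
     = (\<integral>\<^sup>+y. ennreal \<bar>a\<bar> * (\<integral>\<^sup>+x. f (vec_cons (c * (s \<bullet> y) + a * x) (c *\<^sub>R y)) \<partial>lborel) \<partial>lborel)"
    by (simp add: nn_integral_cmult)
  also have "\<dots> = (\<integral>\<^sup>+y. \<integral>\<^sup>+x. f (vec_cons x (c *\<^sub>R y)) \<partial>lborel \<partial>lborel)"
    by (intro nn_integral_cong sa[symmetric]) measurable
  finally have X: "ennreal \<bar>a\<bar> * (\<integral>\<^sup>+x. f (shearlet_matrix a s *v x) \<partial>lborel) = (\<integral>\<^sup>+y. \<integral>\<^sup>+x. f (vec_cons x (c *\<^sub>R y)) \<partial>lborel \<partial>lborel)" .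
  have "ennreal \<bar>det (shearlet_matrix a s)\<bar> * (\<integral>\<^sup>+x. f (shearlet_matrix a s *v x) \<partial>lborel)
     = ennreal (\<bar>c\<bar> ^ CARD('m)) * (\<integral>\<^sup>+y. \<integral>\<^sup>+x. f (vec_cons x (c *\<^sub>R y)) \<partial>lborel \<partial>lborel)"
    unfolding det X[symmetric] by (simp only: ac_simps)
  also have "\<dots> = (\<integral>\<^sup>+y. \<integral>\<^sup>+x. f (vec_cons x y) \<partial>lborel \<partial>lborel)"
    using sc[of "\<lambda>y. \<integral>\<^sup>+x. f (vec_cons x y) \<partial>lborel" 0] by simp
  also have "\<dots> = (\<integral>\<^sup>+x. \<integral>\<^sup>+y. f (vec_cons x y) \<partial>lborel \<partial>lborel)"
    by (rule lborel_pair.Fubini') measurable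
  also have "\<dots> = (\<integral>\<^sup>+x. f x \<partial>lborel)" by (rule nn_integral_vec_cons[symmetric]) measurable
  finally show "(\<integral>\<^sup>+x. f x \<partial>lborel) = ennreal \<bar>det (shearlet_matrix a s)\<bar> * (\<integral>\<^sup>+x. f (shearlet_matrix a s *v x) \<partial>lborel)" by (rule sym)
  have "(\<integral>\<^sup>+x. f (transpose (shearlet_matrix a s) *v x) \<partial>lborel) = (\<integral>\<^sup>+x. \<integral>\<^sup>+y. f (vec_cons (a * x) (c *\<^sub>R (x *\<^sub>R s + y))) \<partial>lborel \<partial>lborel)"
    by (subst nn_integral_vec_cons) (simp_all add: transpose_shearlet_vec_cons c_def add.commute del: transpose_matrix_vector)
  then have "ennreal (\<bar>c\<bar> ^ CARD('m)) * (\<integral>\<^sup>+x. f (transpose (shearlet_matrix a s) *v x) \<partial>lborel)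
     = (\<integral>\<^sup>+x. ennreal (\<bar>c\<bar> ^ CARD('m)) * (\<integral>\<^sup>+y. f (vec_cons (a * x) (c *\<^sub>R (x *\<^sub>R s + y))) \<partial>lborel) \<partial>lborel)"
    by (simp add: nn_integral_cmult del: transpose_matrix_vector)
  also have "\<dots> = (\<integral>\<^sup>+x. \<integral>\<^sup>+y. f (vec_cons (a * x) y) \<partial>lborel \<partial>lborel)"
    by (intro nn_integral_cong sc[symmetric]) measurable
  finally have Y: "ennreal (\<bar>c\<bar> ^ CARD('m)) * (\<integral>\<^sup>+x. f (transpose (shearlet_matrix a s) *v x) \<partial>lborel)
     = (\<integral>\<^sup>+x. \<integral>\<^sup>+y. f (vec_cons (a * x) y) \<partial>lborel \<partial>lborel)" .
  have "ennreal \<bar>det (shearlet_matrix a s)\<bar> * (\<integral>\<^sup>+x. f (transpose (shearlet_matrix a s) *v x) \<partial>lborel)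
     = ennreal \<bar>a\<bar> * (\<integral>\<^sup>+x. \<integral>\<^sup>+y. f (vec_cons (a * x) y) \<partial>lborel \<partial>lborel)"
    unfolding det Y[symmetric] by (simp only: ac_simps)
  also have "\<dots> = (\<integral>\<^sup>+x. \<integral>\<^sup>+y. f (vec_cons x y) \<partial>lborel \<partial>lborel)"
    using sa[of "\<lambda>x. \<integral>\<^sup>+y. f (vec_cons x y) \<partial>lborel" 0] by simp
  also have "\<dots> = (\<integral>\<^sup>+x. f x \<partial>lborel)" by (rule nn_integral_vec_cons[symmetric]) measurable
  finally show "(\<integral>\<^sup>+x. f x \<partial>lborel) = ennreal \<bar>det (shearlet_matrix a s)\<bar> * (\<integral>\<^sup>+x. f (transpose (shearlet_matrix a s) *v x) \<partial>lborel)" by (rule sym)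
qed

lemma matrix_vector_mult_measurable [measurable (raw)]:
  fixes A :: "real ^ 'n::finite ^ 'k::finite"
  assumes [measurable]: "f \<in> borel_measurable M"
  shows "(\<lambda>x. A *v f x) \<in> borel_measurable M"
proof -
  have "(\<lambda>x. A *v x) \<in> borel_measurable borel"
    by (intro borel_measurable_continuous_onI linear_continuous_on matrix_vector_mul_bounded_linear)
  then show ?thesis by (rule measurable_compose[OF assms])
qed

text \<open>The dilation rule for integrable functions extends to related pairs because f(x)
  \<mapsto> k f(N x) and its counterpart in frequency multiply squared L2 distances by the same
  number |k|^2 \<delta>. The matrix enters only through its two change of variables
  formulas.\<close>

lemma is_fourier_L2_matrix:
  fixes M N :: "real ^ 'n::finite ^ 'n" and f g :: "real ^ 'n \<Rightarrow> complex"
  assumes M: "\<And>h. h \<in> borel_measurable borel \<Longrightarrow> (\<integral>\<^sup>+x. h x \<partial>lborel) = ennreal \<delta> * (\<integral>\<^sup>+x. h (M *v x) \<partial>lborel)"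
    and T: "\<And>h. h \<in> borel_measurable borel \<Longrightarrow> (\<integral>\<^sup>+x. h x \<partial>lborel) = ennreal \<delta> * (\<integral>\<^sup>+x. h (transpose M *v x) \<partial>lborel)"
    and NM: "N ** M = mat 1" and \<delta>: "\<delta> > 0"
    and f: "square_integrable f" and fg: "is_fourier_L2 f g"
  shows "is_fourier_L2 (\<lambda>x. k * f (N *v x)) (\<lambda>\<xi>. k * of_real \<delta> * g (transpose M *v \<xi>))"
    and "square_integrable (\<lambda>x. k * f (N *v x))"
proof -
  have [measurable]: "f \<in> borel_measurable borel" "g \<in> borel_measurable borel"
    using f fg by (auto simp: is_fourier_L2_def square_integrable_def)
  have cancel: "N *v (M *v x) = x" for x by (simp add: matrix_vector_mul_assoc NM)
  have nnN: "(\<integral>\<^sup>+x. h (N *v x) \<partial>lborel) = ennreal \<delta> * (\<integral>\<^sup>+x. h x \<partial>lborel)"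
    if [measurable]: "h \<in> borel_measurable borel" for h
    by (subst M) (simp_all add: cancel)
  have nnT: "(\<integral>\<^sup>+x. h (transpose M *v x) \<partial>lborel) = ennreal (1 / \<delta>) * (\<integral>\<^sup>+x. h x \<partial>lborel)"
    if "h \<in> borel_measurable borel" for h
    unfolding T[OF that] using \<delta> by (simp add: mult.assoc[symmetric] ennreal_mult[symmetric] del: transpose_matrix_vector)
  have sqN: "(\<integral>\<^sup>+x. ennreal ((norm (k * h (N *v x)))\<^sup>2) \<partial>lborel) = ennreal ((norm k)\<^sup>2 * \<delta>) * (\<integral>\<^sup>+x. ennreal ((norm (h x))\<^sup>2) \<partial>lborel)"
    if [measurable]: "h \<in> borel_measurable borel" for h :: "real ^ 'n \<Rightarrow> complex"
  proof -
    have "(\<integral>\<^sup>+x. ennreal ((norm (k * h (N *v x)))\<^sup>2) \<partial>lborel) = ennreal ((norm k)\<^sup>2) * (\<integral>\<^sup>+x. ennreal ((norm (h (N *v x)))\<^sup>2) \<partial>lborel)"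
      by (subst nn_integral_cmult[symmetric]) (simp_all add: norm_mult power_mult_distrib ennreal_mult)
    then show ?thesis
      using nnN[of "\<lambda>x. ennreal ((norm (h x))\<^sup>2)"] \<delta> by (simp add: ennreal_mult mult.assoc)
  qed
  have sqT: "(\<integral>\<^sup>+x. ennreal ((norm (k * of_real \<delta> * h (transpose M *v x)))\<^sup>2) \<partial>lborel)
      = ennreal ((norm k)\<^sup>2 * \<delta>) * (\<integral>\<^sup>+x. ennreal ((norm (h x))\<^sup>2) \<partial>lborel)"
    if [measurable]: "h \<in> borel_measurable borel" for h :: "real ^ 'n \<Rightarrow> complex"
  proof -
    have "(\<integral>\<^sup>+x. ennreal ((norm (k * of_real \<delta> * h (transpose M *v x)))\<^sup>2) \<partial>lborel)
       = ennreal ((norm k)\<^sup>2 * \<delta>\<^sup>2) * (\<integral>\<^sup>+x. ennreal ((norm (h (transpose M *v x)))\<^sup>2) \<partial>lborel)"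
      by (subst nn_integral_cmult[symmetric]) (simp_all add: norm_mult power_mult_distrib ennreal_mult del: transpose_matrix_vector)
    also have "\<dots> = ennreal ((norm k)\<^sup>2 * \<delta>\<^sup>2) * (ennreal (1 / \<delta>) * (\<integral>\<^sup>+x. ennreal ((norm (h x))\<^sup>2) \<partial>lborel))"
      by (subst nnT[of "\<lambda>x. ennreal ((norm (h x))\<^sup>2)"]) simp_all
    also have "\<dots> = ennreal ((norm k)\<^sup>2 * \<delta>\<^sup>2 * (1 / \<delta>)) * (\<integral>\<^sup>+x. ennreal ((norm (h x))\<^sup>2) \<partial>lborel)"
      unfolding mult.assoc[symmetric] using \<delta> by (subst ennreal_mult[symmetric]) simp_all
    also have "(norm k)\<^sup>2 * \<delta>\<^sup>2 * (1 / \<delta>) = (norm k)\<^sup>2 * \<delta>" using \<delta> by (simp add: power2_eq_square)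
    finally show ?thesis .
  qed
  have si: "square_integrable (\<lambda>x. k * h (N *v x))" if h: "square_integrable h" for h
  proof -
    have [measurable]: "h \<in> borel_measurable borel" using h by (simp add: square_integrable_def)
    show ?thesis unfolding square_integrable_iff sqN[OF \<open>h \<in> borel_measurable borel\<close>]
      using h by (auto simp: square_integrable_iff ennreal_mult_less_top)
  qed
  then show "square_integrable (\<lambda>x. k * f (N *v x))" using f .
  have int: "integrable lborel (\<lambda>x. k * h (N *v x))" if h: "integrable lborel h" for h
  proof -
    have [measurable]: "h \<in> borel_measurable borel" using h by auto
    have "integrable lborel (\<lambda>x. h (N *v x))"
      using h nnN[of "\<lambda>x. ennreal (norm (h x))"] by (auto simp: integrable_iff_bounded ennreal_mult_less_top)
    then show ?thesis by simp
  qed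
  have mM: "(\<lambda>x. M *v x) \<in> lborel \<rightarrow>\<^sub>M borel" by simp
  \<comment> \<open>The hypothesis \<open>M\<close> concerns nonnegative integrands; restated as an
    equality of measures it also transforms complex Fourier integrals.\<close>
  have lb: "lborel = density (distr lborel borel (\<lambda>x. M *v x)) (\<lambda>_. ennreal \<delta>)"
  proof (rule measure_eqI)
    fix A :: "(real ^ 'n) set" assume "A \<in> sets lborel"
    then have [measurable]: "A \<in> sets borel" by simp
    have "emeasure lborel A = (\<integral>\<^sup>+x. indicator A x \<partial>lborel)" by simp
    also have "\<dots> = ennreal \<delta> * (\<integral>\<^sup>+x. indicator A (M *v x) \<partial>lborel)" by (rule M) simp
    also have "\<dots> = emeasure (density (distr lborel borel (\<lambda>x. M *v x)) (\<lambda>_. ennreal \<delta>)) A"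
      by (subst emeasure_density) (simp_all add: nn_integral_cmult nn_integral_distr del: nn_integral_indicator)
    finally show "emeasure lborel A = emeasure (density (distr lborel borel (\<lambda>x. M *v x)) (\<lambda>_. ennreal \<delta>)) A" .
  qed simp
  have fh: "fourier (\<lambda>x. k * h (N *v x)) \<xi> = k * of_real \<delta> * fourier h (transpose M *v \<xi>)"
    if [measurable]: "h \<in> borel_measurable borel" for h \<xi>
  proof -
    have "fourier (\<lambda>x. k * h (N *v x)) \<xi> = (LINT x|density (distr lborel borel (\<lambda>x. M *v x)) (\<lambda>_. ennreal \<delta>). k * h (N *v x) * fchar \<xi> x)"
      unfolding fourier_def using lb by metis
    also have "\<dots> = (LINT x|distr lborel borel (\<lambda>x. M *v x). \<delta> *\<^sub>R (k * h (N *v x) * fchar \<xi> x))"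
      using \<delta> by (subst integral_density) simp_all
    also have "\<dots> = (LINT x|lborel. \<delta> *\<^sub>R (k * h x * fchar \<xi> (M *v x)))"
      by (subst integral_distr[OF mM]) (simp_all add: cancel)
    also have "\<dots> = (LINT x|lborel. (k * of_real \<delta>) * (h x * fchar (transpose M *v \<xi>) x))"
      by (simp add: dot_lmul_matrix scaleR_conv_of_real ac_simps)
    finally show ?thesis unfolding fourier_def by (simp only: integral_mult_right_zero)
  qed
  obtain u where u: "\<And>k. integrable lborel (u k)" "\<And>k. square_integrable (u k)"
    and lim: "(\<lambda>k. L2_dist (u k) f) \<longlonglongrightarrow> 0" "(\<lambda>k. L2_dist (fourier (u k)) g) \<longlonglongrightarrow> 0"
    using fg unfolding is_fourier_L2_def by blast
  have [measurable]: "u k \<in> borel_measurable borel" for k using u(1)[of k] by auto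
  have d1: "L2_dist (\<lambda>x. k * u j (N *v x)) (\<lambda>x. k * f (N *v x)) = ennreal ((norm k)\<^sup>2 * \<delta>) * L2_dist (u j) f" for j
    unfolding right_diff_distrib[symmetric] by (rule sqN[of "\<lambda>x. u j x - f x"]) measurable
  have d2: "L2_dist (fourier (\<lambda>x. k * u j (N *v x))) (\<lambda>\<xi>. k * of_real \<delta> * g (transpose M *v \<xi>))
     = ennreal ((norm k)\<^sup>2 * \<delta>) * L2_dist (fourier (u j)) g" for j
    unfolding fh[OF \<open>u j \<in> borel_measurable borel\<close>] right_diff_distrib[symmetric]
    by (rule sqT[of "\<lambda>x. fourier (u j) x - g x"]) measurable
  have "square_integrable g" using fg by (simp add: is_fourier_L2_def)
  then have "square_integrable (\<lambda>\<xi>. k * of_real \<delta> * g (transpose M *v \<xi>))"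
    unfolding square_integrable_iff sqT[OF \<open>g \<in> borel_measurable borel\<close>]
    by (auto simp: ennreal_mult_less_top simp del: transpose_matrix_vector)
  moreover have "(\<lambda>j. L2_dist (\<lambda>x. k * u j (N *v x)) (\<lambda>x. k * f (N *v x))) \<longlonglongrightarrow> 0"
    unfolding d1 using ennreal_tendsto_cmult[OF _ lim(1), of "ennreal ((norm k)\<^sup>2 * \<delta>)"] by simp
  moreover have "(\<lambda>j. L2_dist (fourier (\<lambda>x. k * u j (N *v x))) (\<lambda>\<xi>. k * of_real \<delta> * g (transpose M *v \<xi>))) \<longlonglongrightarrow> 0"
    unfolding d2 using ennreal_tendsto_cmult[OF _ lim(2), of "ennreal ((norm k)\<^sup>2 * \<delta>)"] by simp
  ultimately show "is_fourier_L2 (\<lambda>x. k * f (N *v x)) (\<lambda>\<xi>. k * of_real \<delta> * g (transpose M *v \<xi>))"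
    unfolding is_fourier_L2_def using int[OF u(1)] si[OF u(2)]
    by (intro conjI exI[of _ "\<lambda>j x. k * u j (N *v x)"] allI)
qed

text \<open>Writing the negative power as a Gamma integral of Gaussians makes the \<open>x\<close>
  integral t^(-n/2); what remains is the convergent integral \<Gamma>(n/2). The result serves as an
  integrable majorant for Schwartz functions.\<close>

lemma nn_integral_japanese_bracket_finite:
  "(\<integral>\<^sup>+x. ennreal ((1 + pi * (norm x)\<^sup>2) powr - real DIM('a)) \<partial>(lborel :: 'a::euclidean_space measure)) < \<infinity>"
proof -
  define n where "n = real DIM('a)"
  have n: "n > 0" by (simp add: n_def)
  have G: "Gamma n > 0" using n by (rule Gamma_real_pos)
  have "ennreal (Gamma n) * (\<integral>\<^sup>+x. ennreal ((1 + pi * (norm x)\<^sup>2) powr - n) \<partial>(lborel :: 'a measure))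
    = (\<integral>\<^sup>+x. ennreal (Gamma n * (1 + pi * (norm x)\<^sup>2) powr - n) \<partial>(lborel :: 'a measure))"
    using G by (subst nn_integral_cmult[symmetric]) (simp_all add: ennreal_mult)
  also have "\<dots> = (\<integral>\<^sup>+x. \<integral>\<^sup>+t. ennreal (indicator {0<..} t * (t powr (n - 1) * exp (- (1 + pi * (norm x)\<^sup>2) * t))) \<partial>lborel \<partial>(lborel :: 'a measure))"
    by (intro nn_integral_cong nn_integral_powr_exp[symmetric] n) (simp add: add_pos_nonneg)
  also have "\<dots> = (\<integral>\<^sup>+t. \<integral>\<^sup>+x. ennreal (indicator {0<..} t * (t powr (n - 1) * exp (- (1 + pi * (norm x)\<^sup>2) * t))) \<partial>(lborel :: 'a measure) \<partial>lborel)"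
    by (rule lborel_pair.Fubini') measurable
  also have "\<dots> = (\<integral>\<^sup>+t. ennreal (indicator {0<..} t * (t powr (n / 2 - 1) * exp (- 1 * t))) \<partial>lborel)"
  proof (rule nn_integral_cong)
    fix t :: real
    show "(\<integral>\<^sup>+x. ennreal (indicator {0<..} t * (t powr (n - 1) * exp (- (1 + pi * (norm x)\<^sup>2) * t))) \<partial>(lborel :: 'a measure))
      = ennreal (indicator {0<..} t * (t powr (n / 2 - 1) * exp (- 1 * t)))"
    proof (cases "t > 0")
      case True
      have "t powr (n - 1) * exp (- (1 + pi * (norm x)\<^sup>2) * t) = (t powr (n - 1) * exp (- t)) * exp (- pi * t * (norm x)\<^sup>2)" for x :: 'a
        by (simp add: exp_add[symmetric] algebra_simps)
      then have "(\<integral>\<^sup>+x. ennreal (indicator {0<..} t * (t powr (n - 1) * exp (- (1 + pi * (norm x)\<^sup>2) * t))) \<partial>(lborel :: 'a measure))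
        = (\<integral>\<^sup>+x. ennreal (t powr (n - 1) * exp (- t)) * ennreal (exp (- pi * t * (norm x)\<^sup>2)) \<partial>(lborel :: 'a measure))"
        using True by (intro nn_integral_cong) (simp add: ennreal_mult mult.assoc)
      also have "\<dots> = ennreal (t powr (n - 1) * exp (- t)) * ennreal (t powr (- (n / 2)))"
        using nn_integral_gaussian[OF True, where 'a = 'a] by (subst nn_integral_cmult) (simp_all add: n_def)
      also have "\<dots> = ennreal ((t powr (n - 1) * t powr (- (n / 2))) * exp (- t))"
        by (simp add: ennreal_mult[symmetric] ac_simps)
      also have "t powr (n - 1) * t powr (- (n / 2)) = t powr (n / 2 - 1)"
      proof -
        have "n - 1 + - (n / 2) = n / 2 - 1" by simp
        then show ?thesis by (simp only: powr_add[symmetric])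
      qed
      finally show ?thesis using True by simp
    qed simp
  qed
  also have "\<dots> = ennreal (Gamma (n / 2) * 1 powr - (n / 2))"
    using n by (intro nn_integral_powr_exp) simp_all
  finally have "ennreal (Gamma n) * (\<integral>\<^sup>+x. ennreal ((1 + pi * (norm x)\<^sup>2) powr - n) \<partial>(lborel :: 'a measure)) < \<infinity>" by simp
  then show ?thesis using G unfolding n_def by (auto simp: ennreal_mult_less_top)
qed

text \<open>Only the decay of \<open>f\<close> itself, the empty list of derivatives, enters.
  Expanding (1 + pi |x|^2)^n by the binomial theorem bounds it through the even seminorms
  \<open>C (2 * i)\<close>; square integrability then follows from boundedness.\<close>

lemma schwartz_integrable:
  fixes f :: "'a::euclidean_space \<Rightarrow> complex"
  assumes "schwartz f"
  shows "integrable lborel f" "square_integrable f"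
proof -
  have diff: "f differentiable (at x)" for x
    using assms unfolding schwartz_def by (elim allE[of _ "[]"]) simp
  have "\<exists>C. \<forall>x. norm x ^ k * norm (f x) \<le> C" for k
    using assms unfolding schwartz_def by (elim allE[of _ "[]"]) simp
  then obtain C where C: "\<And>k x. norm x ^ k * norm (f x) \<le> C k" by metis
  have "continuous_on UNIV f"
    using diff by (auto intro!: continuous_at_imp_continuous_on differentiable_imp_continuous_within)
  then have [measurable]: "f \<in> borel_measurable borel" by (rule borel_measurable_continuous_onI)
  define n where "n = DIM('a)"
  define K where "K = (\<Sum>i\<le>n. real (n choose i) * pi ^ i * C (2 * i))"
  have le: "norm (f x) \<le> K * (1 + pi * (norm x)\<^sup>2) powr - real n" for x
  proof -
    have pos: "1 + pi * (norm x)\<^sup>2 > 0" by (simp add: add_pos_nonneg)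
    have "(1 + pi * (norm x)\<^sup>2) ^ n * norm (f x) = (\<Sum>i\<le>n. real (n choose i) * pi ^ i * (norm x ^ (2 * i) * norm (f x)))"
      by (subst add.commute, subst binomial_ring)
        (simp add: sum_distrib_right power_mult_distrib power_mult mult.assoc)
    also have "\<dots> \<le> K" unfolding K_def by (intro sum_mono mult_left_mono C) simp
    finally have "norm (f x) \<le> K / (1 + pi * (norm x)\<^sup>2) ^ n" using pos by (simp add: pos_le_divide_eq mult.commute)
    then show ?thesis using pos by (simp add: powr_minus powr_realpow divide_inverse)
  qed
  have K: "K \<ge> 0"
  proof -
    have "0 \<le> C k" for k using C[where k = k and x = 0] by (rule order_trans[rotated]) simp
    then show ?thesis unfolding K_def by (intro sum_nonneg) simp
  qed
  have "(\<integral>\<^sup>+x. ennreal (norm (f x)) \<partial>lborel) \<le> (\<integral>\<^sup>+x. ennreal K * ennreal ((1 + pi * (norm (x::'a))\<^sup>2) powr - real n) \<partial>lborel)"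
    using le K by (intro nn_integral_mono) (simp add: ennreal_mult[symmetric] ennreal_leI)
  also have "\<dots> = ennreal K * (\<integral>\<^sup>+x. ennreal ((1 + pi * (norm (x::'a))\<^sup>2) powr - real n) \<partial>lborel)"
    by (rule nn_integral_cmult) measurable
  also have "\<dots> < \<infinity>" using nn_integral_japanese_bracket_finite[where 'a = 'a] by (simp add: n_def ennreal_mult_less_top)
  finally show int: "integrable lborel f" by (simp add: integrable_iff_bounded)
  have "integrable lborel (\<lambda>x. (norm (f x))\<^sup>2)"
  proof (rule Bochner_Integration.integrable_bound[of _ "\<lambda>x. C 0 * norm (f x)"])
    show "AE x in lborel. norm ((norm (f x))\<^sup>2) \<le> norm (C 0 * norm (f x))"
    proof (rule AE_I2)
      fix x
      have "norm (f x) \<le> C 0" using C[of x 0] by simp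
      then have "norm (f x) * norm (f x) \<le> \<bar>C 0\<bar> * norm (f x)" by (intro mult_right_mono) auto
      then show "norm ((norm (f x))\<^sup>2) \<le> norm (C 0 * norm (f x))" by (simp add: power2_eq_square abs_mult)
    qed
  qed (use int in simp_all)
  then show "square_integrable f" by (simp add: square_integrable_def)
qed

section \<open>The admissibility integral\<close>

definition vec_tl :: "real ^ ('m::finite option) \<Rightarrow> real ^ 'm" where
  "vec_tl z = (\<chi> j. z $ Some j)"

lemma vec_cons_hd_tl: "vec_cons (z $ None) (vec_tl z) = z"
  by (simp add: vec_tl_def vec_cons_eta)

lemma vec_tl_measurable [measurable]: "vec_tl \<in> borel_measurable borel"
  unfolding vec_tl_def[abs_def]
  by (intro borel_measurable_continuous_onI continuous_on_vec_lambda continuous_intros)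

lemma vec_nth_measurable [measurable (raw)]:
  fixes f :: "'z \<Rightarrow> real ^ 'n::finite"
  assumes [measurable]: "f \<in> borel_measurable M"
  shows "(\<lambda>x. f x $ i) \<in> borel_measurable M"
proof -
  have "(\<lambda>v :: real ^ 'n. v $ i) \<in> borel_measurable borel"
    by (intro borel_measurable_continuous_onI continuous_intros)
  then show ?thesis by (rule measurable_compose[OF assms])
qed

lemma transpose_shearlet_mult:
  fixes z :: "real ^ ('m::finite option)"
  shows "transpose (shearlet_matrix a s) *v z = vec_cons (a * z $ None) (dilation_factor TYPE('m) a *\<^sub>R (vec_tl z + z $ None *\<^sub>R s))"
  using transpose_shearlet_vec_cons[of a s "z $ None" "vec_tl z"] unfolding vec_cons_hd_tl .

lemma transpose_shearlet_measurable [measurable (raw)]: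
  fixes z :: "'z \<Rightarrow> real ^ ('m::finite option)"
  assumes [measurable]: "a \<in> borel_measurable M" "s \<in> borel_measurable M" "z \<in> borel_measurable M"
  shows "(\<lambda>x. transpose (shearlet_matrix (a x) (s x)) *v z x) \<in> borel_measurable M"
  unfolding transpose_shearlet_mult by measurable

definition admissibility_exponent :: "'m::finite itself \<Rightarrow> real" where
  "admissibility_exponent _ = ((real CARD('m option))\<^sup>2 - real CARD('m option) + 1) / real CARD('m option)"

text \<open>In the form (n - 1) + 1/n, where n - 1 is \<open>CARD('m)\<close>, the exponent can be
  compared with the powers coming from the Jacobians.\<close>

lemma admissibility_exponent_eq:
  "admissibility_exponent TYPE('m::finite) = real CARD('m) + 1 / real CARD('m option)"
proof -
  have "((real CARD('m) + 1)\<^sup>2 - (real CARD('m) + 1) + 1) / (real CARD('m) + 1) = real CARD('m) + 1 / (real CARD('m) + 1)"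
    by (simp add: field_simps power2_eq_square)
  then show ?thesis by (simp add: admissibility_exponent_def add.commute)
qed

lemma admissibility_integral_eq:
  fixes \<psi> :: "real ^ ('m::finite option) \<Rightarrow> complex"
  shows "admissibility_integral \<psi> \<xi> = (\<integral>\<^sup>+s. \<integral>\<^sup>+a. ennreal (indicator {a. a \<noteq> 0} a * \<bar>a\<bar> powr - admissibility_exponent TYPE('m)) *
      ennreal ((norm (fourier_L2 \<psi> (transpose (shearlet_matrix a s) *v \<xi>)))\<^sup>2) \<partial>lborel \<partial>lborel)"
  unfolding admissibility_integral_def Let_def admissibility_exponent_def
  by (intro nn_integral_cong)
    (auto simp: indicator_def powr_minus divide_inverse ennreal_mult[symmetric] mult.commute simp del: transpose_matrix_vector)

text \<open>Substituting first in \<open>s\<close> and then in \<open>a\<close> absorbs all the dependence on \<open>\<xi>\<close>: the resulting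
  power of \<open>|\<xi>\<^sub>1|\<close> has exponent zero.\<close>

lemma admissibility_integral_eq_canonical:
  fixes \<psi> :: "real ^ ('m::finite option) \<Rightarrow> complex"
  assumes [measurable]: "fourier_L2 \<psi> \<in> borel_measurable borel" and \<xi>: "\<xi> $ None \<noteq> 0"
  shows "admissibility_integral \<psi> \<xi> =
    (\<integral>\<^sup>+a. ennreal (indicator {a. a \<noteq> 0} a * \<bar>a\<bar> powr - (admissibility_exponent TYPE('m) + real CARD('m) / real CARD('m option))) *
      (\<integral>\<^sup>+v. ennreal ((norm (fourier_L2 \<psi> (vec_cons a v)))\<^sup>2) \<partial>lborel) \<partial>lborel)"
proof -
  define p where "p = admissibility_exponent TYPE('m)"
  define m n where "m = real CARD('m)" and "n = real CARD('m option)"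
  define x where "x = \<xi> $ None"
  have x: "x \<noteq> 0" using \<xi> by (simp add: x_def)
  define H where "H b = (\<integral>\<^sup>+v. ennreal ((norm (fourier_L2 \<psi> (vec_cons b v)))\<^sup>2) \<partial>lborel)" for b
  have [measurable]: "H \<in> borel_measurable borel" unfolding H_def by measurable
  let ?E = "\<lambda>a. ennreal (indicator {a. a \<noteq> 0} a * \<bar>a\<bar> powr - p)"
  have "admissibility_integral \<psi> \<xi> = (\<integral>\<^sup>+a. \<integral>\<^sup>+s. ?E a * ennreal ((norm (fourier_L2 \<psi> (transpose (shearlet_matrix a s) *v \<xi>)))\<^sup>2) \<partial>lborel \<partial>lborel)"
    unfolding admissibility_integral_eq p_def[symmetric] by (rule lborel_pair.Fubini') measurable
  also have "\<dots> = (\<integral>\<^sup>+a. ennreal (indicator {a. a \<noteq> 0} a * (\<bar>a\<bar> powr - p * (1 / \<bar>dilation_factor TYPE('m) a * x\<bar> ^ CARD('m)))) * H (a * x) \<partial>lborel)"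
  proof (rule nn_integral_cong)
    fix a :: real
    show "(\<integral>\<^sup>+s. ?E a * ennreal ((norm (fourier_L2 \<psi> (transpose (shearlet_matrix a s) *v \<xi>)))\<^sup>2) \<partial>lborel)
      = ennreal (indicator {a. a \<noteq> 0} a * (\<bar>a\<bar> powr - p * (1 / \<bar>dilation_factor TYPE('m) a * x\<bar> ^ CARD('m)))) * H (a * x)"
    proof (cases "a = 0")
      case False
      \<comment> \<open>Dividing the tail by x = \<xi>_1, which is nonzero, makes the argument an
        affine function of \<open>s\<close> with scale factor c(a) x, where c is
        \<open>dilation_factor\<close>; its Jacobian is |c(a) x|^(n-1).\<close>
      have "transpose (shearlet_matrix a s) *v \<xi> = vec_cons (a * x) ((dilation_factor TYPE('m) a * x) *\<^sub>R ((1 / x) *\<^sub>R vec_tl \<xi> + s))" for s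
        unfolding transpose_shearlet_mult x_def[symmetric] using x by (simp add: scaleR_add_right)
      then have i: "(\<integral>\<^sup>+s. ennreal ((norm (fourier_L2 \<psi> (transpose (shearlet_matrix a s) *v \<xi>)))\<^sup>2) \<partial>lborel)
        = ennreal (1 / \<bar>dilation_factor TYPE('m) a * x\<bar> ^ CARD('m)) * H (a * x)"
        using nn_integral_lborel_affine[of "\<lambda>v. ennreal ((norm (fourier_L2 \<psi> (vec_cons (a * x) v)))\<^sup>2)" "dilation_factor TYPE('m) a * x" "(1 / x) *\<^sub>R vec_tl \<xi>"] x False
        unfolding H_def by (simp only: DIM_cart DIM_real) simp
      have "(\<integral>\<^sup>+s. ?E a * ennreal ((norm (fourier_L2 \<psi> (transpose (shearlet_matrix a s) *v \<xi>)))\<^sup>2) \<partial>lborel)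
        = ?E a * (\<integral>\<^sup>+s. ennreal ((norm (fourier_L2 \<psi> (transpose (shearlet_matrix a s) *v \<xi>)))\<^sup>2) \<partial>lborel)"
        by (rule nn_integral_cmult) measurable
      also note i
      also have "?E a * (ennreal (1 / \<bar>dilation_factor TYPE('m) a * x\<bar> ^ CARD('m)) * H (a * x))
        = ennreal (indicator {a. a \<noteq> 0} a * (\<bar>a\<bar> powr - p * (1 / \<bar>dilation_factor TYPE('m) a * x\<bar> ^ CARD('m)))) * H (a * x)"
        unfolding mult.assoc[symmetric] by (subst ennreal_mult[symmetric]) simp_all
      finally show ?thesis .
    qed simp
  qed
  \<comment> \<open>The substitution b = a x, after which \<xi> survives only in powers of
    |x|.\<close>
  also have "\<dots> = ennreal \<bar>1 / x\<bar> * (\<integral>\<^sup>+b. ennreal (indicator {a. a \<noteq> 0} (0 + 1 / x * b) * (\<bar>0 + 1 / x * b\<bar> powr - p *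
      (1 / \<bar>dilation_factor TYPE('m) (0 + 1 / x * b) * x\<bar> ^ CARD('m)))) * H ((0 + 1 / x * b) * x) \<partial>lborel)"
    using x by (intro nn_integral_real_affine) simp_all
  also have "\<dots> = (\<integral>\<^sup>+b. ennreal \<bar>1 / x\<bar> * (ennreal (indicator {a. a \<noteq> 0} (0 + 1 / x * b) * (\<bar>0 + 1 / x * b\<bar> powr - p *
      (1 / \<bar>dilation_factor TYPE('m) (0 + 1 / x * b) * x\<bar> ^ CARD('m)))) * H ((0 + 1 / x * b) * x)) \<partial>lborel)"
    by (rule nn_integral_cmult[symmetric]) measurable
  also have "\<dots> = (\<integral>\<^sup>+b. ennreal (indicator {a. a \<noteq> 0} b * \<bar>b\<bar> powr - (p + m / n)) * H b \<partial>lborel)"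
  proof (rule nn_integral_cong)
    fix b :: real
    show "ennreal \<bar>1 / x\<bar> * (ennreal (indicator {a. a \<noteq> 0} (0 + 1 / x * b) * (\<bar>0 + 1 / x * b\<bar> powr - p *
      (1 / \<bar>dilation_factor TYPE('m) (0 + 1 / x * b) * x\<bar> ^ CARD('m)))) * H ((0 + 1 / x * b) * x))
      = ennreal (indicator {a. a \<noteq> 0} b * \<bar>b\<bar> powr - (p + m / n)) * H b"
    proof (cases "b = 0")
      case False
      define X B where "X = \<bar>x\<bar>" and "B = \<bar>b\<bar>"
      have pos: "X > 0" "B > 0" using x False by (simp_all add: X_def B_def)
      have "\<bar>dilation_factor TYPE('m) (0 + 1 / x * b) * x\<bar> = (B / X) powr (1 / n) * X"
        using x False by (simp add: abs_mult abs_dilation_factor X_def B_def n_def)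
      also have "\<dots> = B powr (1 / n) * X powr (1 - 1 / n)"
        using pos by (simp add: powr_divide powr_diff)
      finally have d: "\<bar>dilation_factor TYPE('m) (0 + 1 / x * b) * x\<bar> ^ CARD('m) = B powr (m / n) * X powr ((1 - 1 / n) * m)"
        using pos by (simp add: power_mult_distrib powr_power m_def mult.commute)
      \<comment> \<open>The exponent of |\<xi>_1|: -1 from the substitution in \<open>a\<close>, p
        from the weight |a|^(-p), and -(1 - 1/n)(n - 1) from the one in \<open>s\<close>. It
        vanishes because p = (n - 1) + 1/n.\<close>
      have e: "- 1 + p - (1 - 1 / n) * m = 0"
      proof -
        have "n = m + 1" by (simp add: n_def m_def)
        moreover have "n > 0" by (simp add: n_def)
        ultimately show ?thesis unfolding p_def admissibility_exponent_eq m_def[symmetric] n_def[symmetric]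
          by (simp add: field_simps)
      qed
      have "\<bar>1 / x\<bar> * (\<bar>0 + 1 / x * b\<bar> powr - p * (1 / \<bar>dilation_factor TYPE('m) (0 + 1 / x * b) * x\<bar> ^ CARD('m)))
         = X powr - 1 * ((B powr - p * X powr p) * (B powr - (m / n) * X powr - ((1 - 1 / n) * m)))"
      proof -
        have "\<bar>1 / x\<bar> = X powr - 1" using pos by (simp add: X_def powr_minus divide_inverse)
        moreover have "\<bar>0 + 1 / x * b\<bar> = B / X" by (simp add: X_def B_def abs_mult)
        moreover have "(B / X) powr - p = B powr - p * X powr p"
          using pos by (simp add: powr_divide powr_minus field_simps)
        moreover have "1 / (B powr (m / n) * X powr ((1 - 1 / n) * m)) = B powr - (m / n) * X powr - ((1 - 1 / n) * m)"
          by (simp add: powr_minus divide_inverse)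
        ultimately show ?thesis unfolding d by (simp only:)
      qed
      also have "\<dots> = B powr (- p + - (m / n)) * X powr (- 1 + p - (1 - 1 / n) * m)"
        unfolding powr_add diff_conv_add_uminus by (simp only: ac_simps)
      also have "\<dots> = B powr - (p + m / n)" unfolding e using pos by simp
      finally have k: "\<bar>1 / x\<bar> * (\<bar>0 + 1 / x * b\<bar> powr - p * (1 / \<bar>dilation_factor TYPE('m) (0 + 1 / x * b) * x\<bar> ^ CARD('m))) = B powr - (p + m / n)" .
      have i: "indicator {a. a \<noteq> 0} (0 + 1 / x * b) = (1::real)" "(0 + 1 / x * b) * x = b" "indicator {a. a \<noteq> 0} b = (1::real)"
        using x False by simp_all
      show ?thesis
        unfolding i mult_1_left mult.assoc[symmetric] B_def[symmetric] k[symmetric]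
        by (subst ennreal_mult[symmetric]) (simp_all add: mult.assoc)
    qed simp
  qed
  finally show ?thesis unfolding p_def m_def n_def H_def .
qed

lemma nn_integral_lborel_prod:
  fixes h :: "'a::euclidean_space \<times> 'b::euclidean_space \<Rightarrow> ennreal"
  assumes "h \<in> borel_measurable borel"
  shows "(\<integral>\<^sup>+p. h p \<partial>lborel) = (\<integral>\<^sup>+a. \<integral>\<^sup>+b. h (a, b) \<partial>lborel \<partial>lborel)"
proof -
  have "h \<in> borel_measurable (lborel \<Otimes>\<^sub>M lborel)" using assms by (simp add: lborel_prod)
  then show ?thesis by (subst lborel_prod[symmetric], subst lborel.nn_integral_fst[symmetric]) simp_all
qed

lemma AE_nth_None_neq_0: "AE z in lborel. (z :: real ^ ('m::finite option)) $ None \<noteq> 0"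
proof (rule AE_I)
  let ?N = "{z :: real ^ ('m option). z $ None = 0}"
  have [measurable]: "?N \<in> sets borel" by measurable
  then show "?N \<in> sets lborel" by simp
  have "emeasure lborel ?N = (\<integral>\<^sup>+z. indicator ?N z \<partial>lborel)" by simp
  also have "\<dots> = (\<integral>\<^sup>+a. \<integral>\<^sup>+b. indicator ?N (vec_cons a b) \<partial>lborel \<partial>lborel)"
    by (rule nn_integral_vec_cons) measurable
  also have "\<dots> = (\<integral>\<^sup>+(a::real). 0 \<partial>lborel)"
    by (rule nn_integral_cong_AE, rule eventually_mono[OF AE_lborel_singleton[of 0]]) simp
  finally show "emeasure lborel ?N = 0" by simp
qed auto

section \<open>The shearlet transform\<close>

text \<open>With \<open>CARD('m)\<close> = n - 1 the exponent is 2 - 1/n.\<close>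

lemma abs_det_shearlet_matrix_powr:
  fixes s :: "real ^ 'm::finite"
  assumes "a \<noteq> 0"
  shows "\<bar>det (shearlet_matrix a s)\<bar> = \<bar>a\<bar> powr (1 + real CARD('m) / real CARD('m option))"
  unfolding abs_det_shearlet_matrix abs_dilation_factor[OF assms] using assms
  by (simp add: powr_add powr_power)

definition shearlet_inv :: "real \<Rightarrow> real ^ 'm::finite \<Rightarrow> real ^ ('m option) \<Rightarrow> real ^ ('m option)" where
  "shearlet_inv a s z = vec_cons ((z $ None - s \<bullet> vec_tl z) / a) ((1 / dilation_factor TYPE('m) a) *\<^sub>R vec_tl z)"

lemma matrix_inv_shearlet_mult:
  fixes s :: "real ^ 'm::finite"
  assumes "a \<noteq> 0"
  shows "matrix_inv (shearlet_matrix a s) *v z = shearlet_inv a s z"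
proof -
  have "matrix_inv (shearlet_matrix a s) *v vec_cons (z $ None) (vec_tl z) = shearlet_inv a s z"
    unfolding shearlet_matrix_inverse(3)[OF assms] matrix_vector_mul_assoc[symmetric] shear_vec_cons dilation_vec_cons
      dilation_factor_inverse[OF assms] shearlet_inv_def by simp
  then show ?thesis unfolding vec_cons_hd_tl .
qed

lemma shearlet_inv_measurable [measurable (raw)]:
  fixes z :: "'z \<Rightarrow> real ^ ('m::finite option)"
  assumes [measurable]: "a \<in> borel_measurable M" "s \<in> borel_measurable M" "z \<in> borel_measurable M"
  shows "(\<lambda>x. shearlet_inv (a x) (s x) (z x)) \<in> borel_measurable M"
  unfolding shearlet_inv_def by measurable

text \<open>A version of the shearlet that is jointly measurable by inspection: \<^const>\<open>matrix_inv\<close> is replaced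
  by the explicit inverse, which is meaningful only for \<open>a \<noteq> 0\<close>.\<close>

definition shearlet_explicit ::
    "(real ^ ('m::finite option) \<Rightarrow> complex) \<Rightarrow> real \<Rightarrow> real ^ 'm \<Rightarrow> real ^ ('m option) \<Rightarrow> real ^ ('m option) \<Rightarrow> complex" where
  "shearlet_explicit \<psi> a s t x =
     complex_of_real ((\<bar>a\<bar> powr (1 + real CARD('m) / real CARD('m option))) powr (- 1 / 2)) * \<psi> (shearlet_inv a s (x - t))"

lemma shearlet_eq_explicit: "a \<noteq> 0 \<Longrightarrow> shearlet \<psi> a s t x = shearlet_explicit \<psi> a s t x"
  by (simp add: shearlet_def shearlet_explicit_def abs_det_shearlet_matrix_powr matrix_inv_shearlet_mult)

definition shearlet_transform_explicit ::
    "(real ^ ('m::finite option) \<Rightarrow> complex) \<Rightarrow> (real ^ ('m option) \<Rightarrow> complex) \<Rightarrow> real \<Rightarrow> real ^ 'm \<Rightarrow> real ^ ('m option) \<Rightarrow> complex" where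
  "shearlet_transform_explicit \<psi> f a s t = (LINT x|lborel. f x * cnj (shearlet_explicit \<psi> a s t x))"

lemma shearlet_transform_eq_explicit:
  "a \<noteq> 0 \<Longrightarrow> shearlet_transform \<psi> f a s t = shearlet_transform_explicit \<psi> f a s t"
  by (simp add: shearlet_transform_def shearlet_transform_explicit_def shearlet_eq_explicit)

lemma shearlet_transform_explicit_measurable:
  fixes \<psi> f :: "real ^ ('m::finite option) \<Rightarrow> complex"
  assumes [measurable]: "\<psi> \<in> borel_measurable borel" "f \<in> borel_measurable borel"
  shows "(\<lambda>(a, s, t). shearlet_transform_explicit \<psi> f a s t) \<in> borel_measurable (borel \<Otimes>\<^sub>M (borel \<Otimes>\<^sub>M borel))"
  unfolding shearlet_transform_explicit_def shearlet_explicit_def case_prod_beta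
  by (rule lborel.borel_measurable_lebesgue_integral) measurable

text \<open>Pitt's inequality in \<open>t\<close> for the correlation with k \<psi>(N x), where k =
  \<delta>^(-1/2) and \<delta> = |det M|. The dilation rule contributes a further \<delta>, so the
  transform carries \<delta>^(1/2) and its square the factor |det M| on the left.\<close>

lemma pitt_shearlet:
  fixes \<psi> f :: "real ^ ('m::finite option) \<Rightarrow> complex" and s :: "real ^ 'm"
  assumes lam: "0 \<le> lam" "lam < 1" and a: "a \<noteq> 0"
    and \<psi>: "square_integrable \<psi>" and f: "integrable lborel f" "square_integrable f"
  shows "(\<integral>\<^sup>+\<xi>. ennreal (\<bar>det (shearlet_matrix a s)\<bar> * (norm \<xi> powr - lam * (norm (fourier f \<xi>))\<^sup>2 *
      (norm (fourier_L2 \<psi> (transpose (shearlet_matrix a s) *v \<xi>)))\<^sup>2)) \<partial>lborel)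
    \<le> ennreal (pitt_const CARD('m option) lam) *
      (\<integral>\<^sup>+t. ennreal (norm t powr lam * (norm (shearlet_transform \<psi> f a s t))\<^sup>2) \<partial>lborel)"
proof -
  let ?M = "shearlet_matrix a s"
  let ?N = "matrix_inv ?M"
  define \<delta> where "\<delta> = \<bar>det ?M\<bar>"
  define k where "k = complex_of_real (\<delta> powr (- 1 / 2))"
  have \<delta>: "\<delta> > 0" using a by (simp add: \<delta>_def abs_det_shearlet_matrix_powr)
  have NM: "?N ** ?M = mat 1" unfolding shearlet_matrix_inverse(3)[OF a] by (rule shearlet_matrix_inverse(1)[OF a])
  have M: "(\<integral>\<^sup>+x. h x \<partial>lborel) = ennreal \<delta> * (\<integral>\<^sup>+x. h (?M *v x) \<partial>lborel)"
    and T: "(\<integral>\<^sup>+x. h x \<partial>lborel) = ennreal \<delta> * (\<integral>\<^sup>+x. h (transpose ?M *v x) \<partial>lborel)"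
    if "h \<in> borel_measurable borel" for h
    unfolding \<delta>_def using nn_integral_shearlet_matrix[OF that a] by blast+
  note \<phi> = is_fourier_L2_matrix[where M = "?M" and N = "?N" and \<delta> = \<delta> and k = k and f = \<psi>,
      OF M T NM \<delta> \<psi> is_fourier_L2_fourier_L2[OF \<psi>]]
  note corr = is_fourier_L2_correlation[OF f \<phi>(2) \<phi>(1)]
  have eq: "correlation f (\<lambda>x. k * \<psi> (?N *v x)) = shearlet_transform \<psi> f a s"
    by (simp add: fun_eq_iff correlation_def shearlet_transform_def shearlet_def k_def \<delta>_def)
  have "lam < real DIM(real ^ ('m option))" using lam by simp
  note pitt = pitt_inequality[OF lam(1) this corr(2) corr(1), unfolded eq]
  have "norm \<xi> powr - lam * (norm (fourier f \<xi> * cnj (k * complex_of_real \<delta> * fourier_L2 \<psi> (transpose ?M *v \<xi>))))\<^sup>2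
     = \<delta> * (norm \<xi> powr - lam * (norm (fourier f \<xi>))\<^sup>2 * (norm (fourier_L2 \<psi> (transpose ?M *v \<xi>)))\<^sup>2)" for \<xi>
  proof -
    have "(norm k * \<delta>)\<^sup>2 = \<delta>"
    proof -
      have "norm k * \<delta> = \<delta> powr (- 1 / 2) * \<delta> powr 1" using \<delta> by (simp add: k_def)
      also have "\<dots> = \<delta> powr (1 / 2)" unfolding powr_add[symmetric] by simp
      finally show ?thesis using \<delta> by (simp add: powr_power)
    qed
    then show ?thesis using \<delta> unfolding complex_mod_cnj norm_mult norm_of_real power_mult_distrib
      by (simp add: ac_simps del: transpose_matrix_vector)
  qed
  then show ?thesis using pitt unfolding \<delta>_def[symmetric] by (simp only: DIM_cart DIM_real mult_1_right)
qed

text \<open>At a = 0 the shearlet transform involves an unspecified matrix inverse. Measurability is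
  therefore asked of a function \<open>G\<close> that agrees with \<open>F\<close> where the measure
  lives.\<close>

lemma nn_integral_shearlet_measure:
  fixes G :: "real \<Rightarrow> real ^ 'm::finite \<Rightarrow> real ^ ('m option) \<Rightarrow> ennreal"
  assumes m: "(\<lambda>(a, s, t). G a s t) \<in> borel_measurable (borel \<Otimes>\<^sub>M (borel \<Otimes>\<^sub>M borel))"
    and F: "\<And>a s t. a \<noteq> 0 \<Longrightarrow> F a s t = G a s t"
  shows "(\<integral>\<^sup>+(a, s, t). F a s t \<partial>shearlet_measure)
    = (\<integral>\<^sup>+a. \<integral>\<^sup>+s. ennreal (indicator {a. a \<noteq> 0} a / \<bar>a\<bar> ^ (CARD('m option) + 1)) * (\<integral>\<^sup>+t. G a s t \<partial>lborel) \<partial>lborel \<partial>lborel)"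
proof -
  let ?\<Omega> = "{(a, s, t). a \<noteq> 0} :: (real \<times> (real ^ 'm) \<times> (real ^ ('m option))) set"
  let ?d = "\<lambda>(a, s :: real ^ 'm, t :: real ^ ('m option)). ennreal (1 / \<bar>a\<bar> ^ (CARD('m option) + 1))"
  let ?G = "\<lambda>(a, s, t). G a s t"
  have b3: "borel \<Otimes>\<^sub>M (borel \<Otimes>\<^sub>M borel) = (borel :: (real \<times> (real ^ 'm) \<times> (real ^ ('m option))) measure)"
    by (simp add: borel_prod)
  have mG: "?G \<in> borel_measurable borel" using m unfolding b3 .
  have "?d \<in> borel_measurable (borel \<Otimes>\<^sub>M (borel \<Otimes>\<^sub>M borel))" by measurable
  then have md: "?d \<in> borel_measurable borel" unfolding b3 .
  have \<Omega>: "?\<Omega> \<in> sets borel"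
  proof -
    have "?\<Omega> = {p. fst p \<noteq> 0}" by auto
    also have "open \<dots>" by (intro open_Collect_neq continuous_intros)
    finally show ?thesis by simp
  qed
  have "(\<integral>\<^sup>+(a, s, t). F a s t \<partial>shearlet_measure) = (\<integral>\<^sup>+p. ?G p \<partial>shearlet_measure)"
    by (rule nn_integral_cong) (auto simp: shearlet_measure_def space_restrict_space F)
  also have "\<dots> = (\<integral>\<^sup>+p. ?d p * ?G p \<partial>restrict_space lborel ?\<Omega>)"
    unfolding shearlet_measure_def using mG md by (intro nn_integral_density measurable_restrict_space1) simp_all
  also have "\<dots> = (\<integral>\<^sup>+p. ?d p * ?G p * indicator ?\<Omega> p \<partial>lborel)"
    using \<Omega> by (intro nn_integral_restrict_space) simp
  also have "\<dots> = (\<integral>\<^sup>+a. \<integral>\<^sup>+q. ?d (a, q) * ?G (a, q) * indicator ?\<Omega> (a, q) \<partial>lborel \<partial>lborel)"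
    by (intro nn_integral_lborel_prod borel_measurable_times_ennreal mG md borel_measurable_indicator \<Omega>)
  also have "\<dots> = (\<integral>\<^sup>+a. \<integral>\<^sup>+s. ennreal (indicator {a. a \<noteq> 0} a / \<bar>a\<bar> ^ (CARD('m option) + 1)) * (\<integral>\<^sup>+t. G a s t \<partial>lborel) \<partial>lborel \<partial>lborel)"
  proof (rule nn_integral_cong)
    fix a :: real
    let ?w = "ennreal (indicator {a. a \<noteq> 0} a / \<bar>a\<bar> ^ (CARD('m option) + 1))"
    have "Pair a \<in> (borel \<Otimes>\<^sub>M borel) \<rightarrow>\<^sub>M (borel \<Otimes>\<^sub>M (borel \<Otimes>\<^sub>M borel))" by simp
    from measurable_compose[OF this m] have m0: "(\<lambda>q. ?G (a, q)) \<in> borel_measurable (borel \<Otimes>\<^sub>M borel)" .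
    then have m1: "(\<lambda>q. case q of (s, t) \<Rightarrow> ?w * G a s t) \<in> borel_measurable (borel \<Otimes>\<^sub>M borel)"
      unfolding case_prod_beta fst_conv snd_conv by (rule borel_measurable_times_ennreal[OF borel_measurable_const])
    have m2: "(\<lambda>t. G a s t) \<in> borel_measurable borel" for s
    proof -
      have "Pair s \<in> borel \<rightarrow>\<^sub>M (borel \<Otimes>\<^sub>M borel)" by simp
      from measurable_compose[OF this m0] show ?thesis by simp
    qed
    have "(\<integral>\<^sup>+q. ?d (a, q) * ?G (a, q) * indicator ?\<Omega> (a, q) \<partial>lborel) = (\<integral>\<^sup>+q. (case q of (s, t) \<Rightarrow> ?w * G a s t) \<partial>lborel)"
      by (rule nn_integral_cong) (auto simp: indicator_def)
    also have "\<dots> = (\<integral>\<^sup>+s. \<integral>\<^sup>+t. ?w * G a s t \<partial>lborel \<partial>lborel)"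
    proof -
      have "(\<lambda>q. case q of (s, t) \<Rightarrow> ?w * G a s t) \<in> borel_measurable borel" using m1 by (simp only: borel_prod)
      from nn_integral_lborel_prod[OF this] show ?thesis by (simp only: prod.case)
    qed
    also have "\<dots> = (\<integral>\<^sup>+s. ?w * (\<integral>\<^sup>+t. G a s t \<partial>lborel) \<partial>lborel)"
      by (rule nn_integral_cong, rule nn_integral_cmult) (simp add: m2)
    finally show "(\<integral>\<^sup>+q. ?d (a, q) * ?G (a, q) * indicator ?\<Omega> (a, q) \<partial>lborel) = (\<integral>\<^sup>+s. ?w * (\<integral>\<^sup>+t. G a s t \<partial>lborel) \<partial>lborel)" .
  qed
  finally show ?thesis .
qed

text \<open>The identity (2 - 1/n) - (n + 1) = -((n - 1) + 1/n): the determinant from Pitt's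
  inequality and the density of \<open>shearlet_measure\<close> together give the weight of the
  admissibility integral.\<close>

lemma det_div_powr:
  fixes s :: "real ^ 'm::finite"
  assumes "a \<noteq> 0"
  shows "\<bar>det (shearlet_matrix a s)\<bar> / \<bar>a\<bar> ^ (CARD('m option) + 1) = \<bar>a\<bar> powr - admissibility_exponent TYPE('m)"
proof -
  have "1 + real CARD('m) / real CARD('m option) - real (CARD('m option) + 1) = - admissibility_exponent TYPE('m)"
    unfolding admissibility_exponent_eq by (simp add: field_simps)
  moreover have "\<bar>a\<bar> ^ (CARD('m option) + 1) = \<bar>a\<bar> powr real (CARD('m option) + 1)"
    using assms by (subst powr_realpow) simp_all
  ultimately show ?thesis
    unfolding abs_det_shearlet_matrix_powr[OF assms] by (simp only: powr_diff[symmetric])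
qed

lemma ennreal_rearrange:
  fixes A D P q :: real
  assumes "0 \<le> A" "0 \<le> D" "0 \<le> P" "0 \<le> q"
  shows "ennreal (D / A) * ennreal q * ennreal P = ennreal (1 / A) * ennreal (D * (P * q))"
proof -
  have "D / A * q * P = 1 / A * (D * (P * q))" by simp
  then show ?thesis
    using assms by (simp only: ennreal_mult[symmetric] mult_nonneg_nonneg divide_nonneg_nonneg zero_le_one)
qed

theorem theorem2p3:
  fixes \<psi> f :: "real ^ ('m::finite option) \<Rightarrow> complex"
    and \<xi>\<^sub>0 :: "real ^ ('m option)"
    and lam :: real
  assumes "admissible_shearlet \<psi>"
    and "\<xi>\<^sub>0 $ None \<noteq> 0"
    and "0 \<le> lam" and "lam < 1"
    and "schwartz f"
  shows "admissibility_integral \<psi> \<xi>\<^sub>0 *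
           (\<integral>\<^sup>+\<xi>. ennreal (norm \<xi> powr (- lam) * (norm (fourier f \<xi>))\<^sup>2) \<partial>lborel)
         \<le> ennreal (pitt_const CARD('m option) lam) *
           (\<integral>\<^sup>+(a, s, t). ennreal (norm t powr lam * (norm (shearlet_transform \<psi> f a s t))\<^sup>2)
              \<partial>shearlet_measure)"
proof -
  have \<psi>: "square_integrable \<psi>" using assms(1) by (simp add: admissible_shearlet_def)
  note f = schwartz_integrable[OF assms(5)]
  define \<Psi> where "\<Psi> = fourier_L2 \<psi>"
  have [measurable]: "\<psi> \<in> borel_measurable borel" "f \<in> borel_measurable borel" "\<Psi> \<in> borel_measurable borel"
    using \<psi> f is_fourier_L2_fourier_L2[OF \<psi>] by (auto simp: square_integrable_def is_fourier_L2_def \<Psi>_def)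
  define p where "p = admissibility_exponent TYPE('m)"
  let ?C = "ennreal (pitt_const CARD('m option) lam)"
  let ?P = "\<lambda>\<xi>. ennreal (norm \<xi> powr - lam * (norm (fourier f \<xi>))\<^sup>2)"
  let ?E = "\<lambda>a. ennreal (indicator {a. a \<noteq> 0} a * \<bar>a\<bar> powr - p)"
  let ?w = "\<lambda>a. ennreal (indicator {a. a \<noteq> 0} a / \<bar>a\<bar> ^ (CARD('m option) + 1))"
  let ?Q = "\<lambda>a s \<xi>. ennreal ((norm (\<Psi> (transpose (shearlet_matrix a s) *v \<xi>)))\<^sup>2)"
  let ?G = "\<lambda>a s t. ennreal (norm t powr lam * (norm (shearlet_transform_explicit \<psi> f a s t))\<^sup>2)"
  \<comment> \<open>Both sides equal one canonical integral in which no frequency occurs.\<close>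
  have adm: "admissibility_integral \<psi> \<xi> = admissibility_integral \<psi> \<xi>\<^sub>0" if "\<xi> $ None \<noteq> 0" for \<xi>
    using admissibility_integral_eq_canonical[of \<psi>, OF _ that] admissibility_integral_eq_canonical[of \<psi>, OF _ assms(2)]
      \<open>\<Psi> \<in> borel_measurable borel\<close> unfolding \<Psi>_def by simp
  note stm = shearlet_transform_explicit_measurable[OF \<open>\<psi> \<in> borel_measurable borel\<close> \<open>f \<in> borel_measurable borel\<close>]
  have mG: "(\<lambda>(a, s, t). ?G a s t) \<in> borel_measurable (borel \<Otimes>\<^sub>M (borel \<Otimes>\<^sub>M borel))"
  proof -
    have "(\<lambda>x. norm (shearlet_transform_explicit \<psi> f (fst x) (fst (snd x)) (snd (snd x)))) \<in> borel_measurable (borel \<Otimes>\<^sub>M (borel \<Otimes>\<^sub>M borel))"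
      using stm unfolding case_prod_beta by (rule measurable_compose) measurable
    then show ?thesis unfolding case_prod_beta by measurable
  qed
  have "admissibility_integral \<psi> \<xi>\<^sub>0 * (\<integral>\<^sup>+\<xi>. ?P \<xi> \<partial>lborel) = (\<integral>\<^sup>+\<xi>. admissibility_integral \<psi> \<xi>\<^sub>0 * ?P \<xi> \<partial>lborel)"
    by (rule nn_integral_cmult[symmetric]) measurable
  \<comment> \<open>The constant is replaced, under the integral, by the admissibility integral at
    the running frequency; the hyperplane \<xi>_1 = 0 is null.\<close>
  also have "\<dots> = (\<integral>\<^sup>+\<xi>. (\<integral>\<^sup>+s. \<integral>\<^sup>+a. ?E a * ?Q a s \<xi> \<partial>lborel \<partial>lborel) * ?P \<xi> \<partial>lborel)"
  proof (rule nn_integral_cong_AE, rule eventually_mono[OF AE_nth_None_neq_0])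
    fix \<xi> :: "real ^ ('m option)" assume "\<xi> $ None \<noteq> 0"
    from adm[OF this] show "admissibility_integral \<psi> \<xi>\<^sub>0 * ?P \<xi> = (\<integral>\<^sup>+s. \<integral>\<^sup>+a. ?E a * ?Q a s \<xi> \<partial>lborel \<partial>lborel) * ?P \<xi>"
      unfolding admissibility_integral_eq[of \<psi> \<xi>] \<Psi>_def p_def by (simp only:)
  qed
  also have "\<dots> = (\<integral>\<^sup>+\<xi>. \<integral>\<^sup>+s. (\<integral>\<^sup>+a. ?E a * ?Q a s \<xi> * ?P \<xi> \<partial>lborel) \<partial>lborel \<partial>lborel)"
  proof (rule nn_integral_cong)
    fix \<xi>
    have "(\<integral>\<^sup>+s. \<integral>\<^sup>+a. ?E a * ?Q a s \<xi> \<partial>lborel \<partial>lborel) * ?P \<xi> = (\<integral>\<^sup>+s. (\<integral>\<^sup>+a. ?E a * ?Q a s \<xi> \<partial>lborel) * ?P \<xi> \<partial>lborel)"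
      by (rule nn_integral_multc[symmetric]) measurable
    also have "\<dots> = (\<integral>\<^sup>+s. (\<integral>\<^sup>+a. ?E a * ?Q a s \<xi> * ?P \<xi> \<partial>lborel) \<partial>lborel)"
      by (rule nn_integral_cong, rule nn_integral_multc[symmetric]) measurable
    finally show "(\<integral>\<^sup>+s. \<integral>\<^sup>+a. ?E a * ?Q a s \<xi> \<partial>lborel \<partial>lborel) * ?P \<xi> = (\<integral>\<^sup>+s. (\<integral>\<^sup>+a. ?E a * ?Q a s \<xi> * ?P \<xi> \<partial>lborel) \<partial>lborel)" .
  qed
  \<comment> \<open>Three uses of Tonelli make \<xi> innermost, so that Pitt's inequality applies
    for fixed \<open>a\<close> and \<open>s\<close>, and \<open>a\<close> outermost, as in the
    iterated form of \<open>shearlet_measure\<close>.\<close>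
  also have "\<dots> = (\<integral>\<^sup>+s. \<integral>\<^sup>+\<xi>. (\<integral>\<^sup>+a. ?E a * ?Q a s \<xi> * ?P \<xi> \<partial>lborel) \<partial>lborel \<partial>lborel)"
    by (rule lborel_pair.Fubini') measurable
  also have "\<dots> = (\<integral>\<^sup>+s. \<integral>\<^sup>+a. (\<integral>\<^sup>+\<xi>. ?E a * ?Q a s \<xi> * ?P \<xi> \<partial>lborel) \<partial>lborel \<partial>lborel)"
    by (rule nn_integral_cong, rule lborel_pair.Fubini') measurable
  also have "\<dots> = (\<integral>\<^sup>+a. \<integral>\<^sup>+s. (\<integral>\<^sup>+\<xi>. ?E a * ?Q a s \<xi> * ?P \<xi> \<partial>lborel) \<partial>lborel \<partial>lborel)"
    by (rule lborel_pair.Fubini') measurable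
  \<comment> \<open>The inequality holds for each \<open>a\<close> and \<open>s\<close> separately;
    at a = 0 the weight \<open>?E a\<close> is 0.\<close>
  also have "\<dots> \<le> (\<integral>\<^sup>+a. \<integral>\<^sup>+s. ?C * (?w a * (\<integral>\<^sup>+t. ?G a s t \<partial>lborel)) \<partial>lborel \<partial>lborel)"
  proof (intro nn_integral_mono)
    fix a :: real and s :: "real ^ 'm"
    show "(\<integral>\<^sup>+\<xi>. ?E a * ?Q a s \<xi> * ?P \<xi> \<partial>lborel) \<le> ?C * (?w a * (\<integral>\<^sup>+t. ?G a s t \<partial>lborel))"
    proof (cases "a = 0")
      case False
      let ?D = "\<bar>det (shearlet_matrix a s)\<bar>"
      have w: "?w a = ennreal (1 / \<bar>a\<bar> ^ (CARD('m option) + 1))" "?E a = ennreal (?D / \<bar>a\<bar> ^ (CARD('m option) + 1))"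
        unfolding p_def det_div_powr[OF False] using False by simp_all
      have "?E a * ?Q a s \<xi> * ?P \<xi> = ?w a * ennreal (?D * (norm \<xi> powr - lam * (norm (fourier f \<xi>))\<^sup>2 * (norm (\<Psi> (transpose (shearlet_matrix a s) *v \<xi>)))\<^sup>2))" for \<xi>
        unfolding w by (rule ennreal_rearrange) (simp_all del: transpose_matrix_vector)
      then have "(\<integral>\<^sup>+\<xi>. ?E a * ?Q a s \<xi> * ?P \<xi> \<partial>lborel)
        = ?w a * (\<integral>\<^sup>+\<xi>. ennreal (?D * (norm \<xi> powr - lam * (norm (fourier f \<xi>))\<^sup>2 * (norm (\<Psi> (transpose (shearlet_matrix a s) *v \<xi>)))\<^sup>2)) \<partial>lborel)"
        by (simp only:) (rule nn_integral_cmult, measurable)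
      also have "\<dots> \<le> ?w a * (?C * (\<integral>\<^sup>+t. ?G a s t \<partial>lborel))"
        using pitt_shearlet[OF assms(3,4) False \<psi> f, of s]
        unfolding shearlet_transform_eq_explicit[OF False] \<Psi>_def by (rule mult_left_mono) simp
      finally show ?thesis by (simp only: ac_simps)
    qed simp
  qed
  also have "\<dots> = ?C * (\<integral>\<^sup>+a. \<integral>\<^sup>+s. ?w a * (\<integral>\<^sup>+t. ?G a s t \<partial>lborel) \<partial>lborel \<partial>lborel)"
  proof -
    have [measurable]: "(\<lambda>x. ?G (a x) (s x) (t x)) \<in> borel_measurable N"
      if "a \<in> borel_measurable N" "s \<in> borel_measurable N" "t \<in> borel_measurable N" for a s t and N :: "'z measure"
      using measurable_compose[OF measurable_Pair[OF that(1) measurable_Pair[OF that(2,3)]] mG] by simp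
    have "(\<integral>\<^sup>+s. ?C * (?w a * (\<integral>\<^sup>+t. ?G a s t \<partial>lborel)) \<partial>lborel) = ?C * (\<integral>\<^sup>+s. ?w a * (\<integral>\<^sup>+t. ?G a s t \<partial>lborel) \<partial>lborel)" for a
      by (rule nn_integral_cmult) measurable
    then have "(\<integral>\<^sup>+a. \<integral>\<^sup>+s. ?C * (?w a * (\<integral>\<^sup>+t. ?G a s t \<partial>lborel)) \<partial>lborel \<partial>lborel)
      = (\<integral>\<^sup>+a. ?C * (\<integral>\<^sup>+s. ?w a * (\<integral>\<^sup>+t. ?G a s t \<partial>lborel) \<partial>lborel) \<partial>lborel)"
      by (simp only:)
    also have "\<dots> = ?C * (\<integral>\<^sup>+a. \<integral>\<^sup>+s. ?w a * (\<integral>\<^sup>+t. ?G a s t \<partial>lborel) \<partial>lborel \<partial>lborel)"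
      by (rule nn_integral_cmult) measurable
    finally show ?thesis .
  qed
  also have "(\<integral>\<^sup>+a. \<integral>\<^sup>+s. ?w a * (\<integral>\<^sup>+t. ?G a s t \<partial>lborel) \<partial>lborel \<partial>lborel)
     = (\<integral>\<^sup>+(a, s, t). ennreal (norm t powr lam * (norm (shearlet_transform \<psi> f a s t))\<^sup>2) \<partial>shearlet_measure)"
    by (rule nn_integral_shearlet_measure[OF mG, symmetric]) (simp add: shearlet_transform_eq_explicit)
  finally show ?thesis .
qed

end
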